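(* Let $G=\mathrm{SL}(3,\mathbb{R})$, let $H$ be a closed, connected subgroup of $AN$, with Lie algebra $\mathfrak h$, that is compatible with $A$, and let $\rho(g)=g\wedge g$ on $\mathbb{R}^3\wedge\mathbb{R}^3$. (1) If $\mathfrak h=\mathfrak u_\alpha+\mathfrak u_{\alpha+\beta}$ or $\mathfrak h=\mathfrak u_\beta+\mathfrak u_{\alpha+\beta}$, then $\rho(h)\asymp h$ for $h\in H$. (2) If $\mathfrak h=\ker(\alpha-\beta)+\mathfrak u$ for some one-dimensional subspace $\mathfrak u$ of $\mathfrak u_\alpha+\mathfrak u_\beta$ with $\mathfrak u\notin\{\mathfrak u_\alpha,\mathfrak u_\beta\}$ (where $\ker(\alpha-\beta)\subset\mathfrak a$), then $\rho(h)\asymp h$ for $h\in H$. (3) If $\dim H=2$ and $H\neq(H\cap A)\ltimes(H\cap N)$, then $\mu(H)\approx\bigl[(\|h\|\log\|h\|)^{1/2},\ \|h\|^2/(\log\|h\|)\bigr]$.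
   Context: $A$ is the group of diagonal matrices in $\mathrm{SL}(3,\mathbb{R})$ with positive entries, $N$ is the group of upper-triangular matrices with $1$'s on the diagonal, $K=\mathrm{SO}(3)$, and $A^+=\{\mathrm{diag}(a_1,a_2,a_3)\in A: a_1\ge a_2\ge a_3>0\}$. The Cartan projection $\mu:G\to A^+$ sends $g$ to the unique element of $A^+$ with $g\in K\mu(g)K$. $\mathfrak a$ is the Lie algebra of $A$. The roots are $\alpha(a)=a_1/a_2$, $\beta(a)=a_2/a_3$, $\alpha+\beta$ (also viewed as linear functionals on $\mathfrak a$), and $\mathfrak u_\alpha,\mathfrak u_\beta,\mathfrak u_{\alpha+\beta}$ consist of the matrices whose only possibly nonzero entry is the $(1,2)$, $(2,3)$, $(1,3)$ entry respectively. A subgroup $H$ of $AN$ is compatible with $A$ if $H\subset T\,U\,C_N(T)$, where $T=A\cap(HN)$, $U=H\cap N$, and $C_N(T)$ is the centralizer of $T$ in $N$. Norms are any fixed norms on spaces of matrices. $\rho(h)\asymp h$ for $h\in H$ means there is a constant $c\geq 1$ with $c^{-1}\|h\|\le\|\rho(h)\|\le c\|h\|$ for all sufficiently large $h\in H$ (all $h$ outside some compact set). For $X,Y\subset A^+$, $X\approx Y$ means there is a compact $C\subset A$ with $X\subset YC$ and $Y\subset XC$. For functions $f_1,f_2$, the notation $\mu(H)\approx[f_1(\|h\|),f_2(\|h\|)]$ means that for every sufficiently large $C>1$, $\mu(H)\approx\{a\in A^+: C^{-1}f_1(\|a\|)\le\|\rho(a)\|\le Cf_2(\|a\|)\}$ (bounded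 subsets of $A^+$ are irrelevant here, so the $f_i$ need only be defined and positive for large arguments). *)

theory Defs
  imports "HOL-Analysis.Analysis" "HOL-Algebra.Coset"
begin

type_synonym mat3 = "real^3^3"

section \<open>The group and its subgroups\<close>

definition SL3 :: "mat3 monoid" where
  "SL3 = \<lparr>carrier = {g. det g = 1}, mult = (**), one = mat 1\<rparr>"

definition SO3 :: "mat3 set" where
  "SO3 = {k. orthogonal_matrix k \<and> det k = 1}"

definition A_grp :: "mat3 set" where
  "A_grp = {a \<in> carrier SL3. (\<forall>i j. i \<noteq> j \<longrightarrow> a$i$j = 0) \<and> (\<forall>i. a$i$i > 0)}"

text \<open>
  Entries are spelled out because the numeral \<open>3\<close> of the index type \<open>3\<close> is \<open>0\<close>,
  so its built-in order is not \<open>1 < 2 < 3\<close>.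
\<close>
definition N_grp :: "mat3 set" where
  "N_grp = {n. (\<forall>i. n$i$i = 1) \<and> n$2$1 = 0 \<and> n$3$1 = 0 \<and> n$3$2 = 0}"

definition A_plus :: "mat3 set" where
  "A_plus = {a \<in> A_grp. a$1$1 \<ge> a$2$2 \<and> a$2$2 \<ge> a$3$3}"

definition cartan_proj :: "mat3 \<Rightarrow> mat3" where
  "cartan_proj g = (THE a. a \<in> A_plus \<and> g \<in> (SO3 <#>\<^bsub>SL3\<^esub> {a}) <#>\<^bsub>SL3\<^esub> SO3)"

definition centralizer_in_N :: "mat3 set \<Rightarrow> mat3 set" where
  "centralizer_in_N T = {n \<in> N_grp. \<forall>t\<in>T. n ** t = t ** n}"

definition compatible_with_A :: "mat3 set \<Rightarrow> bool" where
  "compatible_with_A H \<longleftrightarrow>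
     (let T = A_grp \<inter> (H <#>\<^bsub>SL3\<^esub> N_grp); U = H \<inter> N_grp
      in H \<subseteq> (T <#>\<^bsub>SL3\<^esub> U) <#>\<^bsub>SL3\<^esub> centralizer_in_N T)"

section \<open>Lie algebras and roots\<close>

text \<open>
  The product of the type class \<open>times\<close> on \<open>real^3^3\<close> is componentwise, so the library's
  \<open>exp\<close> and power are not the ones of the matrix algebra.
\<close>
definition mat_exp :: "mat3 \<Rightarrow> mat3" where
  "mat_exp X = (\<Sum>n. (1 / fact n) *\<^sub>R ((\<lambda>Y. X ** Y) ^^ n) (mat 1))"

text \<open>The Lie algebra of a closed subgroup of \<open>SL(3,\<real>)\<close>, inside the space of all matrices.\<close>
definition lie_alg :: "mat3 set \<Rightarrow> mat3 set" where
  "lie_alg H = {X. \<forall>t::real. mat_exp (t *\<^sub>R X) \<in> H}"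

definition root_alpha :: "mat3 \<Rightarrow> real" where
  "root_alpha X = X$1$1 - X$2$2"

definition root_beta :: "mat3 \<Rightarrow> real" where
  "root_beta X = X$2$2 - X$3$3"

definition u_alpha :: "mat3 set" where
  "u_alpha = {X. \<forall>i j. (i, j) \<noteq> (1, 2) \<longrightarrow> X$i$j = 0}"

definition u_beta :: "mat3 set" where
  "u_beta = {X. \<forall>i j. (i, j) \<noteq> (2, 3) \<longrightarrow> X$i$j = 0}"

definition u_alpha_beta :: "mat3 set" where
  "u_alpha_beta = {X. \<forall>i j. (i, j) \<noteq> (1, 3) \<longrightarrow> X$i$j = 0}"

definition ker_alpha_minus_beta :: "mat3 set" where
  "ker_alpha_minus_beta = {X \<in> lie_alg A_grp. root_alpha X - root_beta X = 0}"

section \<open>The exterior square\<close>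

text \<open>
  \<open>\<real>\<^sup>3 \<and> \<real>\<^sup>3\<close> in coordinates with respect to the basis
  \<open>e\<^sub>1 \<and> e\<^sub>2\<close>, \<open>e\<^sub>1 \<and> e\<^sub>3\<close>, \<open>e\<^sub>2 \<and> e\<^sub>3\<close>.
\<close>
definition wedge :: "real^3 \<Rightarrow> real^3 \<Rightarrow> real^3" where
  "wedge v w = vector [v$1 * w$2 - v$2 * w$1, v$1 * w$3 - v$3 * w$1, v$2 * w$3 - v$3 * w$2]"

text \<open>
  The matrix of \<open>g \<and> g\<close>: the columns are \<open>g e\<^sub>i \<and> g e\<^sub>j\<close> for \<open>i < j\<close>.
\<close>
definition rho :: "mat3 \<Rightarrow> mat3" where
  "rho g = transpose (vector [wedge (column 1 g) (column 2 g),
                              wedge (column 1 g) (column 3 g),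
                              wedge (column 2 g) (column 3 g)])"

lemma rho_wedge: "rho g *v wedge v w = wedge (g *v v) (g *v w)"
  unfolding rho_def wedge_def
  by (simp add: vec_eq_iff forall_3 sum_3 matrix_vector_mult_def transpose_def column_def
      vector_3 algebra_simps)

lemma rho_unique:
  assumes "\<And>v w. M *v wedge v w = wedge (g *v v) (g *v w)"
  shows "M = rho g"
proof -
  have "wedge (axis 1 1) (axis 2 1) = axis 1 1"
    "wedge (axis 1 1) (axis 3 1) = axis 2 1"
    "wedge (axis 2 1) (axis 3 1) = axis 3 1"
    by (simp_all add: wedge_def vec_eq_iff forall_3 axis_def vector_3)
  then have "M *v axis k 1 = rho g *v axis k 1" for k :: 3
    using assms rho_wedge exhaust_3[of k] by metis
  then show ?thesis
    by (simp add: matrix_vector_mult_basis column_def vec_eq_iff)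
qed

section \<open>Norms and coarse comparison\<close>

definition is_norm :: "('a::real_vector \<Rightarrow> real) \<Rightarrow> bool" where
  "is_norm \<nu> \<longleftrightarrow> (\<forall>x. \<nu> x = 0 \<longleftrightarrow> x = 0) \<and> (\<forall>c x. \<nu> (c *\<^sub>R x) = \<bar>c\<bar> * \<nu> x) \<and>
     (\<forall>x y. \<nu> (x + y) \<le> \<nu> x + \<nu> y)"

text \<open>
  In the following, \<open>\<nu>\<close> measures elements \<open>h\<close> of \<open>SL(3,\<real>)\<close> and \<open>\<nu>'\<close> measures \<open>rho h\<close>.
\<close>
definition rho_comparable :: "(mat3 \<Rightarrow> real) \<Rightarrow> (mat3 \<Rightarrow> real) \<Rightarrow> mat3 set \<Rightarrow> bool" where
  "rho_comparable \<nu> \<nu>' H \<longleftrightarrow>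
     (\<exists>c\<ge>1. \<exists>C. compact C \<and>
        (\<forall>h\<in>H - C. inverse c * \<nu> h \<le> \<nu>' (rho h) \<and> \<nu>' (rho h) \<le> c * \<nu> h))"

definition coarse_eq :: "mat3 set \<Rightarrow> mat3 set \<Rightarrow> bool" where
  "coarse_eq X Y \<longleftrightarrow>
     (\<exists>C. compact C \<and> C \<subseteq> A_grp \<and> X \<subseteq> Y <#>\<^bsub>SL3\<^esub> C \<and> Y \<subseteq> X <#>\<^bsub>SL3\<^esub> C)"

text \<open>
  \<open>\<mu>(H) \<approx> [f\<^sub>1(\<parallel>h\<parallel>), f\<^sub>2(\<parallel>h\<parallel>)]\<close>. The functions matter only for large arguments, hence
  the cut-off \<open>R \<le> \<nu> a\<close>, which removes a bounded part of \<open>A_plus\<close>; every large enough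
  cut-off is required to work, with a threshold for \<open>C\<close> independent of it.
\<close>
definition cartan_proj_band ::
  "(mat3 \<Rightarrow> real) \<Rightarrow> (mat3 \<Rightarrow> real) \<Rightarrow> mat3 set \<Rightarrow> (real \<Rightarrow> real) \<Rightarrow> (real \<Rightarrow> real) \<Rightarrow> bool" where
  "cartan_proj_band \<nu> \<nu>' H f1 f2 \<longleftrightarrow>
     (\<exists>R0. \<exists>C0>1. \<forall>R\<ge>R0. \<forall>C\<ge>C0.
        coarse_eq (cartan_proj ` H)
          {a \<in> A_plus. R \<le> \<nu> a \<and> inverse C * f1 (\<nu> a) \<le> \<nu>' (rho a) \<and>
                       \<nu>' (rho a) \<le> C * f2 (\<nu> a)})"

end

theory Submission
  imports Defs
begin

text \<open>
  The Lie algebra of a closed subgroup \<open>H\<close> is its set of tangent vectors at the identity. If \<open>K\<close> is a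
  closed subgroup whose Lie algebra contains that of \<open>H\<close>, then \<open>H \<inter> K\<close> is open in \<open>H\<close>: otherwise take
  \<open>h\<^sub>n \<in> H - K\<close> converging to \<open>1\<close> and nearest points \<open>k\<^sub>n \<in> H \<inter> K\<close>; a limit direction of
  \<open>h\<^sub>n - k\<^sub>n\<close> lies in the Lie algebra of \<open>H\<close>, but minimality makes it orthogonal to the Lie algebra of
  \<open>H \<inter> K\<close>. So a connected \<open>H\<close> is contained in \<open>K\<close>, and in parts (1) and (2) it is contained in an
  explicit group of matrices, on which the entries of \<open>h\<close> and \<open>rho h\<close> are compared directly.

  In part (3) the projection \<open>T\<close> of \<open>H\<close> to \<open>A\<close> must be a line that commutes with some \<open>u\<^sub>i\<^sub>j\<close>, and
  compatibility gives a basis \<open>D + c E\<^sub>i\<^sub>j, V\<close> of the Lie algebra with \<open>c \<noteq> 0\<close>, \<open>D\<close> spanning the Lie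
  algebra of \<open>T\<close> and \<open>V\<close> a root vector for another root. The four resulting families share the norms
  \<open>\<parallel>h\<parallel>\<^sup>2 = 2 e\<^sup>2\<^sup>t + c\<^sup>2 t\<^sup>2 e\<^sup>2\<^sup>t + e\<^sup>-\<^sup>4\<^sup>t + s\<^sup>2\<close> and
  \<open>\<parallel>rho h\<parallel>\<^sup>2 = e\<^sup>4\<^sup>t + 2 e\<^sup>-\<^sup>2\<^sup>t + c\<^sup>2 t\<^sup>2 e\<^sup>-\<^sup>2\<^sup>t + s\<^sup>2 e\<^sup>2\<^sup>t\<close>. These norms determine \<open>\<mu> h\<close>
  up to a bounded factor, both bounds of the band follow by cases, and a point of the band with norms
  \<open>r\<close> and \<open>p\<close> is reached by \<open>s = r\<close>, \<open>t = ln (p / r)\<close>.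
\<close>

section \<open>The matrix exponential\<close>

text \<open>The logarithm in the band comes from the single entry \<open>c * t * exp t\<close>, and
  \<open>c = 0\<close> is the split case. For \<open>t > 0\<close> the upper edge is reached when
  the free parameter \<open>s\<close> has the size of \<open>t * exp t\<close>: then
  \<open>norm h\<close> is about \<open>t * exp t\<close> and \<open>norm (rho h)\<close> about
  \<open>t * exp (2 * t)\<close>. For \<open>t < 0\<close>, with \<open>T = - t\<close>, the lower
  edge is reached at \<open>s\<close> about \<open>T * exp (2 * T)\<close>, where the norms are
  about \<open>T * exp (2 * T)\<close> and \<open>T * exp T\<close>. Two Euclidean norms control the
  Cartan projection because both are invariant under K on either side, and on \<open>A_plus\<close>
  they are comparable to \<open>a$1$1\<close> and \<open>a$1$1 * a$2$2\<close>; with determinant 1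
  these fix the diagonal. On the group side H is known only through \<open>lie_alg\<close>, that is,
  through one-parameter groups. The passage back to elements rests on the limit of
  \<open>(1 + A n) ^ k n\<close>, which takes the place of a matrix logarithm. In parts (1) and (2)
  the estimates hold on the whole explicit group, so an inclusion suffices; part (3) also needs
  elements of H that fill the band, so \<open>H \<inter> N_grp\<close> has to be found
  exactly.\<close>

lemma norm_sq_matrix: "(norm (A :: real^'n^'m))\<^sup>2 = (\<Sum>i\<in>UNIV. \<Sum>j\<in>UNIV. (A$i$j)\<^sup>2)"
  unfolding power2_norm_eq_inner inner_vec_def by (simp add: power2_eq_square)

lemma norm_matrix_mult: "norm (A ** B) \<le> norm A * norm (B :: real^'n^'m)"
  for A :: "real^'m^'k"
proof -
  have "(norm (A ** B))\<^sup>2 = (\<Sum>i\<in>UNIV. \<Sum>j\<in>UNIV. (A$i \<bullet> column j B)\<^sup>2)"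
    by (simp add: norm_sq_matrix matrix_matrix_mult_def inner_vec_def column_def)
  also have "\<dots> \<le> (\<Sum>i\<in>UNIV. \<Sum>j\<in>UNIV. (A$i \<bullet> A$i) * (column j B \<bullet> column j B))"
    by (intro sum_mono Cauchy_Schwarz_ineq)
  also have "\<dots> = (\<Sum>i\<in>UNIV. A$i \<bullet> A$i) * (\<Sum>j\<in>UNIV. column j B \<bullet> column j B)"
    by (simp add: sum_product)
  also have "(\<Sum>i\<in>UNIV. A$i \<bullet> A$i) = (norm A)\<^sup>2"
    by (simp add: power2_norm_eq_inner inner_vec_def)
  also have "(\<Sum>j\<in>UNIV. column j B \<bullet> column j B) = (norm B)\<^sup>2"
    unfolding norm_sq_matrix
    by (simp add: inner_vec_def column_def power2_eq_square, subst sum.swap, simp)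
  finally show ?thesis
    by (metis mult_nonneg_nonneg norm_ge_zero power2_le_imp_le power_mult_distrib)
qed

lemma bounded_bilinear_matrix_mult:
  "bounded_bilinear ((**) :: real^'m^'k \<Rightarrow> real^'n^'m \<Rightarrow> real^'n^'k)"
proof
  show "\<exists>K. \<forall>(a :: real^'m^'k) (b :: real^'n^'m). norm (a ** b) \<le> norm a * norm b * K"
    by (rule exI[of _ 1]) (simp add: norm_matrix_mult)
qed (simp_all add: matrix_matrix_mult_def vec_eq_iff distrib_left distrib_right sum.distrib
      sum_distrib_left mult.assoc mult.left_commute)

lemmas matrix_mult_simps =
  bounded_bilinear.add_left[OF bounded_bilinear_matrix_mult]
  bounded_bilinear.add_right[OF bounded_bilinear_matrix_mult]
  bounded_bilinear.diff_left[OF bounded_bilinear_matrix_mult]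
  bounded_bilinear.diff_right[OF bounded_bilinear_matrix_mult]
  bounded_bilinear.scaleR_left[OF bounded_bilinear_matrix_mult]
  bounded_bilinear.scaleR_right[OF bounded_bilinear_matrix_mult]

lemmas tendsto_matrix_mult = bounded_bilinear.tendsto[OF bounded_bilinear_matrix_mult]
lemmas continuous_on_matrix_mult = bounded_bilinear.continuous_on[OF bounded_bilinear_matrix_mult]

definition mat_pow :: "real^'n^'n \<Rightarrow> nat \<Rightarrow> real^'n^'n" where
  "mat_pow A n = ((\<lambda>Y. A ** Y) ^^ n) (mat 1)"

lemma mat_pow_0 [simp]: "mat_pow A 0 = mat 1"
  and mat_pow_Suc [simp]: "mat_pow A (Suc n) = A ** mat_pow A n"
  by (simp_all add: mat_pow_def)

lemma mat_pow_scaleR: "mat_pow (c *\<^sub>R A) n = c ^ n *\<^sub>R mat_pow A n"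
  by (induction n) (simp_all add: matrix_mult_simps)

lemma norm_mat_pow: "norm (mat_pow A n) \<le> norm (mat 1 :: real^'n^'n) * norm A ^ n"
  for A :: "real^'n^'n"
proof (induction n)
  case (Suc n)
  have "norm (mat_pow A (Suc n)) \<le> norm A * norm (mat_pow A n)"
    by (simp add: norm_matrix_mult)
  also have "\<dots> \<le> norm A * (norm (mat 1 :: real^'n^'n) * norm A ^ n)"
    by (intro mult_left_mono Suc) simp
  finally show ?case by (simp add: mult.left_commute)
qed simp

lemma mat_pow_tendsto:
  assumes "A \<longlonglongrightarrow> L"
  shows "(\<lambda>n. mat_pow (A n) j) \<longlonglongrightarrow> mat_pow L j"
  by (induction j) (auto intro!: tendsto_matrix_mult assms)

lemma mat_pow_binomial:
  "mat_pow (mat 1 + A) k = (\<Sum>j\<le>k. real (k choose j) *\<^sub>R mat_pow A j)"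
proof (induction k)
  case (Suc k)
  let ?S = "\<Sum>j\<le>k. real (k choose j) *\<^sub>R mat_pow A j"
  have "(\<Sum>j\<le>Suc k. real (Suc k choose j) *\<^sub>R mat_pow A j)
      = mat_pow A 0 + (\<Sum>j\<le>k. real (Suc k choose Suc j) *\<^sub>R mat_pow A (Suc j))"
    by (subst sum.atMost_Suc_shift) simp
  also have "\<dots> = mat_pow A 0 + (\<Sum>j\<le>k. real (k choose Suc j) *\<^sub>R mat_pow A (Suc j))
      + (\<Sum>j\<le>k. real (k choose j) *\<^sub>R mat_pow A (Suc j))"
    by (simp add: scaleR_add_left sum.distrib)
  also have "mat_pow A 0 + (\<Sum>j\<le>k. real (k choose Suc j) *\<^sub>R mat_pow A (Suc j))
      = (\<Sum>j\<le>Suc k. real (k choose j) *\<^sub>R mat_pow A j)"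
    by (subst sum.atMost_Suc_shift) simp
  also have "\<dots> = ?S" by simp
  also have "(\<Sum>j\<le>k. real (k choose j) *\<^sub>R mat_pow A (Suc j)) = A ** ?S"
    by (simp add: bounded_bilinear.sum_right[OF bounded_bilinear_matrix_mult]
        matrix_mult_simps)
  finally show ?case
    by (simp add: Suc matrix_mult_simps)
qed simp

lemma mat_exp_eq: "mat_exp X = (\<Sum>n. (1 / fact n) *\<^sub>R mat_pow X n)"
  by (simp add: mat_exp_def mat_pow_def)

lemma summable_mat_exp: "summable (\<lambda>n. (1 / fact n) *\<^sub>R mat_pow X n)"
  for X :: mat3
proof (rule summable_comparison_test')
  show "summable (\<lambda>n. norm (mat 1 :: mat3) * (norm X ^ n / fact n))"
    using summable_exp[of "norm X"] by (intro summable_mult) (simp add: field_simps)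
  show "norm ((1 / fact n) *\<^sub>R mat_pow X n) \<le> norm (mat 1 :: mat3) * (norm X ^ n / fact n)"
    for n
    using norm_mat_pow[of X n] by (simp add: field_simps)
qed

lemma mat_exp_nth: "mat_exp X $ i $ j = (\<Sum>n. mat_pow X n $ i $ j / fact n)"
  and summable_mat_exp_nth: "summable (\<lambda>n. mat_pow X n $ i $ j / fact n)"
proof -
  have "bounded_linear (\<lambda>A :: mat3. A $ i $ j)"
    by (rule bounded_linear_compose[OF bounded_linear_vec_nth bounded_linear_vec_nth])
  note * = bounded_linear.suminf[OF this summable_mat_exp, of X]
    bounded_linear.summable[OF this summable_mat_exp, of X]
  show "mat_exp X $ i $ j = (\<Sum>n. mat_pow X n $ i $ j / fact n)"
    "summable (\<lambda>n. mat_pow X n $ i $ j / fact n)"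
    using * by (simp_all add: mat_exp_eq)
qed

lemma mat_exp_0 [simp]: "mat_exp 0 = mat 1"
proof -
  have "mat_pow (0 :: mat3) n = (if n = 0 then mat 1 else 0)" for n
    by (cases n) auto
  then have "mat_exp 0 = (\<Sum>n\<in>{0}. (1 / fact n) *\<^sub>R mat_pow (0::mat3) n)"
    unfolding mat_exp_eq by (intro suminf_finite) auto
  then show ?thesis by simp
qed

text \<open>Consecutive quotients differ by the factor \<open>(1 - j / k n) / (j + 1)\<close>, which
  tends to \<open>1 / (j + 1)\<close>.\<close>

lemma binomial_over_power_tendsto:
  assumes "filterlim k at_top sequentially"
  shows "(\<lambda>n. real (k n choose j) / real (k n) ^ j) \<longlonglongrightarrow> 1 / fact j"
proof (induction j)
  case 0
  then show ?case by simp
next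
  case (Suc j)
  have k: "filterlim (\<lambda>n. real (k n)) at_top sequentially"
    using assms filterlim_compose filterlim_real_sequentially by blast
  have "(\<lambda>n. real j / real (k n)) \<longlonglongrightarrow> 0"
    by (rule tendsto_divide_0[OF tendsto_const filterlim_at_top_imp_at_infinity[OF k]])
  then have "(\<lambda>n. (real (k n choose j) / real (k n) ^ j) * (1 - real j / real (k n)) / Suc j)
      \<longlonglongrightarrow> (1 / fact j) * (1 - 0) / Suc j"
    by (intro tendsto_intros Suc) auto
  moreover have "\<forall>\<^sub>F n in sequentially. k n > j"
    by (rule eventually_compose_filterlim[OF eventually_gt_at_top assms])
  then have "\<forall>\<^sub>F n in sequentially. (real (k n choose j) / real (k n) ^ j) * (1 - real j / real (k n)) / Suc j
     = real (k n choose Suc j) / real (k n) ^ Suc j"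
  proof eventually_elim
    case (elim n)
    have "real (Suc j) * real (k n choose Suc j) = real (k n - j) * real (k n choose j)"
      by (metis of_nat_mult binomial_absorption binomial_absorb_comp)
    then have "real (k n choose Suc j) = (real (k n) - real j) * real (k n choose j) / real (Suc j)"
      using elim by (simp add: field_simps of_nat_diff)
    moreover have "1 - real j / real (k n) = (real (k n) - real j) / real (k n)"
      using elim by (simp add: field_simps)
    ultimately show ?case by (simp add: mult_ac)
  qed
  ultimately show ?case
    by (auto simp: field_simps elim: Lim_transform_eventually)
qed

text \<open>The binomial expansion is a series whose \<open>j\<close>-th term converges to that of
  the exponential, and Tannery's theorem exchanges limit and sum. This is the bridge from group
  elements near 1 to one-parameter subgroups.\<close>

lemma mat_exp_limit:
  fixes A :: "nat \<Rightarrow> mat3" and k :: "nat \<Rightarrow> nat"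
  assumes k: "filterlim k at_top sequentially"
    and Z: "(\<lambda>n. real (k n) *\<^sub>R A n) \<longlonglongrightarrow> Z"
  shows "(\<lambda>n. mat_pow (mat 1 + A n) (k n)) \<longlonglongrightarrow> mat_exp Z"
proof -
  define a where "a j n = (real (k n choose j) / real (k n) ^ j) *\<^sub>R mat_pow (real (k n) *\<^sub>R A n) j" for j n
  \<comment> \<open>Summable majorant: eventually \<open>real (k n) *\<^sub>R A n\<close> has norm
    below \<open>norm Z + 1\<close>, and \<open>k choose j\<close> is at most
    \<open>k ^ j / fact j\<close>.\<close>
  define M where "M j = norm (mat 1 :: mat3) * ((norm Z + 1) ^ j / fact j)" for j
  have lim: "(a j \<longlongrightarrow> (1 / fact j) *\<^sub>R mat_pow Z j) sequentially" for j
    unfolding a_def by (intro tendsto_scaleR binomial_over_power_tendsto k mat_pow_tendsto Z)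
  have kpos: "\<forall>\<^sub>F n in sequentially. k n > 0"
    by (rule eventually_compose_filterlim[OF eventually_gt_at_top k])
  have "\<forall>\<^sub>F n in sequentially. norm (real (k n) *\<^sub>R A n) < norm Z + 1"
    by (rule order_tendstoD(2)[OF tendsto_norm[OF Z]]) simp
  then have ev: "\<forall>\<^sub>F n in sequentially. \<forall>j. norm (a j n) \<le> M j"
    using kpos
  proof eventually_elim
    case (elim n)
    show ?case
    proof
      fix j
      have "real (k n choose j) * fact j \<le> real (k n) ^ j"
        using binomial_fact_pow[of "k n" j] by (metis of_nat_fact of_nat_le_iff of_nat_mult of_nat_power)
      then have 1: "real (k n choose j) / real (k n) ^ j \<le> 1 / fact j"
        using elim by (simp add: field_simps)
      have 2: "norm (mat_pow (real (k n) *\<^sub>R A n) j) \<le> norm (mat 1 :: mat3) * (norm Z + 1) ^ j"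
        using elim by (intro order_trans[OF norm_mat_pow] mult_left_mono power_mono) auto
      show "norm (a j n) \<le> M j"
        using mult_mono[OF 1 2] by (simp add: a_def M_def)
    qed
  qed
  have "(\<lambda>n. mat_pow (mat 1 + A n) (k n) $ p $ q) \<longlonglongrightarrow> mat_exp Z $ p $ q" for p q
  proof -
    have entry: "\<bar>a j n $ p $ q\<bar> \<le> M j" if "\<forall>j. norm (a j n) \<le> M j" for j n
    proof -
      have "\<bar>a j n $ p $ q\<bar> \<le> norm (a j n $ p)"
        using Finite_Cartesian_Product.norm_nth_le[of "a j n $ p" q] by simp
      also have "\<dots> \<le> norm (a j n)" by (rule Finite_Cartesian_Product.norm_nth_le)
      also have "\<dots> \<le> M j" using that by simp
      finally show ?thesis .
    qed
    have "(\<lambda>n. a j n $ p $ q) \<longlonglongrightarrow> mat_pow Z j $ p $ q / fact j" for j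
      using tendsto_vec_nth[OF tendsto_vec_nth[OF lim[of j]], of p q] by simp
    then have "(\<lambda>n. \<Sum>j. a j n $ p $ q) \<longlonglongrightarrow> (\<Sum>j. mat_pow Z j $ p $ q / fact j)"
    proof (rule conjunct2[OF conjunct2[OF tannerys_theorem[where F = sequentially]]])
      have "\<forall>\<^sub>F x in (sequentially :: nat filter) \<times>\<^sub>F sequentially. (\<forall>j. norm (a j (snd x)) \<le> M j)"
        using ev by (rule eventually_compose_filterlim[OF _ filterlim_snd])
      then show "\<forall>\<^sub>F (j, n) in sequentially \<times>\<^sub>F sequentially. norm (a j n $ p $ q) \<le> M j"
        by (rule eventually_mono) (auto intro: entry)
      show "summable M"
        unfolding M_def using summable_exp[of "norm Z + 1"]
        by (intro summable_mult) (simp add: field_simps)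
    qed simp
    moreover have "\<forall>\<^sub>F n in sequentially. (\<Sum>j. a j n $ p $ q) = mat_pow (mat 1 + A n) (k n) $ p $ q"
      using kpos
    proof eventually_elim
      case (elim n)
      have "(\<Sum>j. a j n $ p $ q) = (\<Sum>j\<le>k n. a j n $ p $ q)"
        by (rule suminf_finite) (auto simp: a_def binomial_eq_0)
      also have "\<dots> = mat_pow (mat 1 + A n) (k n) $ p $ q"
        using elim by (simp add: mat_pow_binomial a_def mat_pow_scaleR)
      finally show ?case .
    qed
    ultimately show ?thesis
      unfolding mat_exp_nth by (rule Lim_transform_eventually)
  qed
  then show ?thesis by (intro vec_tendstoI)
qed

text \<open>Each entry is an everywhere convergent power series in \<open>t\<close>; continuity and
  the derivative at 0 then come from the theory of real power series.\<close>

lemma mat_exp_scaleR_nth: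
  "mat_exp (t *\<^sub>R X) $ i $ j = (\<Sum>n. (mat_pow X n $ i $ j / fact n) * t ^ n)"
  and summable_mat_exp_scaleR_nth: "summable (\<lambda>n. (mat_pow X n $ i $ j / fact n) * t ^ n)"
  using mat_exp_nth[of "t *\<^sub>R X" i j] summable_mat_exp_nth[of "t *\<^sub>R X" i j]
  by (simp_all add: mat_pow_scaleR mult.commute)

lemma continuous_on_mat_exp_scaleR: "continuous_on UNIV (\<lambda>t. mat_exp (t *\<^sub>R X))"
proof (intro continuous_at_imp_continuous_on ballI)
  fix t
  have "isCont (\<lambda>t. mat_exp (t *\<^sub>R X) $ i $ j) t" for i j
    unfolding mat_exp_scaleR_nth
    by (rule isCont_powser_converges_everywhere[OF summable_mat_exp_scaleR_nth])
  then show "isCont (\<lambda>t. mat_exp (t *\<^sub>R X)) t"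
    unfolding isCont_def by (intro vec_tendstoI) simp
qed

lemma tendsto_difference_quotient:
  fixes g :: "real \<Rightarrow> mat3"
  assumes "g 0 = mat 1" "\<And>i j. ((\<lambda>t. g t $ i $ j) has_real_derivative X $ i $ j) (at 0)"
  shows "((\<lambda>t. (g t - mat 1) /\<^sub>R t) \<longlongrightarrow> X) (at 0)"
proof (intro vec_tendstoI)
  fix i j
  show "((\<lambda>t. ((g t - mat 1) /\<^sub>R t) $ i $ j) \<longlongrightarrow> X $ i $ j) (at 0)"
    using assms(2)[of i j] by (simp add: DERIV_def assms(1) divide_inverse mult.commute)
qed

lemma mat_exp_derivative: "((\<lambda>t. (mat_exp (t *\<^sub>R X) - mat 1) /\<^sub>R t) \<longlongrightarrow> X) (at 0)"
proof (rule tendsto_difference_quotient)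
  show "((\<lambda>t. mat_exp (t *\<^sub>R X) $ i $ j) has_real_derivative X $ i $ j) (at 0)" for i j
    using termdiffs_strong_converges_everywhere[OF summable_mat_exp_scaleR_nth[of X i j], of 0]
    unfolding mat_exp_scaleR_nth powser_zero by (simp add: diffs_def)
qed simp

definition upper_tri :: "mat3 \<Rightarrow> bool" where
  "upper_tri X \<longleftrightarrow> X$2$1 = 0 \<and> X$3$1 = 0 \<and> X$3$2 = 0"

lemma mat_exp_upper_tri_diag:
  assumes "upper_tri X"
  shows "mat_exp X $ i $ i = exp (X $ i $ i)"
proof -
  have "upper_tri (mat_pow X n) \<and> (\<forall>i. mat_pow X n $ i $ i = (X $ i $ i) ^ n)" for n
    by (induction n) (use assms in \<open>auto simp: upper_tri_def mat_def forall_3 matrix_matrix_mult_def sum_3\<close>)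
  then show ?thesis
    unfolding mat_exp_nth exp_def by (simp add: divide_inverse mult.commute)
qed

text \<open>The exponents for \<open>lie_alg_tangent\<close>: that many steps of size
  \<open>\<epsilon> n\<close> cover the distance \<open>t\<close> in the limit.\<close>

lemma floor_div_tendsto:
  fixes t :: real
  assumes e: "\<epsilon> \<longlonglongrightarrow> 0" and pos: "\<And>n. \<epsilon> n > (0::real)" and t: "t > 0"
  shows "filterlim (\<lambda>n. nat \<lfloor>t / \<epsilon> n\<rfloor>) at_top sequentially"
    and "(\<lambda>n. real (nat \<lfloor>t / \<epsilon> n\<rfloor>) * \<epsilon> n) \<longlonglongrightarrow> t"
proof -
  have "filterlim \<epsilon> (at_right 0) sequentially"
    using e pos by (auto simp: filterlim_at less_imp_neq[OF pos, symmetric])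
  then have "filterlim (\<lambda>n. t / \<epsilon> n) at_top sequentially"
    unfolding divide_inverse
    by (intro filterlim_tendsto_pos_mult_at_top[OF tendsto_const t]
        filterlim_compose[OF filterlim_inverse_at_top_right])
  then show 1: "filterlim (\<lambda>n. nat \<lfloor>t / \<epsilon> n\<rfloor>) at_top sequentially"
    by (intro filterlim_compose[OF filterlim_nat_sequentially] filterlim_compose[OF filterlim_floor_sequentially])
  show "(\<lambda>n. real (nat \<lfloor>t / \<epsilon> n\<rfloor>) * \<epsilon> n) \<longlonglongrightarrow> t"
  proof (rule tendsto_sandwich[of "\<lambda>n. t - \<epsilon> n" _ _ "\<lambda>n. t"])
    show "\<forall>\<^sub>F n in sequentially. t - \<epsilon> n \<le> real (nat \<lfloor>t / \<epsilon> n\<rfloor>) * \<epsilon> n"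
    proof (intro always_eventually allI)
      fix n
      have "t / \<epsilon> n - 1 \<le> real (nat \<lfloor>t / \<epsilon> n\<rfloor>)" by linarith
      then show "t - \<epsilon> n \<le> real (nat \<lfloor>t / \<epsilon> n\<rfloor>) * \<epsilon> n"
        using pos[of n] by (simp add: field_simps)
    qed
    show "\<forall>\<^sub>F n in sequentially. real (nat \<lfloor>t / \<epsilon> n\<rfloor>) * \<epsilon> n \<le> t"
    proof (intro always_eventually allI)
      fix n
      have "real (nat \<lfloor>t / \<epsilon> n\<rfloor>) \<le> t / \<epsilon> n" using t pos[of n] by simp
      then show "real (nat \<lfloor>t / \<epsilon> n\<rfloor>) * \<epsilon> n \<le> t"
        using pos[of n] by (simp add: field_simps)
    qed
    show "(\<lambda>n. t - \<epsilon> n) \<longlonglongrightarrow> t" using tendsto_diff[OF tendsto_const e, of t] by simp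
  qed simp
qed

section \<open>Closed subgroups and their Lie algebras\<close>

lemma carrier_SL3: "carrier SL3 = {g. det g = 1}"
  and mult_SL3 [simp]: "x \<otimes>\<^bsub>SL3\<^esub> y = x ** y"
  and one_SL3 [simp]: "\<one>\<^bsub>SL3\<^esub> = mat 1"
  by (simp_all add: SL3_def)

lemma set_mult_SL3: "S <#>\<^bsub>SL3\<^esub> T = {x ** y | x y. x \<in> S \<and> y \<in> T}"
  by (auto simp: set_mult_def)

lemma SL3_inverse:
  assumes "det (x :: real^'n^'n) = 1"
  obtains y where "x ** y = mat 1" "y ** x = mat 1" "det y = 1"
proof -
  have "invertible x" using assms by (simp add: invertible_det_nz)
  then obtain y where y: "x ** y = mat 1" "y ** x = mat 1" by (auto simp: invertible_def)
  moreover from y(1) have "det y = 1" using assms by (metis det_I det_mul mult_1)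
  ultimately show ?thesis using that by blast
qed

lemma group_SL3: "group SL3"
proof (rule groupI)
  show "\<exists>y\<in>carrier SL3. y \<otimes>\<^bsub>SL3\<^esub> x = \<one>\<^bsub>SL3\<^esub>" if "x \<in> carrier SL3" for x
    using SL3_inverse[of x] that by (auto simp: carrier_SL3)
qed (auto simp: carrier_SL3 det_mul matrix_mul_assoc)

lemma inv_SL3: "x ** y = mat 1 \<Longrightarrow> det x = 1 \<Longrightarrow> inv\<^bsub>SL3\<^esub> x = y"
  using group.inv_equality[OF group_SL3, of y x] matrix_left_right_inverse[of x y]
  by (simp add: carrier_SL3) (metis det_I det_mul mult_1)

lemma subgroup_SL3I:
  assumes "\<And>x. x \<in> H \<Longrightarrow> det x = 1" "mat 1 \<in> H" "\<And>x y. x \<in> H \<Longrightarrow> y \<in> H \<Longrightarrow> x ** y \<in> H"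
    "\<And>x. x \<in> H \<Longrightarrow> \<exists>y\<in>H. x ** y = mat 1"
  shows "subgroup H SL3"
proof
  show "inv\<^bsub>SL3\<^esub> x \<in> H" if "x \<in> H" for x
    using assms(1,4)[OF that] inv_SL3 by auto
qed (use assms in \<open>auto simp: carrier_SL3\<close>)

lemma subgroup_SL3D:
  assumes "subgroup H SL3"
  shows "x \<in> H \<Longrightarrow> det x = 1" "mat 1 \<in> H" "x \<in> H \<Longrightarrow> y \<in> H \<Longrightarrow> x ** y \<in> H"
    "x \<in> H \<Longrightarrow> x ** y = mat 1 \<Longrightarrow> y \<in> H" "x \<in> H \<Longrightarrow> y ** x = mat 1 \<Longrightarrow> y \<in> H"
proof -
  show 1: "x \<in> H \<Longrightarrow> det x = 1"
    using subgroup.subset[OF assms] by (auto simp: carrier_SL3)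
  show "mat 1 \<in> H" "x \<in> H \<Longrightarrow> y \<in> H \<Longrightarrow> x ** y \<in> H"
    using subgroup.one_closed[OF assms] subgroup.m_closed[OF assms] by auto
  show 2: "x \<in> H \<Longrightarrow> x ** y = mat 1 \<Longrightarrow> y \<in> H"
    using 1 inv_SL3 subgroup.m_inv_closed[OF assms] by metis
  show "x \<in> H \<Longrightarrow> y ** x = mat 1 \<Longrightarrow> y \<in> H"
    using 2 by (simp add: matrix_left_right_inverse)
qed

lemma mat_pow_in_subgroup:
  assumes "subgroup H SL3" "g \<in> H"
  shows "mat_pow g n \<in> H"
  by (induction n) (auto intro: subgroup_SL3D[OF assms(1)] assms(2))

text \<open>From \<open>g' - 1 = - g' (g - 1)\<close>: once \<open>g\<close> is within 1/2 of 1, the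
  right side first bounds \<open>norm g'\<close> by \<open>2 * norm 1\<close>, and with this bound
  it tends to 0.\<close>

lemma left_inverse_tendsto_1:
  fixes g g' :: "nat \<Rightarrow> real^'n^'n"
  assumes g: "g \<longlonglongrightarrow> mat 1" and inv: "\<And>n. g' n ** g n = mat 1"
  shows "g' \<longlonglongrightarrow> mat 1"
proof -
  let ?I = "mat 1 :: real^'n^'n"
  define d where "d n = norm (g n - ?I)" for n
  have d0: "d \<longlonglongrightarrow> 0"
    unfolding d_def using tendsto_norm[OF tendsto_diff[OF g tendsto_const[of ?I]]] by simp
  have eq: "g' n - ?I = - (g' n ** (g n - ?I))" for n
    by (simp add: matrix_mult_simps inv)
  have "\<forall>\<^sub>F n in sequentially. d n < 1/2"
    by (rule order_tendstoD(2)[OF d0]) simp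
  then have "\<forall>\<^sub>F n in sequentially. norm (g' n - ?I) \<le> 2 * norm ?I * d n"
  proof eventually_elim
    case (elim n)
    have 1: "norm (g' n - ?I) \<le> norm (g' n) * d n"
      unfolding eq d_def by (simp add: norm_matrix_mult)
    also have "\<dots> \<le> norm (g' n) * (1/2)"
      using elim by (intro mult_left_mono) auto
    finally have "norm (g' n) \<le> 2 * norm ?I"
      using norm_triangle_sub[of "g' n" ?I] by simp
    then have "norm (g' n) * d n \<le> 2 * norm ?I * d n"
      by (intro mult_right_mono) (auto simp: d_def)
    with 1 show ?case by linarith
  qed
  moreover have "(\<lambda>n. 2 * norm ?I * d n) \<longlonglongrightarrow> 0"
    using tendsto_mult_left[OF d0, of "2 * norm ?I"] by simp
  ultimately have "(\<lambda>n. g' n - ?I) \<longlonglongrightarrow> 0"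
    by (rule Lim_null_comparison)
  then show ?thesis by (simp add: LIM_zero_iff)
qed

lemma tangent_imp_tendsto_1:
  fixes g :: "nat \<Rightarrow> real^'n^'n"
  assumes "\<And>n. \<epsilon> n > (0::real)" "\<epsilon> \<longlonglongrightarrow> 0" "(\<lambda>n. (g n - mat 1) /\<^sub>R \<epsilon> n) \<longlonglongrightarrow> X"
  shows "g \<longlonglongrightarrow> mat 1"
proof -
  have "(\<lambda>n. \<epsilon> n *\<^sub>R ((g n - mat 1) /\<^sub>R \<epsilon> n)) \<longlonglongrightarrow> 0 *\<^sub>R X"
    by (intro tendsto_scaleR assms)
  moreover have "\<epsilon> n *\<^sub>R ((g n - mat 1) /\<^sub>R \<epsilon> n) = g n - mat 1" for n
    using assms(1)[of n] by simp
  ultimately show ?thesis by (simp add: LIM_zero_iff)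
qed

text \<open>The powers of \<open>g n\<close> with exponent \<open>floor (t / \<epsilon> n)\<close>
  stay in H and converge to \<open>exp (t X)\<close>, which lies in H by closedness. Negative
  \<open>t\<close> is handled by the inverses of \<open>g n\<close>, whose tangent is
  \<open>- X\<close>.\<close>

lemma lie_alg_tangent:
  assumes H: "subgroup H SL3" "closed H" and g: "\<And>n. g n \<in> H"
    and \<epsilon>: "\<And>n. \<epsilon> n > (0::real)" "\<epsilon> \<longlonglongrightarrow> 0"
    and lim: "(\<lambda>n. (g n - mat 1) /\<^sub>R \<epsilon> n) \<longlonglongrightarrow> X"
  shows "X \<in> lie_alg H"
proof -
  have pos: "mat_exp (t *\<^sub>R X) \<in> H"
    if g: "\<And>n. g n \<in> H" and lim: "(\<lambda>n. (g n - mat 1) /\<^sub>R \<epsilon> n) \<longlonglongrightarrow> X" and t: "t > 0"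
    for g X t
  proof -
    define k where "k n = nat \<lfloor>t / \<epsilon> n\<rfloor>" for n
    have k: "filterlim k at_top sequentially" "(\<lambda>n. real (k n) * \<epsilon> n) \<longlonglongrightarrow> t"
      unfolding k_def using floor_div_tendsto[OF \<epsilon>(2,1) t] by auto
    have "(\<lambda>n. (real (k n) * \<epsilon> n) *\<^sub>R ((g n - mat 1) /\<^sub>R \<epsilon> n)) \<longlonglongrightarrow> t *\<^sub>R X"
      by (intro tendsto_scaleR k lim)
    moreover have eq: "(real (k n) * \<epsilon> n) *\<^sub>R ((g n - mat 1) /\<^sub>R \<epsilon> n) = real (k n) *\<^sub>R (g n - mat 1)" for n
      using less_imp_neq[OF \<epsilon>(1)[of n]] by simp
    ultimately have "(\<lambda>n. real (k n) *\<^sub>R (g n - mat 1)) \<longlonglongrightarrow> t *\<^sub>R X"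
      by (simp only: eq)
    from mat_exp_limit[OF k(1) this]
    have "(\<lambda>n. mat_pow (g n) (k n)) \<longlonglongrightarrow> mat_exp (t *\<^sub>R X)" by simp
    then show ?thesis
      by (rule closed_sequentially[OF H(2) mat_pow_in_subgroup[OF H(1) g]])
  qed
  have "\<exists>y. y ** g n = mat 1" for n
    using SL3_inverse[of "g n"] subgroup_SL3D(1)[OF H(1) g] by metis
  then obtain g' where g': "\<And>n. g' n ** g n = mat 1" by metis
  have "(\<lambda>n. - (g' n ** ((g n - mat 1) /\<^sub>R \<epsilon> n))) \<longlonglongrightarrow> - (mat 1 ** X)"
    by (intro tendsto_minus tendsto_matrix_mult lim left_inverse_tendsto_1[OF _ g']
        tangent_imp_tendsto_1[OF \<epsilon> lim])
  moreover have "- (g' n ** ((g n - mat 1) /\<^sub>R \<epsilon> n)) = (g' n - mat 1) /\<^sub>R \<epsilon> n" for n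
    by (simp add: matrix_mult_simps g' scaleR_diff_right)
  ultimately have lim': "(\<lambda>n. (g' n - mat 1) /\<^sub>R \<epsilon> n) \<longlonglongrightarrow> - X" by simp
  have "mat_exp (t *\<^sub>R X) \<in> H" for t
  proof -
    consider "t = 0" | "t > 0" | "- t > 0" by linarith
    then show ?thesis
    proof cases
      case 1
      then show ?thesis using subgroup_SL3D(2)[OF H(1)] by simp
    next
      case 2
      then show ?thesis using pos[OF g lim] by simp
    next
      case 3
      then show ?thesis
        using pos[OF subgroup_SL3D(5)[OF H(1) g g'] lim' 3] by simp
    qed
  qed
  then show ?thesis by (simp add: lie_alg_def)
qed

lemma lie_alg_mat_exp: "X \<in> lie_alg H \<Longrightarrow> mat_exp (t *\<^sub>R X) \<in> H"
  by (simp add: lie_alg_def)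

lemma recip_Suc: "1 / real (Suc n) > 0" "(\<lambda>n. 1 / real (Suc n)) \<longlonglongrightarrow> 0"
  using LIMSEQ_inverse_real_of_nat by (simp_all add: inverse_eq_divide)

lemma filterlim_recip_Suc: "filterlim (\<lambda>n. 1 / real (Suc n)) (at 0) sequentially"
  by (intro filterlim_atI recip_Suc(2)) simp

lemma mat_exp_tangent:
  "(\<lambda>n. (mat_exp ((1 / real (Suc n)) *\<^sub>R X) - mat 1) /\<^sub>R (1 / real (Suc n))) \<longlonglongrightarrow> X"
  using filterlim_compose[OF mat_exp_derivative filterlim_recip_Suc] .

text \<open>For sums: \<open>p q - 1 = (p - 1) q + (q - 1)\<close>, so a product of two curves
  through 1 has the sum of their tangents.\<close>

lemma lie_alg_subspace:
  assumes "subgroup H SL3" "closed H"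
  shows "subspace (lie_alg H)"
proof (rule subspaceI)
  show "0 \<in> lie_alg H" using subgroup_SL3D(2)[OF assms(1)] by (simp add: lie_alg_def)
  show "c *\<^sub>R X \<in> lie_alg H" if "X \<in> lie_alg H" for c X
    using that by (simp add: lie_alg_def)
  fix X Y assume XY: "X \<in> lie_alg H" "Y \<in> lie_alg H"
  define p where "p n = mat_exp ((1 / real (Suc n)) *\<^sub>R X)" for n
  define q where "q n = mat_exp ((1 / real (Suc n)) *\<^sub>R Y)" for n
  note pl = mat_exp_tangent[of X, folded p_def] and ql = mat_exp_tangent[of Y, folded q_def]
  have "(\<lambda>n. ((p n - mat 1) /\<^sub>R (1 / real (Suc n))) ** q n + (q n - mat 1) /\<^sub>R (1 / real (Suc n)))
      \<longlonglongrightarrow> X ** mat 1 + Y"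
    by (intro tendsto_add tendsto_matrix_mult pl ql tangent_imp_tendsto_1[OF recip_Suc ql])
  then have "(\<lambda>n. (p n ** q n - mat 1) /\<^sub>R (1 / real (Suc n))) \<longlonglongrightarrow> X + Y"
    by (simp add: matrix_mult_simps algebra_simps)
  then show "X + Y \<in> lie_alg H"
    by (rule lie_alg_tangent[OF assms _ recip_Suc, rotated])
      (auto simp: p_def q_def intro!: subgroup_SL3D(3)[OF assms(1)] lie_alg_mat_exp XY)
qed

lemma lie_alg_conj:
  assumes "subgroup H SL3" "closed H" "g \<in> H" "g ** g' = mat 1" "X \<in> lie_alg H"
  shows "g ** X ** g' \<in> lie_alg H"
proof -
  have "(\<lambda>n. g ** ((mat_exp ((1 / real (Suc n)) *\<^sub>R X) - mat 1) /\<^sub>R (1 / real (Suc n))) ** g')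
      \<longlonglongrightarrow> g ** X ** g'"
    by (intro tendsto_matrix_mult mat_exp_tangent tendsto_const)
  then have "(\<lambda>n. (g ** mat_exp ((1 / real (Suc n)) *\<^sub>R X) ** g' - mat 1) /\<^sub>R (1 / real (Suc n)))
      \<longlonglongrightarrow> g ** X ** g'"
    by (simp add: matrix_mult_simps assms(4))
  then show ?thesis
    by (rule lie_alg_tangent[OF assms(1,2) _ recip_Suc, rotated])
      (auto intro!: subgroup_SL3D(3)[OF assms(1)] lie_alg_mat_exp assms(3,5)
        subgroup_SL3D(4)[OF assms(1,3,4)])
qed

lemma closed_subgroup_eqI:
  assumes H: "subgroup H SL3" "closed H" "connected H"
    and K: "subgroup K SL3" "closed K" and lie: "lie_alg H \<subseteq> lie_alg K"
  shows "H \<subseteq> K"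
proof -
  let ?I = "mat 1 :: mat3"
  let ?L = "H \<inter> K"
  have L: "closed ?L" "?I \<in> ?L"
    using H K subgroup_SL3D(2) by auto
  have nbhd: "\<exists>\<delta>>0. \<forall>h\<in>H. dist h ?I < \<delta> \<longrightarrow> h \<in> K"
  proof (rule ccontr)
    assume "\<not> ?thesis"
    then have "\<exists>h. h \<in> H \<and> dist h ?I < 1 / real (Suc n) \<and> h \<notin> K" for n
      using recip_Suc(1) by blast
    then obtain h where h: "\<And>n. h n \<in> H" "\<And>n. dist (h n) ?I < 1 / real (Suc n)" "\<And>n. h n \<notin> K"
      by metis
    have h1: "h \<longlonglongrightarrow> ?I"
      using h(2) recip_Suc(2) by (intro metric_tendsto_imp_tendsto[OF recip_Suc(2)])
        (auto simp: dist_real_def intro!: always_eventually less_imp_le)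
    have "\<exists>k\<in>?L. \<forall>y\<in>?L. dist (h n) k \<le> dist (h n) y" for n
    proof -
      have "?L \<noteq> {}" using L(2) by blast
      from L(1) this show ?thesis
        by (rule distance_attains_inf[of _ "h n"]) (intro bexI ballI)
    qed
    then obtain k where k: "\<And>n. k n \<in> ?L" "\<And>n y. y \<in> ?L \<Longrightarrow> dist (h n) (k n) \<le> dist (h n) y"
      by metis
    define w where "w n = h n - k n" for n
    have w0: "w n \<noteq> 0" for n
      using h(3)[of n] k(1)[of n] by (auto simp: w_def)
    have w: "w \<longlonglongrightarrow> 0"
    proof (rule metric_tendsto_imp_tendsto[OF h1])
      show "\<forall>\<^sub>F n in sequentially. dist (w n) 0 \<le> dist (h n) ?I"
        using k(2)[OF L(2)] by (auto simp: w_def dist_norm)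
    qed
    have k1: "k \<longlonglongrightarrow> ?I"
      using tendsto_diff[OF h1 w] by (simp add: w_def)
    have "\<exists>y. y ** k n = ?I" for n
      using SL3_inverse[of "k n"] subgroup_SL3D(1)[OF H(1)] k(1) by (metis IntD1)
    then obtain k' where k': "\<And>n. k' n ** k n = ?I" by metis
    have k'1: "k' \<longlonglongrightarrow> ?I" by (rule left_inverse_tendsto_1[OF k1 k'])
    define Y where "Y n = w n /\<^sub>R norm (w n)" for n
    have "Y n \<in> sphere 0 1" for n using w0[of n] by (simp add: Y_def)
    then obtain Z r where Z: "Z \<in> sphere 0 1" "strict_mono r" "(Y \<circ> r) \<longlonglongrightarrow> Z"
      using compact_sphere[of "0::mat3" 1] unfolding compact_def by metis
    then have ZY: "(\<lambda>n. Y (r n)) \<longlonglongrightarrow> Z" by (simp add: o_def)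
    have sub: "(\<lambda>n. f (r n)) \<longlonglongrightarrow> l" if "f \<longlonglongrightarrow> l" for f :: "nat \<Rightarrow> mat3" and l
      using LIMSEQ_subseq_LIMSEQ[OF that Z(2)] by (simp add: o_def)
    \<comment> \<open>\<open>k' h - 1 = k' w\<close> and \<open>k'\<close> tends to 1, so the
      elements \<open>k' h\<close> of H have the same limit direction as \<open>w\<close>.\<close>
    have "Z \<in> lie_alg H"
    proof (rule lie_alg_tangent[OF H(1,2)])
      show "k' (r n) ** h (r n) \<in> H" for n
        using subgroup_SL3D(3,5)[OF H(1)] k(1) k' h(1) by (metis IntD1)
      show "norm (w (r n)) > 0" for n using w0 by simp
      show "(\<lambda>n. norm (w (r n))) \<longlonglongrightarrow> 0" using tendsto_norm[OF sub[OF w]] by simp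
      have "(\<lambda>n. k' (r n) ** Y (r n)) \<longlonglongrightarrow> ?I ** Z"
        by (intro tendsto_matrix_mult sub[OF k'1] ZY)
      moreover have "k' n ** Y n = (k' n ** h n - ?I) /\<^sub>R norm (w n)" for n
        by (simp add: Y_def w_def matrix_mult_simps k')
      ultimately show "(\<lambda>n. (k' (r n) ** h (r n) - ?I) /\<^sub>R norm (w (r n))) \<longlonglongrightarrow> Z" by simp
    qed
    \<comment> \<open>\<open>k n ** exp (s Z)\<close> lies again in \<open>H \<inter> K\<close>, so
      it is no closer to \<open>h n\<close> than \<open>k n\<close> is. Squaring, dividing by
      \<open>s\<close> and letting \<open>s\<close> tend to 0 gives the sign; for \<open>n\<close>
      to infinity it becomes \<open>Z \<bullet> Z \<le> 0\<close>, impossible for a unit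
      vector.\<close>
    have "Y n \<bullet> (k n ** Z) \<le> 0" for n
    proof (rule tendsto_upperbound)
      define q where "q m = mat_exp ((1 / real (Suc m)) *\<^sub>R Z)" for m
      define D where "D m = (q m - ?I) /\<^sub>R (1 / real (Suc m))" for m
      have D: "D \<longlonglongrightarrow> Z" unfolding D_def q_def by (rule mat_exp_tangent)
      have "(\<lambda>m. Y n \<bullet> (k n ** D m) - (norm (k n ** D m))\<^sup>2 / (2 * norm (w n)) * (1 / real (Suc m))) \<longlonglongrightarrow>
         Y n \<bullet> (k n ** Z) - (norm (k n ** Z))\<^sup>2 / (2 * norm (w n)) * 0"
        using w0[of n] by (intro tendsto_intros tendsto_matrix_mult D recip_Suc(2)) auto
      then show "(\<lambda>m. Y n \<bullet> (k n ** D m) - (norm (k n ** D m))\<^sup>2 / (2 * norm (w n)) * (1 / real (Suc m)))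
        \<longlonglongrightarrow> Y n \<bullet> (k n ** Z)" by simp
      show "\<forall>\<^sub>F m in sequentially. Y n \<bullet> (k n ** D m) - (norm (k n ** D m))\<^sup>2 / (2 * norm (w n)) * (1 / real (Suc m)) \<le> 0"
      proof (intro always_eventually allI)
        fix m
        let ?s = "1 / real (Suc m)" and ?v = "k n ** D m"
        have "q m \<in> H" "q m \<in> K"
          unfolding q_def using \<open>Z \<in> lie_alg H\<close> lie by (auto intro: lie_alg_mat_exp)
        then have "k n ** q m \<in> ?L"
          using k(1)[of n] subgroup_SL3D(3)[OF H(1)] subgroup_SL3D(3)[OF K(1)] by blast
        from k(2)[OF this, of n] have "norm (w n) \<le> norm (h n - k n ** q m)"
          by (simp add: w_def dist_norm)
        also have "h n - k n ** q m = w n - ?s *\<^sub>R ?v"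
          by (simp add: w_def D_def matrix_mult_simps)
        finally have "(norm (w n))\<^sup>2 \<le> (norm (w n - ?s *\<^sub>R ?v))\<^sup>2"
          by (intro power_mono) auto
        also have "\<dots> = (norm (w n))\<^sup>2 - 2 * ?s * (w n \<bullet> ?v) + ?s\<^sup>2 * (norm ?v)\<^sup>2"
          unfolding power2_norm_eq_inner
          by (simp add: inner_diff_left inner_diff_right inner_commute power2_eq_square)
        finally have "?s * (2 * (w n \<bullet> ?v)) \<le> ?s * (?s * (norm ?v)\<^sup>2)"
          by (simp add: power2_eq_square algebra_simps)
        then have "2 * (w n \<bullet> ?v) \<le> ?s * (norm ?v)\<^sup>2"
          using recip_Suc(1)[of m] by (simp only: mult_le_cancel_left_pos)
        then show "Y n \<bullet> ?v - (norm ?v)\<^sup>2 / (2 * norm (w n)) * ?s \<le> 0"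
        proof -
          have "Y n \<bullet> ?v - (norm ?v)\<^sup>2 / (2 * norm (w n)) * s = (2 * (w n \<bullet> ?v) - s * (norm ?v)\<^sup>2) / (2 * norm (w n))" for s
            using w0[of n] by (simp add: Y_def field_simps)
          then show ?thesis
            using \<open>2 * (w n \<bullet> ?v) \<le> ?s * (norm ?v)\<^sup>2\<close> by (simp only:) (simp add: divide_nonpos_nonneg)
        qed
      qed
    qed simp
    moreover have "(\<lambda>n. Y (r n) \<bullet> (k (r n) ** Z)) \<longlonglongrightarrow> Z \<bullet> (?I ** Z)"
      by (intro tendsto_inner tendsto_matrix_mult ZY sub[OF k1] tendsto_const)
    ultimately have "Z \<bullet> (?I ** Z) \<le> 0"
      by (intro LIMSEQ_le_const2) auto
    with Z(1) show False by (simp add: dot_square_norm)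
  qed
  then obtain \<delta> where \<delta>: "\<delta> > 0" "\<And>h. h \<in> H \<Longrightarrow> dist h ?I < \<delta> \<Longrightarrow> h \<in> K" by blast
  \<comment> \<open>Left translation by \<open>x\<close> carries the neighbourhood of 1 to one of
    \<open>x\<close>.\<close>
  have "openin (top_of_set H) ?L"
    unfolding openin_euclidean_subtopology_iff
  proof (intro conjI ballI)
    fix x assume x: "x \<in> ?L"
    obtain x' where x': "x ** x' = ?I" "x' ** x = ?I"
      using SL3_inverse subgroup_SL3D(1)[OF H(1)] x by (metis IntD1)
    have "isCont (\<lambda>y. x' ** y) x"
      unfolding isCont_def by (intro tendsto_matrix_mult tendsto_const tendsto_ident_at)
    then obtain e where e: "e > 0" "\<And>y. dist y x < e \<Longrightarrow> dist (x' ** y) (x' ** x) < \<delta>"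
      using \<delta>(1) unfolding continuous_at_eps_delta by metis
    have "y \<in> ?L" if "y \<in> H" "dist y x < e" for y
    proof -
      have "x' ** y \<in> H"
        using subgroup_SL3D(3,4)[OF H(1)] x x'(1) that(1) by blast
      then have "x' ** y \<in> K" using \<delta>(2) e(2)[OF that(2)] x'(2) by simp
      then have "x ** (x' ** y) \<in> K" using subgroup_SL3D(3)[OF K(1)] x by blast
      then show ?thesis using that(1) by (simp add: matrix_mul_assoc x'(1))
    qed
    then show "\<exists>e>0. \<forall>y\<in>H. dist y x < e \<longrightarrow> y \<in> ?L" using e(1) by blast
  qed auto
  moreover have "closedin (top_of_set H) ?L"
    using K(2) by (simp add: closedin_closed_Int)
  ultimately have "?L = H"
    using H(3) L(2) unfolding connected_clopen by blast
  then show ?thesis by blast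
qed

section \<open>Norms and the Cartan decomposition\<close>

lemma is_norm_nonneg:
  assumes "is_norm \<nu>" shows "\<nu> x \<ge> 0"
proof -
  have h: "\<And>c x. \<nu> (c *\<^sub>R x) = \<bar>c\<bar> * \<nu> x" "\<And>x y. \<nu> (x + y) \<le> \<nu> x + \<nu> y" "\<nu> 0 = 0"
    using assms by (auto simp: is_norm_def)
  have "\<nu> (x + (-1) *\<^sub>R x) \<le> \<nu> x + \<nu> ((-1) *\<^sub>R x)" by (rule h(2))
  also have "\<nu> ((-1) *\<^sub>R x) = \<nu> x" by (simp only: h(1))
  finally show ?thesis using h(3) by simp
qed

text \<open>\<open>is_norm\<close> is a bare predicate, so equivalence with the Euclidean norm is
  derived: expansion in the basis gives the upper bound and thereby continuity, and the minimum on
  the unit sphere gives the lower bound.\<close>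

lemma is_norm_equivalent:
  fixes \<nu> :: "'a::euclidean_space \<Rightarrow> real"
  assumes "is_norm \<nu>"
  obtains \<kappa> where "\<kappa> \<ge> 1" "\<And>x. \<nu> x \<le> \<kappa> * norm x" "\<And>x. norm x \<le> \<kappa> * \<nu> x"
proof -
  have h: "\<And>c x. \<nu> (c *\<^sub>R x) = \<bar>c\<bar> * \<nu> x" "\<And>x y. \<nu> (x + y) \<le> \<nu> x + \<nu> y" "\<nu> 0 = 0"
    "\<And>x. \<nu> x = 0 \<Longrightarrow> x = 0"
    using assms by (auto simp: is_norm_def)
  have nonneg: "\<nu> x \<ge> 0" for x by (rule is_norm_nonneg[OF assms])
  define B where "B = (\<Sum>b\<in>Basis. \<nu> (b :: 'a))"
  have B: "\<nu> x \<le> B * norm x" for x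
  proof -
    have sum: "\<nu> (sum f S) \<le> (\<Sum>b\<in>S. \<nu> (f b))" if "finite S" for f and S :: "'a set"
      using that by induction (auto simp: h(3) intro: order_trans[OF h(2)])
    have "\<nu> x = \<nu> (\<Sum>b\<in>Basis. (x \<bullet> b) *\<^sub>R b)" by (simp add: euclidean_representation)
    also have "\<dots> \<le> (\<Sum>b\<in>Basis. \<nu> ((x \<bullet> b) *\<^sub>R b))" by (rule sum) simp
    also have "\<dots> \<le> (\<Sum>b\<in>Basis. norm x * \<nu> b)"
      unfolding h(1) by (intro sum_mono mult_right_mono nonneg) (simp add: Basis_le_norm)
    finally show ?thesis by (simp add: B_def sum_distrib_left mult.commute)
  qed
  have "continuous_on (sphere 0 1) \<nu>"
    unfolding continuous_on_iff
  proof (intro ballI allI impI)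
    fix x :: 'a and e :: real assume "e > 0"
    have B0: "B \<ge> 0" unfolding B_def by (intro sum_nonneg nonneg)
    have diff: "\<bar>\<nu> y - \<nu> x\<bar> \<le> B * norm (y - x)" for x y
    proof -
      have 1: "\<nu> y \<le> \<nu> x + \<nu> (y - x)" for x y using h(2)[of x "y - x"] by simp
      have "\<nu> (x - y) = \<nu> (y - x)" using h(1)[of "-1" "y - x"] by simp
      then have "\<bar>\<nu> y - \<nu> x\<bar> \<le> \<nu> (y - x)" using 1[of x y] 1[of y x] by linarith
      then show ?thesis using B[of "y - x"] by linarith
    qed
    show "\<exists>d>0. \<forall>x'\<in>sphere 0 1. dist x' x < d \<longrightarrow> dist (\<nu> x') (\<nu> x) < e"
    proof (intro exI[of _ "e / (B + 1)"] conjI ballI impI)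
      show "e / (B + 1) > 0" using \<open>e > 0\<close> B0 by simp
      fix y assume "dist y x < e / (B + 1)"
      then have "norm (y - x) * (B + 1) < e" using B0 by (simp add: dist_norm field_simps)
      moreover have "B * norm (y - x) \<le> norm (y - x) * (B + 1)" by (simp add: algebra_simps)
      ultimately show "dist (\<nu> y) (\<nu> x) < e"
        using diff[of y x] by (simp add: dist_real_def)
    qed
  qed
  moreover have "sphere (0::'a) 1 \<noteq> {}" by simp
  ultimately obtain z where z: "z \<in> sphere 0 1" "\<And>y. y \<in> sphere 0 1 \<Longrightarrow> \<nu> z \<le> \<nu> y"
    using continuous_attains_inf[OF compact_sphere] by blast
  have z0: "\<nu> z > 0" using nonneg[of z] h(4)[of z] z(1) by (cases "z = 0") force+
  have lower: "norm x \<le> inverse (\<nu> z) * \<nu> x" for x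
  proof (cases "x = 0")
    case False
    then have "\<nu> z \<le> \<nu> (x /\<^sub>R norm x)" by (intro z(2)) simp
    also have "\<dots> = \<nu> x / norm x" by (simp add: h(1) divide_inverse mult.commute)
    finally show ?thesis using z0 False by (simp add: field_simps)
  qed (simp add: h(3))
  show ?thesis
  proof (rule that[of "max 1 (max B (inverse (\<nu> z)))"])
    show "\<nu> x \<le> max 1 (max B (inverse (\<nu> z))) * norm x" for x
      by (rule order_trans[OF B mult_right_mono]) auto
    show "norm x \<le> max 1 (max B (inverse (\<nu> z))) * \<nu> x" for x
      by (rule order_trans[OF lower mult_right_mono]) (auto intro: nonneg)
  qed simp
qed

section \<open>Invariance of both norms under the orthogonal group\<close>

lemma norm_sq_trace: "(norm A)\<^sup>2 = trace (transpose A ** A)" for A :: "real^'n^'m"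
  unfolding norm_sq_matrix
  by (simp add: trace_def matrix_matrix_mult_def transpose_def power2_eq_square) (rule sum.swap)

lemma norm_transpose: "norm (transpose A) = norm A" for A :: "real^'n^'m"
proof -
  have "(norm (transpose A))\<^sup>2 = (norm A)\<^sup>2"
    unfolding norm_sq_matrix by (simp add: transpose_def) (rule sum.swap)
  then show ?thesis by simp
qed

lemma norm_orthogonal_mult_left:
  fixes A :: "real^'n^'m"
  assumes "orthogonal_matrix k" shows "norm (k ** A) = norm A"
proof -
  have "transpose (k ** A) ** (k ** A) = transpose A ** (transpose k ** k) ** A"
    by (simp only: matrix_transpose_mul matrix_mul_assoc)
  then have "(norm (k ** A))\<^sup>2 = (norm A)\<^sup>2"
    unfolding norm_sq_trace using assms by (simp add: orthogonal_matrix)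
  then show ?thesis by simp
qed

lemma norm_orthogonal_mult_right:
  fixes A :: "real^'n^'m"
  assumes "orthogonal_matrix k" shows "norm (A ** k) = norm A"
proof -
  have "norm (A ** k) = norm (transpose k ** transpose A)"
    by (simp only: norm_transpose flip: matrix_transpose_mul)
  also have "\<dots> = norm A"
    using assms by (simp add: norm_orthogonal_mult_left orthogonal_matrix_transpose norm_transpose)
  finally show ?thesis .
qed

lemma rho_mult: "rho (a ** b) = rho a ** rho b"
  by (rule rho_unique[symmetric]) (simp add: rho_wedge flip: matrix_vector_mul_assoc)

lemma rho_transpose: "rho (transpose a) = transpose (rho a)"
  by (simp add: rho_def wedge_def vec_eq_iff forall_3 transpose_def column_def mult.commute)

lemma rho_1: "rho (mat 1) = mat 1"
  by (rule rho_unique[symmetric]) simp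

text \<open>\<open>rho\<close> respects products and transposes. Hence \<open>norm (rho g)\<close>,
  like \<open>norm g\<close>, is unchanged by orthogonal factors on either side.\<close>

lemma orthogonal_matrix_rho: "orthogonal_matrix k \<Longrightarrow> orthogonal_matrix (rho k)"
  by (simp add: orthogonal_matrix rho_1 flip: rho_transpose rho_mult)

lemma norm_orthogonal_mult_vec:
  assumes "orthogonal_matrix k" shows "norm (k *v x) = norm (x :: real^'n)"
  using assms orthogonal_transformation_matrix[of "(*v) k"] orthogonal_transformation_norm
  by (metis matrix_of_matrix_vector_mul matrix_vector_mul_linear)

lemma SO3_transpose: "k \<in> SO3 \<Longrightarrow> transpose k \<in> SO3"
  and SO3_mult: "k \<in> SO3 \<Longrightarrow> l \<in> SO3 \<Longrightarrow> k ** l \<in> SO3"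
  and SO3_1: "mat 1 \<in> SO3"
  by (auto simp: SO3_def orthogonal_matrix_mul det_mul orthogonal_matrix_transpose orthogonal_matrix_id det_transpose)

lemma compact_SO3: "compact SO3"
  unfolding compact_eq_bounded_closed
proof
  have "norm k \<le> norm (mat 1 :: mat3)" if "k \<in> SO3" for k
    using that norm_orthogonal_mult_left[of k "mat 1"] by (simp add: SO3_def)
  then show "bounded SO3" by (auto simp: bounded_iff)
  have "closed {k :: mat3. transpose k ** k = mat 1 \<and> det k = 1}"
    unfolding transpose_def matrix_matrix_mult_def det_3
    by (intro closed_Collect_conj closed_Collect_eq continuous_intros)
  then show "closed SO3" by (simp add: SO3_def orthogonal_matrix)
qed

text \<open>Cosine and sine are separate parameters, so that a linear functional of a rotated matrix
  is linear in \<open>(c, s)\<close> on the unit circle.\<close>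

definition rot12 :: "real \<Rightarrow> real \<Rightarrow> mat3" where
  "rot12 c s = vector [vector [c, -s, 0], vector [s, c, 0], vector [0, 0, 1]]"
definition rot13 :: "real \<Rightarrow> real \<Rightarrow> mat3" where
  "rot13 c s = vector [vector [c, 0, -s], vector [0, 1, 0], vector [s, 0, c]]"
definition rot23 :: "real \<Rightarrow> real \<Rightarrow> mat3" where
  "rot23 c s = vector [vector [1, 0, 0], vector [0, c, -s], vector [0, s, c]]"

lemma rot_SO3:
  assumes "c\<^sup>2 + s\<^sup>2 = 1"
  shows "rot12 c s \<in> SO3" "rot13 c s \<in> SO3" "rot23 c s \<in> SO3"
  using assms
  by (auto simp: SO3_def orthogonal_matrix rot12_def rot13_def rot23_def vec_eq_iff forall_3
      matrix_matrix_mult_def sum_3 transpose_def mat_def det_3 power2_eq_square algebra_simps)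

text \<open>The maximum of \<open>A * c + B * s\<close> on the circle is
  \<open>sqrt (A\<^sup>2 + B\<^sup>2)\<close>, attained at \<open>(A / r, B / r)\<close>; it can be
  \<open>A\<close> only if \<open>B\<close> vanishes.\<close>

lemma linear_max_on_circle:
  fixes A B :: real
  assumes "\<And>c s. c\<^sup>2 + s\<^sup>2 = 1 \<Longrightarrow> A * c + B * s \<le> A"
  shows "B = 0 \<and> A \<ge> 0"
proof (rule ccontr)
  assume neg: "\<not> ?thesis"
  define r where "r = sqrt (A\<^sup>2 + B\<^sup>2)"
  have A: "A \<ge> 0" using assms[of "-1" 0] by simp
  with neg have B: "B \<noteq> 0" by simp
  then have r0: "r > 0" and r2: "r * r = A\<^sup>2 + B\<^sup>2"
    by (auto simp: r_def add_nonneg_pos)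
  have "(A / r)\<^sup>2 + (B / r)\<^sup>2 = 1"
    using r0 r2 B by (simp add: power_divide power2_eq_square flip: add_divide_distrib)
  from assms[OF this] have "(A * A + B * B) / r \<le> A" by (simp add: add_divide_distrib)
  moreover have "(A * A + B * B) / r = r"
    using r0 r2 by (simp add: field_simps power2_eq_square)
  ultimately have "r * r \<le> A * A" using A r0 by (intro mult_mono) auto
  then show False using r2 B by (simp add: power2_eq_square) (use not_square_less_zero[of B] in force)
qed

text \<open>
  A maximum of the linear functional \<open>M \<mapsto> 3 M\<^sub>1\<^sub>1 + 2 M\<^sub>2\<^sub>2 + M\<^sub>3\<^sub>3\<close> on the double coset
  is diagonal: vanishing derivatives along rotations on both sides give
  \<open>d\<^sub>i M\<^sub>j\<^sub>i = d\<^sub>j M\<^sub>i\<^sub>j\<close> and \<open>d\<^sub>i M\<^sub>i\<^sub>j = d\<^sub>j M\<^sub>j\<^sub>i\<close> with distinct positive weights \<open>d\<^sub>i\<close>.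
\<close>
lemma cartan_decomposition_exists:
  assumes g: "det g = 1"
  obtains k a k' where "k \<in> SO3" "a \<in> A_plus" "k' \<in> SO3" "g = k ** a ** k'"
proof -
  define S where "S = (\<lambda>(k, l). k ** g ** l) ` (SO3 \<times> SO3)"
  define \<phi> where "\<phi> M = 3 * M$1$1 + 2 * M$2$2 + M$3$3" for M :: mat3
  have "continuous_on (SO3 \<times> SO3) (\<lambda>(k, l). k ** g ** l)"
    unfolding case_prod_beta by (intro continuous_on_matrix_mult continuous_intros)
  then have "compact S"
    unfolding S_def by (intro compact_continuous_image compact_Times compact_SO3)
  moreover have "S \<noteq> {}" using SO3_1 by (auto simp: S_def)
  moreover have "continuous_on S \<phi>"
    unfolding \<phi>_def by (intro continuous_intros)
  ultimately obtain M where M: "M \<in> S" and max: "\<And>M'. M' \<in> S \<Longrightarrow> \<phi> M' \<le> \<phi> M"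
    using continuous_attains_sup[of S \<phi>] by blast
  obtain p q where pq: "p \<in> SO3" "q \<in> SO3" "M = p ** g ** q" using M by (auto simp: S_def)
  have max2: "\<phi> (k ** M ** l) \<le> \<phi> M" if "k \<in> SO3" "l \<in> SO3" for k l
  proof (rule max)
    have "k ** M ** l = (k ** p) ** g ** (q ** l)" by (simp add: pq(3) matrix_mul_assoc)
    then show "k ** M ** l \<in> S" using SO3_mult pq that unfolding S_def by (metis (mono_tags, lifting) SigmaI image_eqI split_conv)
  qed
  note maxl = max2[OF _ SO3_1, simplified] and maxr = max2[OF SO3_1, simplified]
  note mm = \<phi>_def rot12_def rot13_def rot23_def matrix_matrix_mult_def sum_3
  have a12: "2 * M$1$2 - 3 * M$2$1 = 0 \<and> 3 * M$1$1 + 2 * M$2$2 \<ge> 0"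
  proof (rule linear_max_on_circle)
    show "(3 * M$1$1 + 2 * M$2$2) * c + (2 * M$1$2 - 3 * M$2$1) * s \<le> 3 * M$1$1 + 2 * M$2$2"
      if "c\<^sup>2 + s\<^sup>2 = 1" for c s
      using maxl[OF rot_SO3(1)[OF that]] by (simp add: mm algebra_simps)
  qed
  have b12: "3 * M$1$2 - 2 * M$2$1 = 0 \<and> 3 * M$1$1 + 2 * M$2$2 \<ge> 0"
  proof (rule linear_max_on_circle)
    show "(3 * M$1$1 + 2 * M$2$2) * c + (3 * M$1$2 - 2 * M$2$1) * s \<le> 3 * M$1$1 + 2 * M$2$2"
      if "c\<^sup>2 + s\<^sup>2 = 1" for c s
      using maxr[OF rot_SO3(1)[OF that]] by (simp add: mm algebra_simps)
  qed
  have a13: "M$1$3 - 3 * M$3$1 = 0 \<and> 3 * M$1$1 + M$3$3 \<ge> 0"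
  proof (rule linear_max_on_circle)
    show "(3 * M$1$1 + M$3$3) * c + (M$1$3 - 3 * M$3$1) * s \<le> 3 * M$1$1 + M$3$3"
      if "c\<^sup>2 + s\<^sup>2 = 1" for c s
      using maxl[OF rot_SO3(2)[OF that]] by (simp add: mm algebra_simps)
  qed
  have b13: "3 * M$1$3 - M$3$1 = 0 \<and> 3 * M$1$1 + M$3$3 \<ge> 0"
  proof (rule linear_max_on_circle)
    show "(3 * M$1$1 + M$3$3) * c + (3 * M$1$3 - M$3$1) * s \<le> 3 * M$1$1 + M$3$3"
      if "c\<^sup>2 + s\<^sup>2 = 1" for c s
      using maxr[OF rot_SO3(2)[OF that]] by (simp add: mm algebra_simps)
  qed
  have a23: "M$2$3 - 2 * M$3$2 = 0 \<and> 2 * M$2$2 + M$3$3 \<ge> 0"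
  proof (rule linear_max_on_circle)
    show "(2 * M$2$2 + M$3$3) * c + (M$2$3 - 2 * M$3$2) * s \<le> 2 * M$2$2 + M$3$3"
      if "c\<^sup>2 + s\<^sup>2 = 1" for c s
      using maxl[OF rot_SO3(3)[OF that]] by (simp add: mm algebra_simps)
  qed
  have b23: "2 * M$2$3 - M$3$2 = 0 \<and> 2 * M$2$2 + M$3$3 \<ge> 0"
  proof (rule linear_max_on_circle)
    show "(2 * M$2$2 + M$3$3) * c + (2 * M$2$3 - M$3$2) * s \<le> 2 * M$2$2 + M$3$3"
      if "c\<^sup>2 + s\<^sup>2 = 1" for c s
      using maxr[OF rot_SO3(3)[OF that]] by (simp add: mm algebra_simps)
  qed
  have off: "M$1$2 = 0" "M$2$1 = 0" "M$1$3 = 0" "M$3$1 = 0" "M$2$3 = 0" "M$3$2 = 0"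
    using a12 b12 a13 b13 a23 b23 by auto
  \<comment> \<open>Opposite quarter turns on the two sides exchange two diagonal entries; the
    larger weight must already sit on the larger entry.\<close>
  have ord12: "M$1$1 \<ge> M$2$2"
    using max2[OF rot_SO3(1) rot_SO3(1), of 0 1 0 "-1"] by (simp add: mm off)
  have ord23: "M$2$2 \<ge> M$3$3"
    using max2[OF rot_SO3(3) rot_SO3(3), of 0 1 0 "-1"] by (simp add: mm off)
  have detM: "det M = 1" using g pq by (simp add: det_mul SO3_def)
  then have prod: "M$1$1 * M$2$2 * M$3$3 = 1" by (simp add: det_3 off)
  \<comment> \<open>A negative last entry would force the other two to be positive, by the
    inequalities in \<open>a13\<close> and \<open>a23\<close>, and the determinant to be
    negative.\<close>
  have pos: "M$3$3 > 0"
  proof (rule ccontr)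
    assume "\<not> M$3$3 > 0"
    with prod have m3: "M$3$3 < 0" by (metis linorder_cases mult_zero_right zero_neq_one)
    have "M$1$1 > 0" "M$2$2 > 0" using m3 a13 a23 by auto
    from mult_pos_neg[OF mult_pos_pos[OF this] m3] prod show False by simp
  qed
  then have "M \<in> A_plus"
    using ord12 ord23 detM by (auto simp: A_plus_def A_grp_def carrier_SL3 forall_3 off)
  moreover have "g = transpose p ** M ** transpose q"
  proof -
    have "transpose p ** M ** transpose q = (transpose p ** p) ** g ** (q ** transpose q)"
      by (simp add: pq(3) matrix_mul_assoc)
    then show ?thesis using pq by (simp add: SO3_def orthogonal_matrix_def)
  qed
  ultimately show ?thesis using that SO3_transpose pq(1,2) by blast
qed

lemma A_grp_det: "a \<in> A_grp \<Longrightarrow> a$1$1 * a$2$2 * a$3$3 = 1"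
  by (auto simp: A_grp_def carrier_SL3 det_3)

text \<open>The largest and smallest diagonal entries are the extreme stretching factors of
  \<open>x \<mapsto> a x\<close>, which orthogonal factors do not change.\<close>

lemma A_plus_le:
  assumes "a \<in> A_plus" "b \<in> A_plus" "orthogonal_matrix p" "orthogonal_matrix q" "b = p ** a ** q"
  shows "b$1$1 \<le> a$1$1" "a$3$3 \<le> b$3$3"
proof -
  have diag: "(a *v x)$i = a$i$i * x$i" if "a \<in> A_plus" for a x and i :: 3
    using that exhaust_3[of i] by (auto simp: A_plus_def A_grp_def matrix_vector_mult_def sum_3)
  have nsq: "(norm x)\<^sup>2 = (x$1)\<^sup>2 + (x$2)\<^sup>2 + (x$3)\<^sup>2" for x :: "real^3"
    unfolding power2_norm_eq_inner inner_vec_def by (simp add: sum_3 power2_eq_square)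
  have a: "a$1$1 \<ge> a$2$2" "a$2$2 \<ge> a$3$3" "a$3$3 > 0" and b: "b$1$1 > 0" "b$3$3 > 0"
    using assms(1,2) by (auto simp: A_plus_def A_grp_def)
  have up: "norm (a *v x) \<le> a$1$1 * norm x" for x
  proof (rule power2_le_imp_le)
    have "(a$2$2)\<^sup>2 \<le> (a$1$1)\<^sup>2" "(a$3$3)\<^sup>2 \<le> (a$1$1)\<^sup>2" using a by (auto intro!: power_mono)
    then show "(norm (a *v x))\<^sup>2 \<le> (a$1$1 * norm x)\<^sup>2"
      unfolding power_mult_distrib nsq diag[OF assms(1)] distrib_left
      by (intro add_mono mult_right_mono) auto
  qed (use a in auto)
  have lo: "a$3$3 * norm x \<le> norm (a *v x)" for x
  proof (rule power2_le_imp_le)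
    have "(a$3$3)\<^sup>2 \<le> (a$1$1)\<^sup>2" "(a$3$3)\<^sup>2 \<le> (a$2$2)\<^sup>2" using a by (auto intro!: power_mono)
    then show "(a$3$3 * norm x)\<^sup>2 \<le> (norm (a *v x))\<^sup>2"
      unfolding power_mult_distrib nsq diag[OF assms(1)] distrib_left
      by (intro add_mono mult_right_mono) auto
  qed auto
  have bn: "norm (b *v x) = norm (a *v (q *v x))" for x
    using norm_orthogonal_mult_vec[OF assms(3), of "a *v (q *v x)"]
    by (simp add: assms(5) matrix_vector_mul_assoc matrix_mul_assoc)
  have be: "norm (b *v axis i 1) = b$i$i" for i
  proof -
    have "b *v axis i 1 = b$i$i *\<^sub>R axis i 1"
      by (simp add: vec_eq_iff diag[OF assms(2)] axis_def)
    then show ?thesis using b assms(2) by (simp add: A_plus_def A_grp_def less_imp_le)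
  qed
  have qn: "norm (q *v axis i (1::real)) = 1" for i
    by (simp add: norm_orthogonal_mult_vec[OF assms(4)])
  show "b$1$1 \<le> a$1$1" using up[of "q *v axis 1 1"] be[of 1] bn[of "axis 1 1"] qn[of 1] by simp
  show "a$3$3 \<le> b$3$3" using lo[of "q *v axis 3 1"] be[of 3] bn[of "axis 3 1"] qn[of 3] by simp
qed

text \<open>The comparison in both directions fixes the outer entries, and determinant 1 fixes the
  middle one.\<close>

lemma A_plus_unique:
  assumes ab: "a \<in> A_plus" "b \<in> A_plus" and pq: "orthogonal_matrix p" "orthogonal_matrix q" and b: "b = p ** a ** q"
  shows "b = a"
proof -
  have "transpose p ** b ** transpose q = (transpose p ** p) ** a ** (q ** transpose q)"
    by (simp add: b matrix_mul_assoc)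
  then have a: "a = transpose p ** b ** transpose q" using pq by (simp add: orthogonal_matrix_def)
  have *: "b$1$1 = a$1$1" "b$3$3 = a$3$3"
    using A_plus_le[OF ab pq b] A_plus_le[OF ab(2,1) _ _ a] pq
    by (auto simp: orthogonal_matrix_transpose intro: antisym)
  have ag: "a \<in> A_grp" "b \<in> A_grp" using ab by (auto simp: A_plus_def)
  then have "a$1$1 \<noteq> 0" "a$3$3 \<noteq> 0" by (auto simp: A_grp_def less_imp_neq[symmetric])
  moreover have "a$1$1 * a$2$2 * a$3$3 = a$1$1 * b$2$2 * a$3$3"
    using A_grp_det[OF ag(1)] A_grp_det[OF ag(2)] * by simp
  ultimately have "b$2$2 = a$2$2" by simp
  then show ?thesis using * ag by (auto simp: vec_eq_iff forall_3 A_grp_def)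
qed

text \<open>Existence and uniqueness evaluate the definite description. Later arguments use of the
  projection only that it lies in \<open>A_plus\<close> and has these two norms.\<close>

lemma cartan_proj:
  assumes g: "det g = 1"
  shows "cartan_proj g \<in> A_plus" "norm (cartan_proj g) = norm g"
    "norm (rho (cartan_proj g)) = norm (rho g)"
proof -
  obtain k a k' where k: "k \<in> SO3" "a \<in> A_plus" "k' \<in> SO3" "g = k ** a ** k'"
    by (rule cartan_decomposition_exists[OF g])
  have "cartan_proj g = a"
    unfolding cartan_proj_def set_mult_SL3
  proof (rule the_equality)
    show "a \<in> A_plus \<and> g \<in> {x ** y |x y. x \<in> {x ** y |x y. x \<in> SO3 \<and> y \<in> {a}} \<and> y \<in> SO3}"
      using k by auto
    fix b assume b: "b \<in> A_plus \<and> g \<in> {x ** y |x y. x \<in> {x ** y |x y. x \<in> SO3 \<and> y \<in> {b}} \<and> y \<in> SO3}"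
    then obtain l l' where l: "l \<in> SO3" "l' \<in> SO3" "g = l ** b ** l'" by auto
    have "(transpose l ** k) ** a ** (k' ** transpose l') = transpose l ** (l ** b ** l') ** transpose l'"
      unfolding l(3)[symmetric] k(4) by (simp add: matrix_mul_assoc)
    also have "\<dots> = (transpose l ** l) ** b ** (l' ** transpose l')"
      by (simp add: matrix_mul_assoc)
    also have "\<dots> = b" using l by (simp add: SO3_def orthogonal_matrix_def)
    finally have "b = (transpose l ** k) ** a ** (k' ** transpose l')" ..
    then show "b = a"
      using b k l by (intro A_plus_unique[of a b "transpose l ** k" "k' ** transpose l'"])
        (auto simp: SO3_def orthogonal_matrix_mul orthogonal_matrix_transpose)
  qed
  then show "cartan_proj g \<in> A_plus" "norm (cartan_proj g) = norm g"
    "norm (rho (cartan_proj g)) = norm (rho g)"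
    using k by (auto simp: SO3_def rho_mult norm_orthogonal_mult_left norm_orthogonal_mult_right
        orthogonal_matrix_rho)
qed

section \<open>Coarse equivalence in the Weyl chamber\<close>

definition within_factor :: "real \<Rightarrow> real \<Rightarrow> real \<Rightarrow> bool" where
  "within_factor L x y \<longleftrightarrow> x \<le> L * y \<and> y \<le> L * x"

text \<open>In the chamber each norm is comparable to its dominant entry, so the pair of norms
  determines \<open>a\<close> up to a bounded factor.\<close>

lemma A_plus_norm_bounds:
  assumes "a \<in> A_plus"
  shows "a$1$1 \<le> norm a" "norm a \<le> 3 * a$1$1"
    "a$1$1 * a$2$2 \<le> norm (rho a)" "norm (rho a) \<le> 3 * (a$1$1 * a$2$2)"
proof -
  have a: "a$1$1 \<ge> a$2$2" "a$2$2 \<ge> a$3$3" "a$3$3 > 0"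
    and off: "\<And>i j. i \<noteq> j \<Longrightarrow> a$i$j = 0"
    using assms by (auto simp: A_plus_def A_grp_def)
  have n: "(norm a)\<^sup>2 = (a$1$1)\<^sup>2 + (a$2$2)\<^sup>2 + (a$3$3)\<^sup>2"
    by (simp add: norm_sq_matrix sum_3 off)
  have r: "(norm (rho a))\<^sup>2 = (a$1$1 * a$2$2)\<^sup>2 + (a$1$1 * a$3$3)\<^sup>2 + (a$2$2 * a$3$3)\<^sup>2"
    by (simp add: norm_sq_matrix sum_3 off rho_def wedge_def transpose_def column_def)
  have sq: "(a$2$2)\<^sup>2 \<le> (a$1$1)\<^sup>2" "(a$3$3)\<^sup>2 \<le> (a$1$1)\<^sup>2" using a by (auto intro!: power_mono)
  have "a$1$1 * a$3$3 \<le> a$1$1 * a$2$2" "a$2$2 * a$3$3 \<le> a$1$1 * a$2$2"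
    using a by (auto intro!: mult_mono)
  then have rq: "(a$1$1 * a$3$3)\<^sup>2 \<le> (a$1$1 * a$2$2)\<^sup>2" "(a$2$2 * a$3$3)\<^sup>2 \<le> (a$1$1 * a$2$2)\<^sup>2"
    using a by (auto intro!: power_mono)
  show "a$1$1 \<le> norm a" by (rule power2_le_imp_le) (auto simp: n)
  show "norm a \<le> 3 * a$1$1"
  proof (rule power2_le_imp_le)
    have "(3 * a$1$1)\<^sup>2 = 9 * (a$1$1)\<^sup>2" by (simp add: power_mult_distrib)
    then show "(norm a)\<^sup>2 \<le> (3 * a$1$1)\<^sup>2" using sq n zero_le_power2[of "a$1$1"] by linarith
    show "0 \<le> 3 * a$1$1" using a by simp
  qed
  show "a$1$1 * a$2$2 \<le> norm (rho a)" by (rule power2_le_imp_le) (auto simp: r)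
  show "norm (rho a) \<le> 3 * (a$1$1 * a$2$2)"
  proof (rule power2_le_imp_le)
    have "(3 * (a$1$1 * a$2$2))\<^sup>2 = 9 * (a$1$1 * a$2$2)\<^sup>2" by (simp add: power_mult_distrib)
    then show "(norm (rho a))\<^sup>2 \<le> (3 * (a$1$1 * a$2$2))\<^sup>2" using rq r zero_le_power2[of "a$1$1 * a$2$2"] by linarith
    show "0 \<le> 3 * (a$1$1 * a$2$2)" using a by simp
  qed
qed

text \<open>Elements of the chamber with comparable norm pairs differ by a diagonal factor
  \<open>c\<close> with bounded entries. The quotients of \<open>a$1$1\<close> and of
  \<open>a$1$1 * a$2$2\<close> are controlled by \<open>3 * L\<close>, hence that of the middle
  entries by \<open>(3 * L)\<^sup>2\<close>, which is the 9 in \<open>C\<close>; the last entry is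
  inverse to \<open>a$1$1 * a$2$2\<close>.\<close>

lemma coarse_eqI:
  assumes X: "X \<subseteq> A_plus" and Y: "Y \<subseteq> A_plus" and L: "L \<ge> 1"
    and XY: "\<And>x. x \<in> X \<Longrightarrow> \<exists>y\<in>Y. within_factor L (norm x) (norm y) \<and> within_factor L (norm (rho x)) (norm (rho y))"
    and YX: "\<And>y. y \<in> Y \<Longrightarrow> \<exists>x\<in>X. within_factor L (norm x) (norm y) \<and> within_factor L (norm (rho x)) (norm (rho y))"
  shows "coarse_eq X Y"
proof -
  define C where "C = {c \<in> A_grp. \<forall>i. 1 / (9 * L\<^sup>2) \<le> c$i$i \<and> c$i$i \<le> 9 * L\<^sup>2}"
  have "compact C"
    unfolding compact_eq_bounded_closed
  proof
    have "norm c \<le> 27 * L\<^sup>2" if "c \<in> C" for c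
    proof (rule power2_le_imp_le)
      have "(c$i$i)\<^sup>2 \<le> (9 * L\<^sup>2)\<^sup>2" for i
        using that by (intro power_mono) (auto simp: C_def A_grp_def less_imp_le)
      moreover have "(norm c)\<^sup>2 = (c$1$1)\<^sup>2 + (c$2$2)\<^sup>2 + (c$3$3)\<^sup>2"
        using that by (simp add: norm_sq_matrix C_def A_grp_def sum_3)
      ultimately have "(norm c)\<^sup>2 \<le> (9 * L\<^sup>2)\<^sup>2 + (9 * L\<^sup>2)\<^sup>2 + (9 * L\<^sup>2)\<^sup>2"
        by (metis add_mono)
      also have "\<dots> \<le> (27 * L\<^sup>2)\<^sup>2" by (simp add: power_mult_distrib)
      finally show "(norm c)\<^sup>2 \<le> (27 * L\<^sup>2)\<^sup>2" .
    qed simp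
    then show "bounded C" by (auto simp: bounded_iff)
    \<comment> \<open>The lower bound on the entries implies the strict positivity in
      \<open>A_grp\<close>, so \<open>C\<close> is described by closed conditions alone.\<close>
    have "0 < 1 / (9 * L\<^sup>2)" using L by (auto simp: power2_eq_square)
    then have C: "C = {c. det c = 1 \<and> (\<forall>i j. i \<noteq> j \<longrightarrow> c$i$j = 0) \<and> (\<forall>i. 1 / (9 * L\<^sup>2) \<le> c$i$i \<and> c$i$i \<le> 9 * L\<^sup>2)}"
      unfolding C_def A_grp_def carrier_SL3 by (auto intro: less_le_trans[of 0 "1 / (9 * L\<^sup>2)"])
    show "closed C"
      unfolding C det_3
      by (intro closed_Collect_conj closed_Collect_all closed_Collect_imp closed_Collect_eq
          closed_Collect_le continuous_intros open_Collect_const)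
  qed
  have key: "\<exists>c\<in>C. a = b ** c"
    if ab: "a \<in> A_plus" "b \<in> A_plus" "within_factor L (norm a) (norm b)"
      "within_factor L (norm (rho a)) (norm (rho b))" for a b
  proof -
    have a: "a$1$1 > 0" "a$2$2 > 0" "a$3$3 > 0" and b: "b$1$1 > 0" "b$2$2 > 0" "b$3$3 > 0"
      and off: "\<And>i j. i \<noteq> j \<Longrightarrow> a$i$j = 0" "\<And>i j. i \<noteq> j \<Longrightarrow> b$i$j = 0"
      using ab by (auto simp: A_plus_def A_grp_def)
    have pa: "a$1$1 * a$2$2 * a$3$3 = 1" and pb: "b$1$1 * b$2$2 * b$3$3 = 1"
      using ab A_grp_det by (auto simp: A_plus_def)
    define c :: mat3 where "c = (\<chi> i j. if i = j then a$i$i / b$i$i else 0)"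
    have step: "x \<le> 3 * L * y" if "x \<le> n" "n \<le> L * m" "m \<le> 3 * y" for x y n m :: real
    proof -
      have "L * m \<le> L * (3 * y)" using that L by (intro mult_left_mono) auto
      then have "x \<le> L * (3 * y)" using that by linarith
      then show ?thesis by (simp add: mult_ac)
    qed
    have 1: "a$1$1 \<le> 3 * L * b$1$1" "b$1$1 \<le> 3 * L * a$1$1"
      "a$1$1 * a$2$2 \<le> 3 * L * (b$1$1 * b$2$2)" "b$1$1 * b$2$2 \<le> 3 * L * (a$1$1 * a$2$2)"
      using ab A_plus_norm_bounds[OF ab(1)] A_plus_norm_bounds[OF ab(2)]
      unfolding within_factor_def by (blast intro: step)+
    have two: "x2 \<le> 9 * L\<^sup>2 * y2" if "y1 \<le> 3 * L * x1" "x1 * x2 \<le> 3 * L * (y1 * y2)" "x1 > 0" "y2 > 0" for x1 x2 y1 y2 :: real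
    proof -
      have "x1 * x2 \<le> 3 * L * (y1 * y2)" by fact
      also have "\<dots> \<le> 3 * L * ((3 * L * x1) * y2)"
        using that L by (intro mult_left_mono mult_right_mono) auto
      finally have "x1 * x2 \<le> x1 * (9 * L\<^sup>2 * y2)" by (simp add: power2_eq_square mult_ac)
      then show ?thesis using that by simp
    qed
    have three: "x3 \<le> 3 * L * y3" if "q \<le> 3 * L * p" "p * x3 = 1" "q * y3 = 1" "x3 > 0" "y3 > 0" for p q x3 y3 :: real
    proof -
      have "q * (x3 * y3) \<le> 3 * L * p * (x3 * y3)" using that by (intro mult_right_mono) auto
      moreover have "q * (x3 * y3) = (q * y3) * x3" "3 * L * p * (x3 * y3) = 3 * L * y3 * (p * x3)" by simp_all
      ultimately show ?thesis using that by simp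
    qed
    have L9: "3 * L \<le> 9 * L\<^sup>2" using L by (simp add: power2_eq_square)
    have "x \<le> 9 * L\<^sup>2 * y" if "x \<le> 3 * L * y" "y > 0" for x y
      using order_trans[OF that(1) mult_right_mono[OF L9]] that(2) by simp
    then have 2: "a$i$i \<le> 9 * L\<^sup>2 * b$i$i \<and> b$i$i \<le> 9 * L\<^sup>2 * a$i$i" for i
      using exhaust_3[of i] 1 a b two[OF 1(2,3)] two[OF 1(1,4)] three[OF 1(4) pa pb] three[OF 1(3) pb pa]
      by auto
    have 3: "1 / (9 * L\<^sup>2) \<le> c$i$i \<and> c$i$i \<le> 9 * L\<^sup>2 \<and> c$i$i > 0" for i
      using 2[of i] a b L exhaust_3[of i] by (auto simp: c_def field_simps)
    have "det c = 1"
      using a b pa pb by (simp add: det_3 c_def)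
    with 3 have "c \<in> C" by (auto simp: C_def A_grp_def carrier_SL3 c_def)
    moreover have "a = b ** c"
      using a b by (simp add: vec_eq_iff forall_3 matrix_matrix_mult_def sum_3 c_def off)
    ultimately show ?thesis by blast
  qed
  have sym: "within_factor L x y \<Longrightarrow> within_factor L y x" for x y by (auto simp: within_factor_def)
  show ?thesis
    unfolding coarse_eq_def set_mult_SL3
  proof (intro exI[of _ C] conjI subsetI)
    show "compact C" by fact
    show "x \<in> C \<Longrightarrow> x \<in> A_grp" for x by (simp add: C_def)
    show "x \<in> {y ** c |y c. y \<in> Y \<and> c \<in> C}" if "x \<in> X" for x
      using XY[OF that] key X Y that by blast
    show "y \<in> {x ** c |x c. x \<in> X \<and> c \<in> C}" if "y \<in> Y" for y
      using YX[OF that] key sym X Y that by blast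
  qed
qed

section \<open>The band\<close>

text \<open>
  For the two-dimensional subgroups of part (3), \<open>sq_norm c t s\<close> and \<open>sq_norm_rho c t s\<close> are the
  squared Euclidean norms of \<open>h\<close> and \<open>rho h\<close>, with \<open>t\<close> and \<open>s\<close> parametrizing the subgroup.
\<close>
definition sq_norm :: "real \<Rightarrow> real \<Rightarrow> real \<Rightarrow> real" where
  "sq_norm c t s = 2 * (exp t)\<^sup>2 + (c * t * exp t)\<^sup>2 + (exp (- 2 * t))\<^sup>2 + s\<^sup>2"

definition sq_norm_rho :: "real \<Rightarrow> real \<Rightarrow> real \<Rightarrow> real" where
  "sq_norm_rho c t s = (exp (2 * t))\<^sup>2 + 2 * (exp (- t))\<^sup>2 + (c * t * exp (- t))\<^sup>2 + (s * exp t)\<^sup>2"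

text \<open>The two limits of the band with square root and quotient cleared: \<open>r ln r\<close>
  against \<open>p\<^sup>2\<close>, and \<open>p ln r\<close> against \<open>r\<^sup>2\<close>. In
  this form it makes sense also at \<open>r = 1\<close>.\<close>

definition in_band :: "real \<Rightarrow> real \<Rightarrow> real \<Rightarrow> bool" where
  "in_band K r p \<longleftrightarrow> r * ln r \<le> K * p\<^sup>2 \<and> p * ln r \<le> K * r\<^sup>2"

lemma ln_le_sqrt: "x > 0 \<Longrightarrow> ln x \<le> 2 * sqrt x" for x :: real
  using ln_le_minus_one[of "sqrt x"] by (simp add: ln_sqrt)

lemma abs_le_exp_abs: "\<bar>t\<bar> \<le> exp \<bar>t\<bar>" for t :: real
  using exp_ge_add_one_self[of "\<bar>t\<bar>"] by linarith

lemma sum_squares_le_square: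
  fixes a b c d :: real
  assumes "a \<ge> 0" "b \<ge> 0" "c \<ge> 0" "d \<ge> 0"
  shows "2 * a\<^sup>2 + b\<^sup>2 + c\<^sup>2 + d\<^sup>2 \<le> (2 * a + b + c + d)\<^sup>2"
  using assms mult_nonneg_nonneg[of a b] mult_nonneg_nonneg[of a c] mult_nonneg_nonneg[of a d]
    mult_nonneg_nonneg[of b c] mult_nonneg_nonneg[of b d] mult_nonneg_nonneg[of c d]
  by (simp add: power2_eq_square algebra_simps)

lemma sqrt_sq_norm_bounds:
  defines "r \<equiv> \<lambda>c t s. sqrt (sq_norm c t s)"
  shows "exp t \<le> r c t s" "\<bar>c\<bar> * \<bar>t\<bar> * exp t \<le> r c t s" "exp (- 2 * t) \<le> r c t s" "\<bar>s\<bar> \<le> r c t s"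
    "1 \<le> r c t s" "r c t s \<le> 2 * exp t + \<bar>c\<bar> * \<bar>t\<bar> * exp t + exp (- 2 * t) + \<bar>s\<bar>"
proof -
  show 1: "exp t \<le> r c t s" unfolding r_def sq_norm_def by (rule real_le_rsqrt) simp
  show "\<bar>c\<bar> * \<bar>t\<bar> * exp t \<le> r c t s"
    unfolding r_def sq_norm_def by (rule real_le_rsqrt) (simp add: power_mult_distrib)
  show 3: "exp (- 2 * t) \<le> r c t s" unfolding r_def sq_norm_def by (rule real_le_rsqrt) simp
  show "\<bar>s\<bar> \<le> r c t s" unfolding r_def sq_norm_def by (rule real_le_rsqrt) simp
  have "1 \<le> exp t \<or> 1 \<le> exp (- 2 * t)" by auto
  then show "1 \<le> r c t s" using 1 3 by linarith
  show "r c t s \<le> 2 * exp t + \<bar>c\<bar> * \<bar>t\<bar> * exp t + exp (- 2 * t) + \<bar>s\<bar>"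
    unfolding r_def
  proof (rule real_le_lsqrt)
    show "sq_norm c t s \<le> (2 * exp t + \<bar>c\<bar> * \<bar>t\<bar> * exp t + exp (- 2 * t) + \<bar>s\<bar>)\<^sup>2"
      using sum_squares_le_square[of "exp t" "\<bar>c\<bar> * \<bar>t\<bar> * exp t" "exp (- 2 * t)" "\<bar>s\<bar>"]
      by (simp add: sq_norm_def power_mult_distrib)
  qed simp
qed

lemma sqrt_sq_norm_rho_bounds:
  defines "p \<equiv> \<lambda>c t s. sqrt (sq_norm_rho c t s)"
  shows "exp (2 * t) \<le> p c t s" "\<bar>s\<bar> * exp t \<le> p c t s"
    "p c t s \<le> exp (2 * t) + 2 * exp (- t) + \<bar>c\<bar> * \<bar>t\<bar> * exp (- t) + \<bar>s\<bar> * exp t"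
proof -
  show "exp (2 * t) \<le> p c t s" unfolding p_def sq_norm_rho_def by (rule real_le_rsqrt) simp
  show "\<bar>s\<bar> * exp t \<le> p c t s"
    unfolding p_def sq_norm_rho_def by (rule real_le_rsqrt) (simp add: power_mult_distrib)
  show "p c t s \<le> exp (2 * t) + 2 * exp (- t) + \<bar>c\<bar> * \<bar>t\<bar> * exp (- t) + \<bar>s\<bar> * exp t"
    unfolding p_def
  proof (rule real_le_lsqrt)
    show "sq_norm_rho c t s \<le> (exp (2 * t) + 2 * exp (- t) + \<bar>c\<bar> * \<bar>t\<bar> * exp (- t) + \<bar>s\<bar> * exp t)\<^sup>2"
      using sum_squares_le_square[of "exp (- t)" "exp (2 * t)" "\<bar>c\<bar> * \<bar>t\<bar> * exp (- t)" "\<bar>s\<bar> * exp t"]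
      by (simp add: sq_norm_rho_def power_mult_distrib add.commute)
  qed simp
qed

text \<open>The core is \<open>exp t * ln r \<le> K * r\<close>. Multiplied by
  \<open>exp t \<le> r\<close> and by \<open>\<bar>s\<bar> \<le> r\<close> it bounds the two large
  terms of the norm of \<open>rho h\<close>, each with constant \<open>K\<close>; the two decaying
  terms contribute \<open>2 + \<bar>c\<bar>\<close>.\<close>

lemma sq_norm_upper:
  assumes c: "c \<noteq> 0"
  shows "sqrt (sq_norm_rho c t s) * ln (sqrt (sq_norm c t s))
    \<le> (2 * (3 + 2 / \<bar>c\<bar>) + 2 + \<bar>c\<bar>) * (sqrt (sq_norm c t s))\<^sup>2"
proof -
  define r where "r = sqrt (sq_norm c t s)"
  define K where "K = 3 + 2 / \<bar>c\<bar>"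
  note b = sqrt_sq_norm_bounds[where c = c and t = t and s = s, folded r_def]
  have l0: "ln r \<ge> 0" and lr: "ln r \<le> r" using b(5) ln_le_minus_one[of r] by auto
  have key: "exp t * ln r \<le> K * r"
  proof -
    have K2: "2 / \<bar>c\<bar> * r \<ge> 0" using b(5) by simp
    have K: "K * r = 3 * r + 2 / \<bar>c\<bar> * r" by (simp add: K_def algebra_simps)
    \<comment> \<open>For \<open>t \<le> 1\<close> the bound \<open>exp 1 \<le> 3\<close> suffices.
      If \<open>r \<le> exp (2 * t)\<close>, then \<open>ln r \<le> 2 * t\<close> and the entry
      \<open>c * t * exp t\<close> pays for the factor \<open>t\<close>. Otherwise
      \<open>exp t \<le> sqrt r\<close>, and \<open>ln r \<le> 2 * sqrt r\<close>.\<close>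
    consider "t \<le> 1" | "t \<ge> 1" "r \<le> exp (2 * t)" | "exp (2 * t) \<le> r" by linarith
    then show ?thesis
    proof cases
      case 1
      then have "exp t \<le> 3" using exp_le by (meson exp_le_cancel_iff order_trans)
      then have "exp t * ln r \<le> 3 * r" using lr l0 by (intro mult_mono) auto
      then show ?thesis using K K2 by linarith
    next
      case 2
      then have "ln r \<le> 2 * t" using b(5) by (metis ln_exp ln_le_cancel_iff exp_gt_zero less_le_trans zero_less_one)
      then have "exp t * ln r \<le> exp t * (2 * t)" by (intro mult_left_mono) auto
      also have "\<dots> = 2 / \<bar>c\<bar> * (\<bar>c\<bar> * \<bar>t\<bar> * exp t)" using c 2 by simp
      also have "\<dots> \<le> 2 / \<bar>c\<bar> * r" using b(2) by (intro mult_left_mono) auto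
      finally show ?thesis using K b(5) by linarith
    next
      case 3
      have "exp t \<le> sqrt r" using 3 by (intro real_le_rsqrt) (simp add: exp_double)
      moreover have "ln r \<le> 2 * sqrt r" using b(5) by (intro ln_le_sqrt) simp
      ultimately have "exp t * ln r \<le> sqrt r * (2 * sqrt r)" using l0 b(5) by (intro mult_mono) auto
      also have "\<dots> = 2 * r" using b(5) by simp
      finally show ?thesis using K K2 b(5) by linarith
    qed
  qed
  have 1: "exp (2 * t) * ln r \<le> K * r\<^sup>2"
  proof -
    have "exp t * (exp t * ln r) \<le> r * (K * r)"
      using b(1,5) l0 by (intro mult_mono[OF _ key]) auto
    then show ?thesis unfolding exp_double power2_eq_square by (simp add: mult_ac)
  qed
  have 2: "exp (- t) * ln r \<le> r\<^sup>2"
  proof -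
    have "exp (- t) \<le> r"
    proof (cases "t \<ge> 0")
      case True
      then have "exp (- t) \<le> 1" by simp
      then show ?thesis using b(5) by linarith
    next
      case False
      then have "exp (- t) \<le> exp (- 2 * t)" by simp
      then show ?thesis using b(3) by linarith
    qed
    then have "exp (- t) * ln r \<le> r * r" using lr l0 b(5) by (intro mult_mono) auto
    then show ?thesis by (simp add: power2_eq_square)
  qed
  have 3: "\<bar>c\<bar> * \<bar>t\<bar> * exp (- t) * ln r \<le> \<bar>c\<bar> * r\<^sup>2"
  proof -
    have "\<bar>t\<bar> * exp (- t) \<le> r"
    proof (cases "t \<ge> 0")
      case True
      then have "\<bar>t\<bar> * exp (- t) \<le> exp t * exp (- t)"
        using abs_le_exp_abs[of t] by (intro mult_right_mono) auto
      then show ?thesis using b(5) by (simp flip: exp_add)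
    next
      case False
      then have "\<bar>t\<bar> * exp (- t) \<le> exp (- t) * exp (- t)"
        using abs_le_exp_abs[of t] by (intro mult_right_mono) auto
      then show ?thesis using b(3) by (simp flip: exp_add)
    qed
    then have "\<bar>t\<bar> * exp (- t) * ln r \<le> r * r" using lr l0 b(5) by (intro mult_mono) auto
    then have "\<bar>c\<bar> * (\<bar>t\<bar> * exp (- t) * ln r) \<le> \<bar>c\<bar> * (r * r)" by (intro mult_left_mono) auto
    then show ?thesis by (simp add: power2_eq_square mult_ac)
  qed
  have 4: "\<bar>s\<bar> * exp t * ln r \<le> K * r\<^sup>2"
  proof -
    have "\<bar>s\<bar> * (exp t * ln r) \<le> r * (K * r)" using b(4,5) l0 by (intro mult_mono[OF _ key]) auto
    then show ?thesis by (simp add: power2_eq_square mult_ac)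
  qed
  have "sqrt (sq_norm_rho c t s) * ln r
     \<le> (exp (2 * t) + 2 * exp (- t) + \<bar>c\<bar> * \<bar>t\<bar> * exp (- t) + \<bar>s\<bar> * exp t) * ln r"
    by (intro mult_right_mono sqrt_sq_norm_rho_bounds l0)
  also have "\<dots> \<le> (2 * K + 2 + \<bar>c\<bar>) * r\<^sup>2"
    using 1 2 3 4 by (simp add: algebra_simps)
  finally show ?thesis by (simp only: r_def K_def)
qed

text \<open>Here even \<open>r \<le> (4 + \<bar>c\<bar>) * p\<close> holds, and
  \<open>ln r \<le> r\<close> gives the claim with room to spare.\<close>

lemma sq_norm_lower_nonneg:
  assumes t: "t \<ge> 0"
  shows "sqrt (sq_norm c t s) * ln (sqrt (sq_norm c t s))
    \<le> (4 + \<bar>c\<bar>)\<^sup>2 * sq_norm_rho c t s"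
proof -
  define r where "r = sqrt (sq_norm c t s)"
  define p where "p = sqrt (sq_norm_rho c t s)"
  note b = sqrt_sq_norm_bounds[where c = c and t = t and s = s, folded r_def]
  note d = sqrt_sq_norm_rho_bounds[where c = c and t = t and s = s, folded p_def]
  have p2: "sq_norm_rho c t s = p\<^sup>2" by (simp add: p_def sq_norm_rho_def)
  have "exp t \<le> exp (2 * t)" using t by simp
  then have 1: "exp t \<le> p" using d(1) by linarith
  have "t * exp t \<le> exp t * exp t"
    using abs_le_exp_abs[of t] t by (intro mult_right_mono) auto
  then have "\<bar>t\<bar> * exp t \<le> p" using d(1) t by (simp flip: exp_add)
  then have "\<bar>c\<bar> * (\<bar>t\<bar> * exp t) \<le> \<bar>c\<bar> * p" by (intro mult_left_mono) auto
  moreover have "1 \<le> exp t" "exp (- 2 * t) \<le> 1" using t by auto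
  moreover have "\<bar>s\<bar> * 1 \<le> \<bar>s\<bar> * exp t" using t by (intro mult_left_mono) auto
  then have "\<bar>s\<bar> \<le> p" using d(2) by linarith
  ultimately have "r \<le> (4 + \<bar>c\<bar>) * p"
    using b(6) 1 unfolding mult.assoc distrib_right by linarith
  then have "r * r \<le> ((4 + \<bar>c\<bar>) * p) * ((4 + \<bar>c\<bar>) * p)" using b(5) by (intro mult_mono) auto
  moreover have "r * ln r \<le> r * r" using b(5) ln_le_minus_one[of r] by (intro mult_left_mono) auto
  ultimately show ?thesis
    unfolding p2 r_def[symmetric] by (simp add: power2_eq_square mult_ac)
qed

text \<open>With \<open>X = exp (- t)\<close>, up to constants \<open>r\<close> is at most
  \<open>1 + X\<^sup>2 + \<bar>s\<bar>\<close>, and \<open>G\<close>, the squared norm of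
  \<open>rho h\<close>, contains the squares of \<open>X\<close>, \<open>c * \<tau> * X\<close> and
  \<open>s / X\<close>. If \<open>\<bar>s\<bar> \<le> X^4\<close>, then \<open>ln r\<close> is at
  most linear in \<open>\<tau>\<close> and products of two of these entries suffice. If
  \<open>\<bar>s\<bar>\<close> is larger, \<open>(s / X)\<^sup>2\<close> exceeds the power 3/2 of
  \<open>\<bar>s\<bar>\<close>, which dominates \<open>r * ln r\<close>.\<close>

lemma sq_norm_lower_neg:
  assumes c: "c \<noteq> 0" and t: "t \<le> 0"
  shows "sqrt (sq_norm c t s) * ln (sqrt (sq_norm c t s))
    \<le> ((4 + \<bar>c\<bar>) * (ln (4 + \<bar>c\<bar>) + 4 / \<bar>c\<bar>) + 2 * (4 + \<bar>c\<bar>)\<^sup>2) * sq_norm_rho c t s"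
proof -
  define r where "r = sqrt (sq_norm c t s)"
  define G where "G = sq_norm_rho c t s"
  define \<tau> where "\<tau> = - t"
  define X where "X = exp \<tau>"
  define B where "B = 4 + \<bar>c\<bar>"
  note b = sqrt_sq_norm_bounds[where c = c and t = t and s = s, folded r_def]
  have \<tau>: "\<tau> \<ge> 0" "\<bar>t\<bar> = \<tau>" using t by (auto simp: \<tau>_def)
  have X1: "X \<ge> 1" and et: "exp t = 1 / X" and e2: "exp (- 2 * t) = X\<^sup>2"
    using \<tau> by (auto simp: X_def \<tau>_def exp_minus field_simps power2_eq_square simp flip: exp_add)
  have G: "G = (1 / X)^4 + 2 * X\<^sup>2 + (c * \<tau> * X)\<^sup>2 + (s / X)\<^sup>2"
  proof -
    have "exp (2 * t) = (1 / X)\<^sup>2" using et by (simp add: exp_double)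
    then show ?thesis
      using et by (simp add: G_def sq_norm_rho_def X_def \<tau>_def)
  qed
  \<comment> \<open>Applied to pairs of entries of \<open>rho h\<close>: their products cancel the
    factor \<open>X\<close>, leaving \<open>\<bar>s\<bar>\<close>,
    \<open>\<bar>c\<bar> * \<tau> * \<bar>s\<bar>\<close> and
    \<open>\<bar>c\<bar> * \<tau> * X\<^sup>2\<close> below \<open>G\<close>.\<close>
  have ab: "2 * (x * y) \<le> x\<^sup>2 + y\<^sup>2" for x y :: real
    using zero_le_power2[of "x - y"] by (simp add: power2_eq_square algebra_simps)
  have 4: "(1 / X)^4 \<ge> 0" by simp
  have g1: "X\<^sup>2 \<le> G" using G 4 zero_le_power2[of X] zero_le_power2[of "c * \<tau> * X"] zero_le_power2[of "s / X"] by linarith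
  have g0: "1 \<le> G" using g1 X1 by (meson one_le_power order_trans)
  have g2: "\<bar>s\<bar> \<le> G"
  proof -
    have "\<bar>s\<bar> = X * (\<bar>s\<bar> / X)" using X1 by simp
    moreover have "(\<bar>s\<bar> / X)\<^sup>2 = (s / X)\<^sup>2" by (simp add: power_divide)
    ultimately show ?thesis
      using ab[of X "\<bar>s\<bar> / X"] G 4 zero_le_power2[of "c * \<tau> * X"] zero_le_power2[of X] by linarith
  qed
  have g3: "\<bar>c\<bar> * \<tau> * \<bar>s\<bar> \<le> G"
  proof -
    have "(\<bar>c\<bar> * \<tau> * X) * (\<bar>s\<bar> / X) = \<bar>c\<bar> * \<tau> * \<bar>s\<bar>" using X1 by simp
    moreover have "(\<bar>s\<bar> / X)\<^sup>2 = (s / X)\<^sup>2" "(\<bar>c\<bar> * \<tau> * X)\<^sup>2 = (c * \<tau> * X)\<^sup>2"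
      by (simp_all add: power_divide power_mult_distrib)
    moreover have "\<bar>c\<bar> * \<tau> * \<bar>s\<bar> \<ge> 0" using \<tau> by simp
    ultimately show ?thesis
      using ab[of "\<bar>c\<bar> * \<tau> * X" "\<bar>s\<bar> / X"] G 4 zero_le_power2[of X] by linarith
  qed
  have g4: "\<bar>c\<bar> * \<tau> * X\<^sup>2 \<le> G"
  proof -
    have "(\<bar>c\<bar> * \<tau> * X) * X = \<bar>c\<bar> * \<tau> * X\<^sup>2" by (simp add: power2_eq_square)
    moreover have "(\<bar>c\<bar> * \<tau> * X)\<^sup>2 = (c * \<tau> * X)\<^sup>2" by (simp add: power_mult_distrib)
    moreover have "\<bar>c\<bar> * \<tau> * X\<^sup>2 \<ge> 0" using \<tau> by simp
    ultimately show ?thesis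
      using ab[of "\<bar>c\<bar> * \<tau> * X" X] G 4 zero_le_power2[of X] zero_le_power2[of "s / X"] by linarith
  qed
  have g5: "\<bar>c\<bar> * \<tau> \<le> G"
  proof -
    have "\<bar>c\<bar> * \<tau> * 1 \<le> \<bar>c\<bar> * \<tau> * X\<^sup>2" using \<tau> X1 by (intro mult_left_mono) (auto simp: one_le_power)
    then show ?thesis using g4 by simp
  qed
  have rB: "r \<le> (B - 2) + X\<^sup>2 + \<bar>s\<bar>"
  proof -
    have "\<tau> \<le> X" using abs_le_exp_abs[of \<tau>] \<tau> by (simp add: X_def)
    then have "\<bar>t\<bar> * exp t \<le> 1" using X1 by (simp add: et \<tau>(2) field_simps)
    then have "\<bar>c\<bar> * (\<bar>t\<bar> * exp t) \<le> \<bar>c\<bar> * 1" by (intro mult_left_mono) auto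
    moreover have "exp t \<le> 1" using t by simp
    ultimately show ?thesis using b(6) unfolding e2 B_def mult.assoc by linarith
  qed
  have B4: "B \<ge> 4" by (simp add: B_def)
  have r0: "r > 0" and l0: "ln r \<ge> 0" using b(5) by auto
  have K1: "B * (ln B + 4 / \<bar>c\<bar>) * G \<ge> 0" and K2: "2 * B\<^sup>2 * G \<ge> 0"
    using B4 g0 by (auto intro!: mult_nonneg_nonneg add_nonneg_nonneg ln_ge_zero)
  have "r * ln r \<le> B * (ln B + 4 / \<bar>c\<bar>) * G + 2 * B\<^sup>2 * G"
  proof (cases "\<bar>s\<bar> \<le> X^4")
    case True
    have "X\<^sup>2 \<le> X^4" "1 \<le> X^4" using X1 by (auto intro: power_increasing simp: one_le_power)
    moreover from this have "(B - 2) * 1 \<le> (B - 2) * X^4" using B4 by (intro mult_left_mono) auto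
    ultimately have "r \<le> B * X^4" using rB True by (simp add: algebra_simps)
    then have "ln r \<le> ln (B * X^4)" using r0 B4 X1 by (subst ln_le_cancel_iff) auto
    also have "\<dots> = ln B + 4 * \<tau>" using B4 X1 by (simp add: ln_mult ln_realpow) (simp add: X_def)
    finally have lr: "ln r \<le> ln B + 4 * \<tau>" .
    have lB: "ln B \<ge> 0" using B4 by simp
    have BG: "B - 2 \<le> (B - 2) * G" using mult_left_mono[OF g0, of "B - 2"] B4 by simp
    have "r * ln r \<le> ((B - 2) + X\<^sup>2 + \<bar>s\<bar>) * (ln B + 4 * \<tau>)"
      using rB lr r0 l0 by (intro mult_mono) auto
    also have "\<dots> = ((B - 2) + X\<^sup>2 + \<bar>s\<bar>) * ln B + 4 / \<bar>c\<bar> * (((B - 2) + X\<^sup>2 + \<bar>s\<bar>) * (\<bar>c\<bar> * \<tau>))"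
      using c by (simp add: field_simps)
    also have "\<dots> \<le> (B * G) * ln B + 4 / \<bar>c\<bar> * (B * G)"
    proof (intro add_mono mult_right_mono mult_left_mono lB)
      show "(B - 2) + X\<^sup>2 + \<bar>s\<bar> \<le> B * G" using BG g1 g2 by (simp add: algebra_simps)
      have "(B - 2) * (\<bar>c\<bar> * \<tau>) \<le> (B - 2) * G" using g5 B4 by (intro mult_left_mono) auto
      then show "((B - 2) + X\<^sup>2 + \<bar>s\<bar>) * (\<bar>c\<bar> * \<tau>) \<le> B * G"
        using g3 g4 by (simp add: algebra_simps)
    qed simp
    also have "\<dots> = B * (ln B + 4 / \<bar>c\<bar>) * G" by (simp add: algebra_simps)
    finally show ?thesis using K2 by linarith
  next
    case False
    define \<sigma> where "\<sigma> = sqrt \<bar>s\<bar>"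
    have \<sigma>2: "\<bar>s\<bar> = \<sigma>\<^sup>2" and \<sigma>0: "\<sigma> \<ge> 0" by (auto simp: \<sigma>_def)
    have X\<sigma>: "X\<^sup>2 \<le> \<sigma>"
      using False unfolding \<sigma>2 by (intro power2_le_imp_le[OF _ \<sigma>0]) simp
    have "X\<^sup>2 \<le> X^4" by (rule power_increasing) (use X1 in auto)
    then have s1: "1 \<le> \<bar>s\<bar>" "X\<^sup>2 \<le> \<bar>s\<bar>"
      using False one_le_power[OF X1, of 4] by linarith+
    from this(1) have "(B - 2) * 1 \<le> (B - 2) * \<bar>s\<bar>" using B4 by (intro mult_left_mono) auto
    then have rs: "r \<le> B * \<sigma>\<^sup>2" using rB s1(2) unfolding \<sigma>2[symmetric] by (simp add: algebra_simps)
    have "sqrt r \<le> B * \<sigma>"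
    proof (rule real_le_lsqrt)
      have "B * \<sigma>\<^sup>2 \<le> B * (B * \<sigma>\<^sup>2)" using B4 by (intro mult_left_mono mult_le_cancel_right1[THEN iffD2]) auto
      then show "r \<le> (B * \<sigma>)\<^sup>2" using rs by (simp add: power2_eq_square mult_ac)
    qed (use B4 \<sigma>0 in auto)
    then have "ln r \<le> 2 * (B * \<sigma>)" using ln_le_sqrt[OF r0] by linarith
    then have "r * ln r \<le> (B * \<sigma>\<^sup>2) * (2 * (B * \<sigma>))"
      using rs r0 l0 B4 by (intro mult_mono) auto
    also have "\<dots> = 2 * B\<^sup>2 * \<sigma>^3" by (simp add: power2_eq_square power3_eq_cube)
    also have "\<dots> \<le> 2 * B\<^sup>2 * G"
    proof (intro mult_left_mono)
      have "\<sigma>^3 * X\<^sup>2 \<le> \<sigma>^3 * \<sigma>" using X\<sigma> \<sigma>0 by (intro mult_left_mono) auto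
      also have "\<dots> = s\<^sup>2" using \<sigma>2 by (metis power2_abs power2_eq_square power3_eq_cube mult.assoc)
      finally have "\<sigma>^3 \<le> (s / X)\<^sup>2" using X1 by (simp add: power_divide field_simps)
      then show "\<sigma>^3 \<le> G"
        using G 4 zero_le_power2[of "c * \<tau> * X"] zero_le_power2[of X] by linarith
    qed simp
    finally show ?thesis using K1 by linarith
  qed
  also have "\<dots> = (B * (ln B + 4 / \<bar>c\<bar>) + 2 * B\<^sup>2) * G" by (simp add: algebra_simps)
  finally show ?thesis by (simp only: r_def B_def G_def)
qed

lemma subgroup_in_band:
  assumes c: "c \<noteq> 0"
  obtains K where "K \<ge> 1" "\<And>t s. in_band K (sqrt (sq_norm c t s)) (sqrt (sq_norm_rho c t s))"
proof -
  define K1 where "K1 = 2 * (3 + 2 / \<bar>c\<bar>) + 2 + \<bar>c\<bar>"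
  define K2 where "K2 = (4 + \<bar>c\<bar>)\<^sup>2"
  define K3 where "K3 = (4 + \<bar>c\<bar>) * (ln (4 + \<bar>c\<bar>) + 4 / \<bar>c\<bar>) + 2 * (4 + \<bar>c\<bar>)\<^sup>2"
  define K where "K = max K1 (max K2 K3)"
  have "K1 \<ge> 1" unfolding K1_def by (simp add: add_nonneg_nonneg)
  then have "K \<ge> 1" by (simp add: K_def)
  moreover have "in_band K (sqrt (sq_norm c t s)) (sqrt (sq_norm_rho c t s))" for t s
  proof -
    have G0: "sq_norm_rho c t s \<ge> 0" by (simp add: sq_norm_rho_def)
    have "sqrt (sq_norm c t s) * ln (sqrt (sq_norm c t s)) \<le> K * sq_norm_rho c t s"
    proof (cases "t \<ge> 0")
      case True
      have "K2 * sq_norm_rho c t s \<le> K * sq_norm_rho c t s" by (intro mult_right_mono G0) (simp add: K_def)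
      then show ?thesis using sq_norm_lower_nonneg[OF True, of c s] unfolding K2_def by linarith
    next
      case False
      have "K3 * sq_norm_rho c t s \<le> K * sq_norm_rho c t s" by (intro mult_right_mono G0) (simp add: K_def)
      then show ?thesis using sq_norm_lower_neg[OF c, of t s] False unfolding K3_def by linarith
    qed
    moreover have "K1 * (sqrt (sq_norm c t s))\<^sup>2 \<le> K * (sqrt (sq_norm c t s))\<^sup>2"
      by (intro mult_right_mono) (auto simp: K_def)
    ultimately show ?thesis
      using sq_norm_upper[OF c, of t s] G0 unfolding in_band_def K1_def by simp
  qed
  ultimately show ?thesis using that by blast
qed

text \<open>The choice \<open>s = r\<close>, \<open>exp t = p / r\<close> makes the entries
  \<open>s\<close> and \<open>s * exp t\<close> equal to \<open>r\<close> and \<open>p\<close>,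
  which gives the lower bounds. The remaining entries are at most constant multiples of
  \<open>r\<close> or \<open>p\<close>, and the factor before \<open>r\<^sup>2\<close> and
  \<open>p\<^sup>2\<close> adds their squared constants, rounded up to serve both norms.\<close>

lemma band_in_subgroup:
  assumes K: "K \<ge> 1" and r: "r > 0" "ln r \<ge> K" and p: "p \<ge> 1" and band: "in_band K r p"
  obtains t s where "r\<^sup>2 \<le> sq_norm c t s" "sq_norm c t s \<le> (3 + c\<^sup>2 * K\<^sup>2 + 2 * K\<^sup>2) * r\<^sup>2"
    "p\<^sup>2 \<le> sq_norm_rho c t s" "sq_norm_rho c t s \<le> (3 + c\<^sup>2 * K\<^sup>2 + 2 * K\<^sup>2) * p\<^sup>2"
proof -
  have r1: "r \<ge> 1" using r K ln_ge_zero_iff[of r] by linarith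
  have l1: "ln r \<ge> 1" using r K by linarith
  define E where "E = p / r"
  define t where "t = ln E"
  have E0: "E > 0" using r p by (simp add: E_def)
  have et: "exp t = E" "exp (- t) = 1 / E" "exp (2 * t) = E\<^sup>2" "exp (- 2 * t) = (1 / E)\<^sup>2"
    using E0 by (simp_all add: t_def exp_minus exp_double inverse_eq_divide)
      (metis power_one_over)
  \<comment> \<open>This is where \<open>K \<le> ln r\<close> enters: it cancels the constant of the
    band. The clean bound gives \<open>E \<le> r\<close> and
    \<open>E\<^sup>2 \<le> p\<close>.\<close>
  have pr: "p \<le> r\<^sup>2"
  proof -
    have "p * K \<le> p * ln r" using r p by (intro mult_left_mono) auto
    also have "\<dots> \<le> K * r\<^sup>2" using band by (simp add: in_band_def)
    finally show ?thesis using K by simp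
  qed
  have rp: "r \<le> K * p\<^sup>2"
  proof -
    have "r * 1 \<le> r * ln r" using r l1 by (intro mult_left_mono) auto
    also have "\<dots> \<le> K * p\<^sup>2" using band by (simp add: in_band_def)
    finally show ?thesis by simp
  qed
  have tl: "\<bar>t\<bar> \<le> ln r"
  proof -
    have "E \<le> r" "1 / r \<le> E" using pr r p by (auto simp: E_def field_simps power2_eq_square)
    then have "ln E \<le> ln r" "ln (1 / r) \<le> ln E" using E0 r by auto
    then show ?thesis using r by (auto simp: t_def ln_div)
  qed
  have Er: "E \<le> r" using pr r by (simp add: E_def field_simps power2_eq_square)
  have Ep: "E\<^sup>2 \<le> p"
  proof -
    have "p * p \<le> p * r\<^sup>2" using pr p by (intro mult_left_mono) auto
    then show ?thesis using r by (simp add: E_def power_divide divide_simps power2_eq_square)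
  qed
  have tE: "\<bar>t\<bar> * E \<le> K * r"
  proof -
    have "\<bar>t\<bar> * E \<le> ln r * E" using tl E0 by (intro mult_right_mono) auto
    also have "\<dots> = p * ln r / r" by (simp add: E_def)
    also have "\<dots> \<le> K * r\<^sup>2 / r" using band r by (intro divide_right_mono) (auto simp: in_band_def)
    finally show ?thesis using r by (simp add: power2_eq_square)
  qed
  have iE: "1 / E \<le> K * p" using rp p by (simp add: E_def field_simps power2_eq_square)
  have iE2: "(1 / E)\<^sup>2 \<le> K * r"
  proof -
    have "r * r \<le> r * (K * p\<^sup>2)" using rp r by (intro mult_left_mono) auto
    then show ?thesis using p by (simp add: E_def power_divide divide_simps power2_eq_square mult_ac)
  qed
  have tiE: "\<bar>t\<bar> * (1 / E) \<le> K * p"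
  proof -
    have "\<bar>t\<bar> * (1 / E) \<le> ln r * (1 / E)" using tl E0 by (intro mult_right_mono) auto
    also have "\<dots> = r * ln r / p" by (simp add: E_def)
    also have "\<dots> \<le> K * p\<^sup>2 / p" using band p by (intro divide_right_mono) (auto simp: in_band_def)
    finally show ?thesis using p by (simp add: power2_eq_square)
  qed
  have iE0: "1 / E > 0" using E0 by simp
  have sq: "x\<^sup>2 \<le> M\<^sup>2 * y\<^sup>2" if "0 \<le> x" "x \<le> M * y" for x y M :: real
    using power_mono[OF that(2,1), of 2] by (simp add: power_mult_distrib)
  have ct: "(c * t * x)\<^sup>2 \<le> c\<^sup>2 * K\<^sup>2 * y\<^sup>2" if "\<bar>t\<bar> * x \<le> K * y" "x > 0" for x y
  proof -
    have "(c * t * x)\<^sup>2 = c\<^sup>2 * (\<bar>t\<bar> * x)\<^sup>2" by (simp add: power_mult_distrib)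
    also have "\<dots> \<le> c\<^sup>2 * (K\<^sup>2 * y\<^sup>2)" using that by (intro mult_left_mono sq) auto
    finally show ?thesis by simp
  qed
  have n: "sq_norm c t r = 2 * E\<^sup>2 + (c * t * E)\<^sup>2 + ((1 / E)\<^sup>2)\<^sup>2 + r\<^sup>2"
    unfolding sq_norm_def et ..
  have m: "sq_norm_rho c t r = (E\<^sup>2)\<^sup>2 + 2 * (1 / E)\<^sup>2 + (c * t * (1 / E))\<^sup>2 + p\<^sup>2"
    unfolding sq_norm_rho_def et using r by (simp add: E_def)
  show ?thesis
  proof (rule that)
    show "r\<^sup>2 \<le> sq_norm c t r" "p\<^sup>2 \<le> sq_norm_rho c t r" unfolding n m by simp_all
    have "E\<^sup>2 \<le> r\<^sup>2" using Er E0 by (intro power_mono) auto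
    moreover have "((1 / E)\<^sup>2)\<^sup>2 \<le> K\<^sup>2 * r\<^sup>2" using iE2 by (intro sq) auto
    moreover have "K\<^sup>2 * r\<^sup>2 \<ge> 0" by simp
    ultimately show "sq_norm c t r \<le> (3 + c\<^sup>2 * K\<^sup>2 + 2 * K\<^sup>2) * r\<^sup>2"
      unfolding n distrib_right using ct[OF tE E0] by linarith
    have "(E\<^sup>2)\<^sup>2 \<le> p\<^sup>2" using Ep by (intro power_mono) auto
    moreover have "(1 / E)\<^sup>2 \<le> K\<^sup>2 * p\<^sup>2" using iE E0 by (intro sq) auto
    ultimately show "sq_norm_rho c t r \<le> (3 + c\<^sup>2 * K\<^sup>2 + 2 * K\<^sup>2) * p\<^sup>2"
      unfolding m distrib_right using ct[OF tiE iE0] zero_le_power2[of p] by linarith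
  qed
qed

section \<open>Change of norms and the band for the Cartan projection\<close>

lemma within_factor_mono: "within_factor L x y \<Longrightarrow> L \<le> L' \<Longrightarrow> x \<ge> 0 \<Longrightarrow> y \<ge> 0 \<Longrightarrow> within_factor L' x y"
  unfolding within_factor_def by (meson mult_right_mono order_trans)

lemma within_factor_bounded:
  assumes "1 \<le> x" "x \<le> L" "1 \<le> y" "y \<le> L"
  shows "within_factor L x y"
proof -
  have "L * 1 \<le> L * x" "L * 1 \<le> L * y" using assms by (auto intro!: mult_left_mono)
  then show ?thesis using assms unfolding within_factor_def by (intro conjI) linarith+
qed

lemma within_factor_squares:
  assumes "x \<ge> 0" "y > 0" "L \<ge> 1" "y\<^sup>2 \<le> x\<^sup>2" "x\<^sup>2 \<le> L * y\<^sup>2"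
  shows "within_factor L x y"
proof -
  have "y \<le> x" by (rule power2_le_imp_le[OF assms(4,1)])
  moreover have "1 * x \<le> L * x" using assms by (intro mult_right_mono) auto
  moreover have "L * y\<^sup>2 \<le> (L * y)\<^sup>2"
    using assms by (simp add: power_mult_distrib power2_eq_square)
  then have "x\<^sup>2 \<le> (L * y)\<^sup>2" using assms(5) by linarith
  then have "x \<le> L * y" by (rule power2_le_imp_le) (use assms in simp)
  ultimately show ?thesis by (simp add: within_factor_def)
qed

text \<open>Changing norms costs \<open>\<kappa>\<close> for the linear factor,
  \<open>\<kappa>\<^sup>2\<close> for the square, and 2 for the logarithm: since
  \<open>x \<ge> \<kappa>\<close>,
  \<open>ln y \<le> ln \<kappa> + ln x \<le> 2 * ln x\<close>.\<close>

lemma in_band_within_factor: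
  assumes \<kappa>: "\<kappa> \<ge> 1" and K: "K \<ge> 1"
    and x: "x \<ge> \<kappa>" "y \<ge> 1" and uv: "u \<ge> 0" "v \<ge> 0"
    and xy: "within_factor \<kappa> x y" and uv': "within_factor \<kappa> u v" and band: "in_band K x u"
  shows "in_band (2 * \<kappa>^3 * K) y v"
proof -
  have x1: "x \<ge> 1" using x \<kappa> by simp
  have lx: "ln x \<ge> 0" and ly: "ln y \<ge> 0" using x1 x by auto
  have "ln y \<le> ln (\<kappa> * x)" using xy x x1 \<kappa> by (subst ln_le_cancel_iff) (auto simp: within_factor_def)
  also have "\<dots> = ln \<kappa> + ln x" using \<kappa> x1 by (simp add: ln_mult)
  also have "ln \<kappa> \<le> ln x" using x \<kappa> x1 by (subst ln_le_cancel_iff) auto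
  finally have l: "ln y \<le> 2 * ln x" by simp
  have sq: "a\<^sup>2 \<le> \<kappa>\<^sup>2 * b\<^sup>2" if "a \<ge> 0" "a \<le> \<kappa> * b" for a b
    using power_mono[OF that(2,1), of 2] by (simp add: power_mult_distrib)
  have "y * ln y \<le> (\<kappa> * x) * (2 * ln x)"
    using xy l ly x x1 \<kappa> by (intro mult_mono) (auto simp: within_factor_def)
  also have "\<dots> = 2 * \<kappa> * (x * ln x)" by simp
  also have "\<dots> \<le> 2 * \<kappa> * (K * u\<^sup>2)"
    using band \<kappa> by (intro mult_left_mono) (auto simp: in_band_def)
  also have "\<dots> \<le> 2 * \<kappa> * (K * (\<kappa>\<^sup>2 * v\<^sup>2))"
    using \<kappa> K uv uv' by (intro mult_left_mono sq) (auto simp: within_factor_def)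
  finally have 1: "y * ln y \<le> 2 * \<kappa>^3 * K * v\<^sup>2" by (simp add: power2_eq_square power3_eq_cube mult_ac)
  have "v * ln y \<le> (\<kappa> * u) * (2 * ln x)"
    using uv' l ly uv \<kappa> by (intro mult_mono) (auto simp: within_factor_def)
  also have "\<dots> = 2 * \<kappa> * (u * ln x)" by simp
  also have "\<dots> \<le> 2 * \<kappa> * (K * x\<^sup>2)"
    using band \<kappa> by (intro mult_left_mono) (auto simp: in_band_def)
  also have "\<dots> \<le> 2 * \<kappa> * (K * (\<kappa>\<^sup>2 * y\<^sup>2))"
    using \<kappa> K x1 xy by (intro mult_left_mono sq) (auto simp: within_factor_def)
  finally have 2: "v * ln y \<le> 2 * \<kappa>^3 * K * y\<^sup>2" by (simp add: power2_eq_square power3_eq_cube mult_ac)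
  show ?thesis using 1 2 by (simp add: in_band_def)
qed

lemma in_band_imp_limits:
  assumes "in_band C q w" "C \<ge> 1" "q > 1" "w \<ge> 0"
  shows "inverse C * (q * ln q) powr (1/2) \<le> w" "w \<le> C * (q\<^sup>2 / ln q)"
proof -
  have l: "ln q > 0" using assms by simp
  have "q * ln q \<le> C * w\<^sup>2" using assms by (simp add: in_band_def)
  also have "\<dots> \<le> C * (C * w\<^sup>2)"
  proof (rule mult_left_mono)
    show "w\<^sup>2 \<le> C * w\<^sup>2" using mult_right_mono[of 1 C "w\<^sup>2"] assms by simp
  qed (use assms in simp)
  also have "\<dots> = (C * w)\<^sup>2" by (simp add: power2_eq_square)
  finally have "sqrt (q * ln q) \<le> C * w" using assms by (intro real_le_lsqrt) auto
  then show "inverse C * (q * ln q) powr (1/2) \<le> w"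
    using assms l by (simp add: powr_half_sqrt field_simps)
  show "w \<le> C * (q\<^sup>2 / ln q)"
    using assms l by (simp add: in_band_def field_simps)
qed

text \<open>Squaring the square root bound turns \<open>C\<close> into \<open>C\<^sup>2\<close>, so
  this is a converse of \<open>in_band_imp_limits\<close> only up to the constant.\<close>

lemma limits_imp_in_band:
  assumes "inverse C * (q * ln q) powr (1/2) \<le> w" "w \<le> C * (q\<^sup>2 / ln q)" "C \<ge> 1" "q > 1" "w \<ge> 0"
  shows "in_band (C\<^sup>2) q w"
proof -
  have l: "ln q > 0" using assms by simp
  have "sqrt (q * ln q) \<le> C * w"
    using assms l by (simp add: powr_half_sqrt field_simps)
  then have "(sqrt (q * ln q))\<^sup>2 \<le> (C * w)\<^sup>2" by (intro power_mono) (use assms l in auto)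
  then have 1: "q * ln q \<le> C\<^sup>2 * w\<^sup>2" using assms l by (simp add: power_mult_distrib)
  have "w * ln q \<le> C * q\<^sup>2" using assms l by (simp add: field_simps)
  also have "\<dots> \<le> C\<^sup>2 * q\<^sup>2" using assms by (intro mult_right_mono) (auto simp: power2_eq_square)
  finally show ?thesis using 1 by (simp add: in_band_def)
qed

lemma A_plus_norm_ge_1:
  assumes "a \<in> A_plus"
  shows "1 \<le> norm a" "1 \<le> norm (rho a)" "norm (rho a) \<le> 3 * (norm a)\<^sup>2"
proof -
  have a: "a$1$1 \<ge> a$2$2" "a$2$2 \<ge> a$3$3" "a$3$3 > 0" and p: "a$1$1 * a$2$2 * a$3$3 = 1"
    using assms A_grp_det by (auto simp: A_plus_def A_grp_def)
  have 1: "1 \<le> a$1$1"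
  proof (rule ccontr)
    assume "\<not> 1 \<le> a$1$1"
    then have "a$1$1 * a$2$2 < 1" "a$3$3 < 1"
      using a mult_strict_mono[of "a$1$1" 1 "a$2$2" 1] by auto
    then have "a$1$1 * a$2$2 * a$3$3 < 1" using a mult_strict_mono[of "a$1$1 * a$2$2" 1 "a$3$3" 1] by auto
    with p show False by simp
  qed
  have 3: "a$3$3 \<le> 1"
  proof (rule ccontr)
    assume "\<not> a$3$3 \<le> 1"
    then have "1 < a$1$1 * a$2$2" "1 < a$3$3"
      using a mult_strict_mono[of 1 "a$1$1" 1 "a$2$2"] by auto
    then have "1 < a$1$1 * a$2$2 * a$3$3" using a mult_strict_mono[of 1 "a$1$1 * a$2$2" 1 "a$3$3"] by auto
    with p show False by simp
  qed
  have 2: "1 \<le> a$1$1 * a$2$2"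
  proof -
    have "a$1$1 * a$2$2 * a$3$3 \<le> a$1$1 * a$2$2 * 1" using a 3 by (intro mult_left_mono) auto
    then show ?thesis using p by simp
  qed
  note n = A_plus_norm_bounds[OF assms]
  show "1 \<le> norm a" "1 \<le> norm (rho a)" using 1 2 n by linarith+
  have "a$1$1 * a$2$2 \<le> norm a * norm a" using n a by (intro mult_mono) auto
  then show "norm (rho a) \<le> 3 * (norm a)\<^sup>2" using n by (simp add: power2_eq_square)
qed

text \<open>\<open>coarse_eqI\<close> reduces the claim to pairs of norms. Far out,
  \<open>subgroup_in_band\<close> and \<open>band_in_subgroup\<close> supply the partners; elements
  of bounded norm are all compared with one point \<open>x0\<close> common to both sets. The factor
  \<open>L\<close> may depend on \<open>R\<close> and \<open>C\<close>, since the compact set is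
  chosen after them.\<close>

lemma cartan_proj_band_criterion:
  assumes \<nu>: "is_norm \<nu>" "is_norm \<nu>'" and c: "c \<noteq> 0"
    and det: "\<And>h. h \<in> H \<Longrightarrow> det h = 1"
    and H1: "\<And>h. h \<in> H \<Longrightarrow> \<exists>t s. (norm h)\<^sup>2 = sq_norm c t s \<and> (norm (rho h))\<^sup>2 = sq_norm_rho c t s"
    and H2: "\<And>t s. \<exists>h\<in>H. (norm h)\<^sup>2 = sq_norm c t s \<and> (norm (rho h))\<^sup>2 = sq_norm_rho c t s"
  shows "cartan_proj_band \<nu> \<nu>' H (\<lambda>r. (r * ln r) powr (1/2)) (\<lambda>r. r\<^sup>2 / ln r)"
proof -
  obtain \<kappa>1 where \<kappa>1: "\<kappa>1 \<ge> 1" "\<And>x. \<nu> x \<le> \<kappa>1 * norm x" "\<And>x. norm x \<le> \<kappa>1 * \<nu> x"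
    using is_norm_equivalent[OF \<nu>(1)] by blast
  obtain \<kappa>2 where \<kappa>2: "\<kappa>2 \<ge> 1" "\<And>x. \<nu>' x \<le> \<kappa>2 * norm x" "\<And>x. norm x \<le> \<kappa>2 * \<nu>' x"
    using is_norm_equivalent[OF \<nu>(2)] by blast
  define \<kappa> where "\<kappa> = max \<kappa>1 \<kappa>2"
  have \<kappa>: "\<kappa> \<ge> 1" using \<kappa>1(1) by (simp add: \<kappa>_def)
  have nn: "\<nu> x \<ge> 0" "\<nu>' x \<ge> 0" for x by (intro is_norm_nonneg \<nu>)+
  have w1: "within_factor \<kappa> (\<nu> x) (norm x)" "within_factor \<kappa> (norm x) (\<nu> x)" for x
    using within_factor_mono[of \<kappa>1 "\<nu> x" "norm x" \<kappa>] \<kappa>1 nn by (auto simp: within_factor_def \<kappa>_def)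
  have w2: "within_factor \<kappa> (\<nu>' x) (norm x)" "within_factor \<kappa> (norm x) (\<nu>' x)" for x
    using within_factor_mono[of \<kappa>2 "\<nu>' x" "norm x" \<kappa>] \<kappa>2 nn by (auto simp: within_factor_def \<kappa>_def)
  obtain K where K: "K \<ge> 1" "\<And>t s. in_band K (sqrt (sq_norm c t s)) (sqrt (sq_norm_rho c t s))"
    using subgroup_in_band[OF c] by blast
  let ?\<mu> = "cartan_proj"
  have \<mu>: "?\<mu> h \<in> A_plus" "norm (?\<mu> h) = norm h" "norm (rho (?\<mu> h)) = norm (rho h)" if "h \<in> H" for h
    using cartan_proj[OF det[OF that]] by auto
  have bandH: "in_band K (norm h) (norm (rho h))" if h: "h \<in> H" for h
  proof -
    obtain t s where "(norm h)\<^sup>2 = sq_norm c t s" "(norm (rho h))\<^sup>2 = sq_norm_rho c t s"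
      using H1[OF h] by blast
    then have "norm h = sqrt (sq_norm c t s)" "norm (rho h) = sqrt (sq_norm_rho c t s)"
      by (metis norm_ge_zero real_sqrt_unique)+
    then show ?thesis using K(2) by simp
  qed
  \<comment> \<open>The cut-off makes \<open>\<nu> a \<ge> \<kappa>\<close> and
    \<open>norm a \<ge> \<kappa>\<close>, as required for changing norms inside the band.\<close>
  define R0 where "R0 = \<kappa>\<^sup>2 + 1"
  \<comment> \<open>The band constant of H after the change of norms; it does not involve
    \<open>R\<close>.\<close>
  define C0 where "C0 = 2 * \<kappa>^3 * K + 1"
  have C01: "C0 > 1" using \<kappa> K by (simp add: C0_def)
  have \<kappa>2': "\<kappa> \<le> \<kappa>\<^sup>2" using \<kappa> by (simp add: power2_eq_square)
  show ?thesis
    unfolding cartan_proj_band_def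
  proof (rule exI[of _ R0], rule exI[of _ C0], intro conjI C01 allI impI)
    fix R C assume R: "R \<ge> R0" and C: "C \<ge> C0"
    have C1: "C \<ge> 1" using C C01 by simp
    have R1: "R > 1" using R \<kappa> \<kappa>2' by (simp add: R0_def)
    define Y where "Y = {a \<in> A_plus. R \<le> \<nu> a \<and> inverse C * (\<nu> a * ln (\<nu> a)) powr (1/2) \<le> \<nu>' (rho a) \<and>
                 \<nu>' (rho a) \<le> C * ((\<nu> a)\<^sup>2 / ln (\<nu> a))}"
    have HY: "?\<mu> h \<in> Y" if h: "h \<in> H" "R \<le> \<nu> (?\<mu> h)" for h
    proof -
      let ?a = "?\<mu> h"
      have "\<kappa> \<le> norm ?a"
      proof -
        have "\<kappa> * \<kappa> \<le> \<kappa> * norm ?a"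
          using h(2) R w1(1)[of ?a] by (simp add: R0_def within_factor_def power2_eq_square)
        then show ?thesis using \<kappa> by simp
      qed
      then have "in_band (2 * \<kappa>^3 * K) (\<nu> ?a) (\<nu>' (rho ?a))"
        using h(2) R1 bandH[OF h(1)] \<mu>[OF h(1)]
        by (intro in_band_within_factor[OF \<kappa> K(1) _ _ norm_ge_zero nn(2) w1(2) w2(2)]) simp_all
      then have "in_band C (\<nu> ?a) (\<nu>' (rho ?a))"
        using C mult_right_mono[of "2 * \<kappa>^3 * K" C "(\<nu>' (rho ?a))\<^sup>2"] mult_right_mono[of "2 * \<kappa>^3 * K" C "(\<nu> ?a)\<^sup>2"]
        unfolding in_band_def C0_def by auto
      from in_band_imp_limits[OF this C1 _ nn(2)] show ?thesis
        using h(2) R1 \<mu>(1)[OF h(1)] by (simp add: Y_def)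
    qed
    \<comment> \<open>At \<open>t = 0\<close> the parameter \<open>s\<close> alone makes the norm
      large enough to pass the cut-off, so the projection of \<open>h0\<close> lies in both
      sets.\<close>
    obtain h0 where h0: "h0 \<in> H" "(norm h0)\<^sup>2 = sq_norm c 0 (\<kappa> * R)"
      using H2[of 0 "\<kappa> * R"] by blast
    define x0 where "x0 = ?\<mu> h0"
    have "\<kappa> * R \<le> norm h0"
      by (rule power2_le_imp_le) (auto simp: h0(2) sq_norm_def)
    then have "\<kappa> * R \<le> \<kappa> * \<nu> x0"
      using w1(1)[of x0] \<mu>[OF h0(1)] by (simp add: x0_def within_factor_def)
    then have "R \<le> \<nu> x0" using \<kappa> by simp
    then have x0: "x0 \<in> Y" "x0 \<in> ?\<mu> ` H" using HY h0(1) by (auto simp: x0_def)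
    then have x0A: "x0 \<in> A_plus" by (simp add: Y_def)
    define C' where "C' = 2 * \<kappa>^3 * C\<^sup>2"
    have C'1: "C' \<ge> 1"
    proof -
      have "1 * 1 \<le> \<kappa>^3 * C\<^sup>2" using \<kappa> C1 by (intro mult_mono) (auto simp: one_le_power)
      then show ?thesis by (simp add: C'_def)
    qed
    \<comment> \<open>Beyond \<open>exp C'\<close> the logarithm is at least \<open>C'\<close>, as
      \<open>band_in_subgroup\<close> demands; \<open>\<kappa> * R\<close> covers the projections of
      elements of H below the cut-off.\<close>
    define R2 where "R2 = \<kappa> * R + exp C' + \<kappa>\<^sup>2"
    define L1 where "L1 = R2 + 3 * R2\<^sup>2 + norm x0 + norm (rho x0)"
    define L2 where "L2 = 3 + c\<^sup>2 * C'\<^sup>2 + 2 * C'\<^sup>2"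
    define L where "L = max 1 (max L1 L2)"
    have R20: "R2 \<ge> 0" using \<kappa> R1 by (simp add: R2_def)
    have near: "within_factor L (norm x) (norm x0) \<and> within_factor L (norm (rho x)) (norm (rho x0))"
      if x: "x \<in> A_plus" "norm x \<le> R2" for x
    proof -
      note a = A_plus_norm_ge_1[OF x(1)] and b = A_plus_norm_ge_1[OF x0A]
      have "(norm x)\<^sup>2 \<le> R2\<^sup>2" using x by (intro power_mono) auto
      then have "norm (rho x) \<le> 3 * R2\<^sup>2" using a by linarith
      moreover have "R2\<^sup>2 \<ge> 0" by simp
      ultimately have "norm x \<le> L1" "norm x0 \<le> L1" "norm (rho x) \<le> L1" "norm (rho x0) \<le> L1"
        using x a b R20 by (auto simp: L1_def)
      then show ?thesis
        using a b by (intro conjI within_factor_bounded) (auto simp: L_def)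
    qed
    have self: "within_factor L (norm x) (norm x)" for x :: mat3
      using mult_right_mono[of 1 L "norm x"] by (simp add: within_factor_def L_def)
    show "coarse_eq (?\<mu> ` H) {a \<in> A_plus. R \<le> \<nu> a \<and> inverse C * (\<nu> a * ln (\<nu> a)) powr (1/2) \<le> \<nu>' (rho a) \<and>
                 \<nu>' (rho a) \<le> C * ((\<nu> a)\<^sup>2 / ln (\<nu> a))}"
      unfolding Y_def[symmetric]
    proof (rule coarse_eqI[of _ _ L])
      show "?\<mu> ` H \<subseteq> A_plus" using \<mu>(1) by auto
      show "Y \<subseteq> A_plus" by (auto simp: Y_def)
      show "L \<ge> 1" by (simp add: L_def)
    next
      fix x assume "x \<in> ?\<mu> ` H"
      then obtain h where h: "h \<in> H" "x = ?\<mu> h" by blast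
      show "\<exists>y\<in>Y. within_factor L (norm x) (norm y) \<and> within_factor L (norm (rho x)) (norm (rho y))"
      proof (cases "R \<le> \<nu> x")
        case True
        then show ?thesis using HY h self by blast
      next
        case False
        have "norm x \<le> \<kappa> * \<nu> x" using w1(1)[of x] by (simp add: within_factor_def)
        also have "\<dots> \<le> \<kappa> * R" using False \<kappa> by (intro mult_left_mono) auto
        also have "\<dots> \<le> R2" by (simp add: R2_def add_nonneg_nonneg)
        finally show ?thesis using near[of x] \<mu>(1)[OF h(1)] h(2) x0(1) by blast
      qed
    next
      fix y assume y: "y \<in> Y"
      then have yA: "y \<in> A_plus" and yR: "R \<le> \<nu> y" by (auto simp: Y_def)
      show "\<exists>x\<in>?\<mu> ` H. within_factor L (norm x) (norm y) \<and> within_factor L (norm (rho x)) (norm (rho y))"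
      proof (cases "norm y \<le> R2")
        case True
        have sym: "within_factor L u v \<Longrightarrow> within_factor L v u" for u v by (auto simp: within_factor_def)
        show ?thesis using near[OF yA True] x0(2) sym by blast
      next
        case False
        note a = A_plus_norm_ge_1[OF yA]
        have "in_band (C\<^sup>2) (\<nu> y) (\<nu>' (rho y))"
          using y R1 yR nn by (intro limits_imp_in_band[OF _ _ C1]) (auto simp: Y_def)
        moreover have "\<kappa> \<le> \<nu> y" using yR R \<kappa>2' by (simp add: R0_def)
        ultimately have band: "in_band C' (norm y) (norm (rho y))"
          unfolding C'_def using C1 a
          by (intro in_band_within_factor[OF \<kappa> _ _ _ nn(2) norm_ge_zero w1(1) w2(1)])
            (auto simp: one_le_power)
        have "exp C' \<le> norm y" using False \<kappa> R1 by (simp add: R2_def) (smt (verit) mult_nonneg_nonneg zero_le_power2)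
        moreover have "norm y > 0" using a(1) by linarith
        ultimately have C'ln: "C' \<le> ln (norm y)" using ln_ge_iff by blast
        obtain t s where ts: "(norm y)\<^sup>2 \<le> sq_norm c t s" "sq_norm c t s \<le> L2 * (norm y)\<^sup>2"
          "(norm (rho y))\<^sup>2 \<le> sq_norm_rho c t s" "sq_norm_rho c t s \<le> L2 * (norm (rho y))\<^sup>2"
          using band_in_subgroup[OF C'1 \<open>norm y > 0\<close> C'ln a(2) band, of c] unfolding L2_def by blast
        obtain h where h: "h \<in> H" "(norm h)\<^sup>2 = sq_norm c t s" "(norm (rho h))\<^sup>2 = sq_norm_rho c t s"
          using H2 by blast
        have "L2 \<ge> 1" by (simp add: L2_def add_nonneg_nonneg)
        then have "within_factor L2 (norm h) (norm y)" "within_factor L2 (norm (rho h)) (norm (rho y))"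
          using a ts h by (auto intro!: within_factor_squares)
        moreover have "L2 \<le> L" by (simp add: L_def)
        ultimately have "within_factor L (norm h) (norm y)" "within_factor L (norm (rho h)) (norm (rho y))"
          using within_factor_mono norm_ge_zero by blast+
        then show ?thesis using \<mu>[OF h(1)] h(1) by (metis imageI)
      qed
    qed
  qed
qed

section \<open>Upper triangular matrices\<close>

definition ut :: "real \<Rightarrow> real \<Rightarrow> real \<Rightarrow> real \<Rightarrow> real \<Rightarrow> real \<Rightarrow> mat3" where
  "ut a b c d e f = vector [vector [a, b, c], vector [0, d, e], vector [0, 0, f]]"

lemma ut_nth [simp]:
  "ut a b c d e f $ 1 $ 1 = a" "ut a b c d e f $ 1 $ 2 = b" "ut a b c d e f $ 1 $ 3 = c"
  "ut a b c d e f $ 2 $ 1 = 0" "ut a b c d e f $ 2 $ 2 = d" "ut a b c d e f $ 2 $ 3 = e"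
  "ut a b c d e f $ 3 $ 1 = 0" "ut a b c d e f $ 3 $ 2 = 0" "ut a b c d e f $ 3 $ 3 = f"
  by (simp_all add: ut_def)

lemma ut_eq_iff [simp]:
  "ut a b c d e f = ut a' b' c' d' e' f' \<longleftrightarrow> a = a' \<and> b = b' \<and> c = c' \<and> d = d' \<and> e = e' \<and> f = f'"
  by (auto simp: vec_eq_iff forall_3)

lemma ut_mult [simp]:
  "ut a b c d e f ** ut a' b' c' d' e' f'
    = ut (a * a') (a * b' + b * d') (a * c' + b * e' + c * f') (d * d') (d * e' + e * f') (f * f')"
  by (simp add: vec_eq_iff forall_3 matrix_matrix_mult_def sum_3)

lemma ut_add: "ut a b c d e f + ut a' b' c' d' e' f' = ut (a + a') (b + b') (c + c') (d + d') (e + e') (f + f')"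
  and ut_diff: "ut a b c d e f - ut a' b' c' d' e' f' = ut (a - a') (b - b') (c - c') (d - d') (e - e') (f - f')"
  and ut_scaleR: "r *\<^sub>R ut a b c d e f = ut (r * a) (r * b) (r * c) (r * d) (r * e) (r * f)"
  and mat_1_ut: "mat 1 = ut 1 0 0 1 0 1"
  by (simp_all add: vec_eq_iff forall_3 mat_def)

lemma det_ut [simp]: "det (ut a b c d e f) = a * d * f"
  by (simp add: det_3)

lemma upper_tri_ut [simp]: "upper_tri (ut a b c d e f)"
  by (simp add: upper_tri_def)

lemma upper_tri_eq_ut: "upper_tri g \<Longrightarrow> g = ut (g$1$1) (g$1$2) (g$1$3) (g$2$2) (g$2$3) (g$3$3)"
  by (simp add: vec_eq_iff forall_3 upper_tri_def)

lemma norm_sq_ut: "(norm (ut a b c d e f))\<^sup>2 = a\<^sup>2 + b\<^sup>2 + c\<^sup>2 + d\<^sup>2 + e\<^sup>2 + f\<^sup>2"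
  by (simp add: norm_sq_matrix sum_3)

lemma norm_sq_rho_ut:
  "(norm (rho (ut a b c d e f)))\<^sup>2
    = (a * d)\<^sup>2 + (a * e)\<^sup>2 + (a * f)\<^sup>2 + (b * e - c * d)\<^sup>2 + (b * f)\<^sup>2 + (d * f)\<^sup>2"
  by (simp add: norm_sq_matrix sum_3 rho_def wedge_def transpose_def column_def mult.commute)

lemma closed_upper_tri: "closed {g. upper_tri g}"
  unfolding upper_tri_def by (intro closed_Collect_conj closed_Collect_eq continuous_intros)

lemma N_grp_iff: "g \<in> N_grp \<longleftrightarrow> g = ut 1 (g$1$2) (g$1$3) 1 (g$2$3) 1"
  by (auto simp: N_grp_def vec_eq_iff forall_3)

lemma ut_in_N_grp [simp]: "ut a b c d e f \<in> N_grp \<longleftrightarrow> a = 1 \<and> d = 1 \<and> f = 1"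
  by (auto simp: N_grp_def forall_3)

lemma closed_N_grp: "closed N_grp"
  unfolding N_grp_def
  by (intro closed_Collect_conj closed_Collect_all closed_Collect_eq continuous_intros)

lemma N_grp_subgroup: "subgroup N_grp SL3"
proof (rule subgroup_SL3I)
  fix x y assume x: "x \<in> N_grp" and y: "y \<in> N_grp"
  show "det x = 1" by (subst x[unfolded N_grp_iff]) simp
  show "x ** y \<in> N_grp"
    by (subst x[unfolded N_grp_iff], subst y[unfolded N_grp_iff]) simp
  have "x ** ut 1 (- x$1$2) (x$1$2 * x$2$3 - x$1$3) 1 (- x$2$3) 1 = mat 1"
    by (subst x[unfolded N_grp_iff]) (simp add: mat_1_ut)
  then show "\<exists>y\<in>N_grp. x ** y = mat 1"
    by (rule bexI[where x = "ut 1 (- x$1$2) (x$1$2 * x$2$3 - x$1$3) 1 (- x$2$3) 1"]) simp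
qed (simp add: mat_1_ut)

section \<open>One-parameter subgroups\<close>

text \<open>Any differentiable curve in K through 1 will do, so membership in the Lie algebra is
  shown without computing an exponential.\<close>

lemma lie_alg_curve:
  assumes "subgroup K SL3" "closed K" "\<And>t. g t \<in> K" "g 0 = mat 1"
    and "\<And>i j. ((\<lambda>t. g t $ i $ j) has_real_derivative X $ i $ j) (at 0)"
  shows "X \<in> lie_alg K"
  using filterlim_compose[OF tendsto_difference_quotient[OF assms(4,5)] filterlim_recip_Suc]
  by (rule lie_alg_tangent[OF assms(1,2) assms(3) recip_Suc])

text \<open>\<open>g (t / n)\<close> is 1 plus a term of size \<open>1 / n\<close>; its
  \<open>n\<close>-th power is exactly \<open>g t\<close> and, by \<open>mat_exp_limit\<close>,
  tends to the exponential.\<close>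

lemma mat_exp_one_parameter:
  assumes add: "\<And>s t. g (s + t) = g s ** g t" and g0: "g 0 = mat 1"
    and der: "\<And>i j. ((\<lambda>t. g t $ i $ j) has_real_derivative X $ i $ j) (at 0)"
  shows "mat_exp (t *\<^sub>R X) = g t"
proof (cases "t = 0")
  case False
  have "filterlim (\<lambda>n. t * (1 / real (Suc n))) (at 0) sequentially"
    using tendsto_mult_right_zero[OF recip_Suc(2), of t] False by (intro filterlim_atI) auto
  from filterlim_compose[OF tendsto_difference_quotient[OF g0 der] this]
  have "(\<lambda>n. t *\<^sub>R ((g (t * (1 / real (Suc n))) - mat 1) /\<^sub>R (t * (1 / real (Suc n))))) \<longlonglongrightarrow> t *\<^sub>R X"
    by (intro tendsto_scaleR tendsto_const)
  then have "(\<lambda>n. real (Suc n) *\<^sub>R (g (t * (1 / real (Suc n))) - mat 1)) \<longlonglongrightarrow> t *\<^sub>R X"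
    using False by simp
  from mat_exp_limit[OF filterlim_Suc this]
  have "(\<lambda>n. mat_pow (g (t * (1 / real (Suc n)))) (Suc n)) \<longlonglongrightarrow> mat_exp (t *\<^sub>R X)" by simp
  moreover have "mat_pow (g s) n = g (real n * s)" for s n
    by (induction n) (simp_all add: g0 distrib_right flip: add)
  then have "mat_pow (g (t * (1 / real (Suc n)))) (Suc n) = g t" for n by (simp del: of_nat_Suc mat_pow_Suc)
  ultimately show ?thesis by (simp add: LIMSEQ_const_iff del: mat_pow_Suc)
qed (simp add: g0)

lemma has_real_derivative_ut:
  assumes "(a has_real_derivative a') F" "(b has_real_derivative b') F" "(c has_real_derivative c') F"
    "(d has_real_derivative d') F" "(e has_real_derivative e') F" "(f has_real_derivative f') F"
  shows "((\<lambda>t. ut (a t) (b t) (c t) (d t) (e t) (f t) $ i $ j) has_real_derivative ut a' b' c' d' e' f' $ i $ j) F"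
  using exhaust_3[of i] exhaust_3[of j] assms by auto

lemma lie_alg_entry_0:
  assumes "X \<in> lie_alg H" "i \<noteq> j" "\<And>h. h \<in> H \<Longrightarrow> h $ i $ j = 0"
  shows "X $ i $ j = 0"
proof -
  have "(\<lambda>n. ((mat_exp ((1 / real (Suc n)) *\<^sub>R X) - mat 1) /\<^sub>R (1 / real (Suc n))) $ i $ j) \<longlonglongrightarrow> X $ i $ j"
    by (intro tendsto_vec_nth mat_exp_tangent)
  moreover have "((mat_exp ((1 / real (Suc n)) *\<^sub>R X) - mat 1) /\<^sub>R (1 / real (Suc n))) $ i $ j = 0" for n
    using assms(3)[OF lie_alg_mat_exp[OF assms(1)]] assms(2) by (simp add: mat_def)
  ultimately show ?thesis by (simp add: LIMSEQ_const_iff)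
qed

lemma lie_alg_upper_tri:
  assumes "X \<in> lie_alg H" "\<And>h. h \<in> H \<Longrightarrow> upper_tri h"
  shows "upper_tri X"
  using lie_alg_entry_0[OF assms(1), of 2 1] lie_alg_entry_0[OF assms(1), of 3 1]
    lie_alg_entry_0[OF assms(1), of 3 2] assms(2)
  by (auto simp: upper_tri_def)

lemma lie_alg_trace_0:
  assumes X: "X \<in> lie_alg H" and H: "\<And>h. h \<in> H \<Longrightarrow> upper_tri h" "\<And>h. h \<in> H \<Longrightarrow> det h = 1"
  shows "X$1$1 + X$2$2 + X$3$3 = 0"
proof -
  have h: "mat_exp X \<in> H" using lie_alg_mat_exp[OF X, of 1] by simp
  have "det (mat_exp X) = exp (X$1$1) * exp (X$2$2) * exp (X$3$3)"
    by (subst upper_tri_eq_ut[OF H(1)[OF h]])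
      (simp add: mat_exp_upper_tri_diag[OF lie_alg_upper_tri[OF X H(1)]])
  then show ?thesis using H(2)[OF h] by (simp flip: exp_add)
qed

section \<open>The subgroups of parts (1) and (2)\<close>

text \<open>The comparison is assumed on all of H, so the exceptional compact set is empty.\<close>

lemma rho_comparableI:
  assumes \<nu>: "is_norm \<nu>" "is_norm \<nu>'" and M: "M \<ge> 1"
    and H: "\<And>h. h \<in> H \<Longrightarrow> (norm h)\<^sup>2 \<le> M * (norm (rho h))\<^sup>2 \<and> (norm (rho h))\<^sup>2 \<le> M * (norm h)\<^sup>2"
  shows "rho_comparable \<nu> \<nu>' H"
proof -
  obtain \<kappa> where \<kappa>: "\<kappa> \<ge> 1" "\<And>x. \<nu> x \<le> \<kappa> * norm x" "\<And>x. norm x \<le> \<kappa> * \<nu> x"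
    using is_norm_equivalent[OF \<nu>(1)] by blast
  obtain \<kappa>' where \<kappa>': "\<kappa>' \<ge> 1" "\<And>x. \<nu>' x \<le> \<kappa>' * norm x" "\<And>x. norm x \<le> \<kappa>' * \<nu>' x"
    using is_norm_equivalent[OF \<nu>(2)] by blast
  have le: "x \<le> M * y" if "x\<^sup>2 \<le> M * y\<^sup>2" "y \<ge> 0" for x y :: real
  proof (rule power2_le_imp_le)
    have "1 * (M * y\<^sup>2) \<le> M * (M * y\<^sup>2)" using M by (intro mult_right_mono) auto
    then have "M * y\<^sup>2 \<le> (M * y)\<^sup>2" by (simp add: power2_eq_square mult_ac)
    then show "x\<^sup>2 \<le> (M * y)\<^sup>2" using that by linarith
  qed (use M that in simp)
  define c where "c = \<kappa> * M * \<kappa>'"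
  have c1: "c \<ge> 1" unfolding c_def by (intro mult_ge1_I \<kappa>(1) \<kappa>'(1) M)
  have 1: "\<nu> h \<le> c * \<nu>' (rho h)" "\<nu>' (rho h) \<le> c * \<nu> h" if "h \<in> H" for h
  proof -
    have "\<nu> h \<le> \<kappa> * norm h" by (rule \<kappa>(2))
    also have "\<dots> \<le> \<kappa> * (M * norm (rho h))" using \<kappa>(1) by (intro mult_left_mono[OF le]) (use H[OF that] in auto)
    also have "\<dots> \<le> \<kappa> * (M * (\<kappa>' * \<nu>' (rho h)))" using \<kappa>(1) M by (intro mult_left_mono \<kappa>'(3)) auto
    finally show "\<nu> h \<le> c * \<nu>' (rho h)" by (simp add: c_def mult_ac)
    have "\<nu>' (rho h) \<le> \<kappa>' * norm (rho h)" by (rule \<kappa>'(2))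
    also have "\<dots> \<le> \<kappa>' * (M * norm h)" using \<kappa>'(1) by (intro mult_left_mono[OF le]) (use H[OF that] in auto)
    also have "\<dots> \<le> \<kappa>' * (M * (\<kappa> * \<nu> h))" using \<kappa>'(1) M by (intro mult_left_mono \<kappa>(3)) auto
    finally show "\<nu>' (rho h) \<le> c * \<nu> h" by (simp add: c_def mult_ac)
  qed
  show ?thesis
    unfolding rho_comparable_def
  proof (intro exI[of _ c] exI[of _ "{}"] conjI ballI c1 compact_empty)
    fix h assume "h \<in> H - {}"
    then show "inverse c * \<nu> h \<le> \<nu>' (rho h)" "\<nu>' (rho h) \<le> c * \<nu> h"
      using 1[of h] c1 by (auto simp: field_simps)
  qed
qed

text \<open>On either abelian group the minor \<open>b * e - c * d\<close> is just
  \<open>- c\<close>, so \<open>rho\<close> merely rearranges the entries up to sign and the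
  Euclidean norms agree.\<close>

lemma rho_comparable_abelian_unipotent:
  assumes \<nu>: "is_norm \<nu>" "is_norm \<nu>'"
    and H: "subgroup H SL3" "closed H" "connected H"
    and lie: "lie_alg H = u_alpha + u_alpha_beta \<or> lie_alg H = u_beta + u_alpha_beta"
  shows "rho_comparable \<nu> \<nu>' H"
proof -
  define Ka where "Ka = {g \<in> N_grp. g$2$3 = 0}"
  define Kb where "Kb = {g \<in> N_grp. g$1$2 = 0}"
  have Ka: "g \<in> Ka \<longleftrightarrow> (\<exists>x z. g = ut 1 x z 1 0 1)" for g
    unfolding Ka_def by (auto, metis N_grp_iff)
  have Kb: "g \<in> Kb \<longleftrightarrow> (\<exists>y z. g = ut 1 0 z 1 y 1)" for g
    unfolding Kb_def by (auto, metis N_grp_iff)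
  have subA: "subgroup Ka SL3"
  proof (rule subgroup_SL3I)
    fix g assume "g \<in> Ka"
    then obtain x z where "g = ut 1 x z 1 0 1" by (auto simp: Ka)
    then show "det g = 1" "\<exists>g'\<in>Ka. g ** g' = mat 1"
      by (auto simp: Ka mat_1_ut intro!: bexI[of _ "ut 1 (-x) (-z) 1 0 1"])
  qed (auto simp: Ka mat_1_ut)
  have subB: "subgroup Kb SL3"
  proof (rule subgroup_SL3I)
    fix g assume "g \<in> Kb"
    then obtain y z where "g = ut 1 0 z 1 y 1" by (auto simp: Kb)
    then show "det g = 1" "\<exists>g'\<in>Kb. g ** g' = mat 1"
      by (auto simp: Kb mat_1_ut intro!: bexI[of _ "ut 1 0 (-z) 1 (-y) 1"])
  qed (auto simp: Kb mat_1_ut)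
  have cl: "closed Ka" "closed Kb"
    unfolding Ka_def Kb_def Collect_conj_eq Collect_mem_eq
    by (intro closed_Int closed_N_grp closed_Collect_eq continuous_intros)+
  have "H \<subseteq> Ka \<or> H \<subseteq> Kb"
    using lie
  proof
    assume lie: "lie_alg H = u_alpha + u_alpha_beta"
    have "H \<subseteq> Ka"
    proof (rule closed_subgroup_eqI[OF H subA cl(1)], rule subsetI)
      fix X assume "X \<in> lie_alg H"
      then obtain A B where "A \<in> u_alpha" "B \<in> u_alpha_beta" "X = A + B"
        unfolding lie by (auto elim: set_plus_elim)
      then have X: "X = ut 0 (X$1$2) (X$1$3) 0 0 0"
        by (auto simp: u_alpha_def u_alpha_beta_def vec_eq_iff forall_3)
      show "X \<in> lie_alg Ka"
      proof (rule lie_alg_curve[OF subA cl(1), of "\<lambda>t. ut 1 (t * X$1$2) (t * X$1$3) 1 0 1"])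
        show "((\<lambda>t. ut 1 (t * X$1$2) (t * X$1$3) 1 0 1 $ i $ j) has_real_derivative X $ i $ j) (at 0)" for i j
          by (subst X) (intro has_real_derivative_ut; auto intro!: derivative_eq_intros)
      qed (auto simp: Ka mat_1_ut)
    qed
    then show ?thesis ..
  next
    assume lie: "lie_alg H = u_beta + u_alpha_beta"
    have "H \<subseteq> Kb"
    proof (rule closed_subgroup_eqI[OF H subB cl(2)], rule subsetI)
      fix X assume "X \<in> lie_alg H"
      then obtain A B where "A \<in> u_beta" "B \<in> u_alpha_beta" "X = A + B"
        unfolding lie by (auto elim: set_plus_elim)
      then have X: "X = ut 0 0 (X$1$3) 0 (X$2$3) 0"
        by (auto simp: u_beta_def u_alpha_beta_def vec_eq_iff forall_3)
      show "X \<in> lie_alg Kb"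
      proof (rule lie_alg_curve[OF subB cl(2), of "\<lambda>t. ut 1 0 (t * X$1$3) 1 (t * X$2$3) 1"])
        show "((\<lambda>t. ut 1 0 (t * X$1$3) 1 (t * X$2$3) 1 $ i $ j) has_real_derivative X $ i $ j) (at 0)" for i j
          by (subst X) (intro has_real_derivative_ut; auto intro!: derivative_eq_intros)
      qed (auto simp: Kb mat_1_ut)
    qed
    then show ?thesis ..
  qed
  then have "h \<in> Ka \<or> h \<in> Kb" if "h \<in> H" for h using that by blast
  then have "(\<exists>x z. h = ut 1 x z 1 0 1) \<or> (\<exists>y z. h = ut 1 0 z 1 y 1)" if "h \<in> H" for h
    using that unfolding Ka Kb by blast
  moreover have "(norm (rho (ut 1 x z 1 0 1)))\<^sup>2 = (norm (ut 1 x z 1 0 1))\<^sup>2"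
    "(norm (rho (ut 1 0 z 1 x 1)))\<^sup>2 = (norm (ut 1 0 z 1 x 1))\<^sup>2" for x z
    unfolding norm_sq_ut norm_sq_rho_ut by simp_all
  ultimately have "(norm (rho h))\<^sup>2 = (norm h)\<^sup>2" if "h \<in> H" for h
    using that by metis
  then show ?thesis by (intro rho_comparableI[OF \<nu>, of 1]) auto
qed

text \<open>A spanning vector with a zero coordinate would make the line one of the two excluded
  root spaces.\<close>

lemma one_dim_subspace_u_alpha_u_beta:
  assumes u: "subspace u" "dim u = 1" "u \<subseteq> u_alpha + u_beta" "u \<notin> {u_alpha, u_beta}"
  obtains x y where "x \<noteq> 0" "y \<noteq> 0" "\<And>X. X \<in> u \<Longrightarrow> \<exists>s. X = ut 0 (s * x) 0 0 (s * y) 0"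
proof -
  have form: "X = ut 0 (X$1$2) 0 0 (X$2$3) 0" if X: "X \<in> u" for X
  proof -
    have "X \<in> u_alpha + u_beta" using X u(3) by blast
    then obtain A B where "A \<in> u_alpha" "B \<in> u_beta" "X = A + B"
      by (auto elim: set_plus_elim)
    then show ?thesis by (auto simp: u_alpha_def u_beta_def vec_eq_iff forall_3)
  qed
  obtain B where B: "B \<subseteq> u" "independent B" "u \<subseteq> span B" "card B = dim u"
    using basis_exists by metis
  then obtain V where BV: "B = {V}" using u(2) by (metis card_1_singletonE)
  have V: "V \<in> u" "V \<noteq> 0" using B BV dependent_zero[of B] by auto
  have span: "\<exists>s. X = s *\<^sub>R V" if "X \<in> u" for X
    using that B(3) BV by (auto simp: span_singleton)
  have sc: "s *\<^sub>R V \<in> u" for s using u(1) V(1) by (rule subspace_mul)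
  define x where "x = V$1$2"
  define y where "y = V$2$3"
  have Vxy: "V = ut 0 x 0 0 y 0" using form[OF V(1)] by (simp add: x_def y_def)
  have ua: "X \<in> u_alpha \<longleftrightarrow> X = ut 0 (X$1$2) 0 0 0 0" and ub: "X \<in> u_beta \<longleftrightarrow> X = ut 0 0 0 0 (X$2$3) 0" for X
    by (auto simp: u_alpha_def u_beta_def vec_eq_iff forall_3)
  have "y \<noteq> 0"
  proof
    assume y: "y = 0"
    then have x0: "x \<noteq> 0" using V(2) Vxy by (auto simp: vec_eq_iff forall_3)
    have "u = u_alpha"
    proof (intro equalityI subsetI)
      fix X assume "X \<in> u"
      then obtain s where "X = s *\<^sub>R V" using span by blast
      then have "X = ut 0 (s * x) 0 0 0 0" by (simp only: Vxy y ut_scaleR mult_zero_right)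
      then show "X \<in> u_alpha" unfolding ua by simp
    next
      fix X assume "X \<in> u_alpha"
      then have "X = (X$1$2 / x) *\<^sub>R V" using x0 by (simp add: ua Vxy y ut_scaleR)
      then show "X \<in> u" using sc by metis
    qed
    then show False using u(4) by simp
  qed
  moreover have "x \<noteq> 0"
  proof
    assume x: "x = 0"
    then have y0: "y \<noteq> 0" using V(2) Vxy by (auto simp: vec_eq_iff forall_3)
    have "u = u_beta"
    proof (intro equalityI subsetI)
      fix X assume "X \<in> u"
      then obtain s where "X = s *\<^sub>R V" using span by blast
      then have "X = ut 0 0 0 0 (s * y) 0" by (simp only: Vxy x ut_scaleR mult_zero_right)
      then show "X \<in> u_beta" unfolding ub by simp
    next
      fix X assume "X \<in> u_beta"
      then have "X = (X$2$3 / y) *\<^sub>R V" using y0 by (simp add: ub Vxy x ut_scaleR)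
      then show "X \<in> u" using sc by metis
    qed
    then show False using u(4) by simp
  qed
  moreover have "\<exists>s. X = ut 0 (s * x) 0 0 (s * y) 0" if "X \<in> u" for X
    using span[OF that] Vxy by (auto simp: ut_scaleR)
  ultimately show ?thesis using that by blast
qed

text \<open>Equal roots together with trace 0 force the middle entry to vanish.\<close>

lemma ker_alpha_minus_beta_eq:
  assumes "X \<in> ker_alpha_minus_beta"
  shows "X = ut (X$1$1) 0 0 0 0 (- X$1$1)"
proof -
  have X: "X \<in> lie_alg A_grp" "X$1$1 - X$2$2 = X$2$2 - X$3$3"
    using assms by (auto simp: ker_alpha_minus_beta_def root_alpha_def root_beta_def)
  have "X$i$j = 0" if "i \<noteq> j" for i j
    using that by (intro lie_alg_entry_0[OF X(1)]) (auto simp: A_grp_def)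
  moreover have "X$1$1 + X$2$2 + X$3$3 = 0"
    by (intro lie_alg_trace_0[OF X(1)]) (auto simp: A_grp_def upper_tri_def carrier_SL3)
  then have "X$2$2 = 0" "X$3$3 = - X$1$1" using X(2) by auto
  ultimately show ?thesis by (simp add: vec_eq_iff forall_3)
qed

text \<open>On the explicit group, passing from \<open>h\<close> to \<open>rho h\<close> exchanges
  \<open>x\<close> and \<open>y\<close> in the squares of the entries and leaves the other squares
  in place. Since both are nonzero, the norms differ by the ratios \<open>x / y\<close> and
  \<open>y / x\<close> at most.\<close>

lemma rho_comparable_ker_alpha_minus_beta:
  assumes \<nu>: "is_norm \<nu>" "is_norm \<nu>'"
    and H: "subgroup H SL3" "closed H" "connected H"
    and u: "subspace u" "dim u = 1" "u \<subseteq> u_alpha + u_beta" "u \<notin> {u_alpha, u_beta}"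
    and lie: "lie_alg H = ker_alpha_minus_beta + u"
  shows "rho_comparable \<nu> \<nu>' H"
proof -
  obtain x y where xy: "x \<noteq> 0" "y \<noteq> 0" "\<And>X. X \<in> u \<Longrightarrow> \<exists>s. X = ut 0 (s * x) 0 0 (s * y) 0"
    using one_dim_subspace_u_alpha_u_beta[OF u] by metis
  \<comment> \<open>The products of \<open>diag (E, 1, 1 / E)\<close> and a one-parameter unipotent
    group, written by closed conditions: \<open>g$1$1 \<ge> 0\<close> with
    \<open>g$1$1 * g$3$3 = 1\<close> stands for \<open>E > 0\<close>.\<close>
  define K where "K = {g. upper_tri g \<and> g$1$1 \<ge> 0 \<and> g$2$2 = 1 \<and> g$1$1 * g$3$3 = 1 \<and>
    y * g$1$2 = x * g$1$1 * g$2$3 \<and> 2 * g$1$3 = g$1$2 * g$2$3}"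
  have K: "g \<in> K \<longleftrightarrow> (\<exists>E s. E > 0 \<and> g = ut E (E * s * x) (E * s\<^sup>2 * x * y / 2) 1 (s * y) (1 / E))" for g
  proof
    assume g: "g \<in> K"
    define E where "E = g$1$1"
    define s where "s = g$2$3 / y"
    have E: "E > 0" using g by (cases "E = 0") (auto simp: K_def E_def)
    have 12: "g$1$2 = E * s * x" and 23: "g$2$3 = s * y" and 33: "g$3$3 = 1 / E"
      using g xy E by (auto simp: K_def E_def s_def field_simps)
    have "g = ut E (E * s * x) (E * s\<^sup>2 * x * y / 2) 1 (s * y) (1 / E)"
    proof -
      have "2 * g$1$3 = (E * s * x) * (s * y)"
        using g unfolding K_def by (simp only: mem_Collect_eq flip: 12 23)
      then have 13: "g$1$3 = E * s\<^sup>2 * x * y / 2"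
        by (simp add: power2_eq_square mult_ac)
      have 11: "g$1$1 = E" and 22: "g$2$2 = 1" and ut: "upper_tri g" using g by (auto simp: E_def K_def)
      show ?thesis
        by (subst upper_tri_eq_ut[OF ut]) (simp only: 11 12 13 22 23 33)
    qed
    then show "\<exists>E s. E > 0 \<and> g = ut E (E * s * x) (E * s\<^sup>2 * x * y / 2) 1 (s * y) (1 / E)"
      using E by blast
  qed (auto simp: K_def power2_eq_square)
  have sub: "subgroup K SL3"
  proof (rule subgroup_SL3I)
    fix g assume "g \<in> K"
    then obtain E s where E: "E > 0" and g: "g = ut E (E * s * x) (E * s\<^sup>2 * x * y / 2) 1 (s * y) (1 / E)"
      by (auto simp: K)
    show "det g = 1" using E g by simp
    define g' where "g' = ut (1 / E) (1 / E * (- (E * s)) * x) (1 / E * (- (E * s))\<^sup>2 * x * y / 2) 1 (- (E * s) * y) (1 / (1 / E))"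
    have "g' \<in> K" unfolding K g'_def using E by (intro exI[of _ "1 / E"] exI[of _ "- (E * s)"]) simp
    moreover have "g ** g' = mat 1"
      using E by (simp add: g g'_def mat_1_ut field_simps power2_eq_square)
    ultimately show "\<exists>g'\<in>K. g ** g' = mat 1" by blast
    fix h assume "h \<in> K"
    then obtain F r where F: "F > 0" and h: "h = ut F (F * r * x) (F * r\<^sup>2 * x * y / 2) 1 (r * y) (1 / F)"
      by (auto simp: K)
    \<comment> \<open>Moving \<open>diag (F, 1, 1 / F)\<close> past the unipotent factor divides
      \<open>s\<close> by \<open>F\<close> in both root entries, because the two roots agree on
      it.\<close>
    have "g ** h = ut (E * F) (E * F * (r + s / F) * x) (E * F * (r + s / F)\<^sup>2 * x * y / 2) 1 ((r + s / F) * y) (1 / (E * F))"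
      using E F by (simp add: g h field_simps power2_eq_square)
    then show "g ** h \<in> K" unfolding K using E F by (intro exI[of _ "E * F"] exI[of _ "r + s / F"]) simp
  qed (auto simp: K_def mat_1_ut)
  have cl: "closed K"
    unfolding K_def
    by (intro closed_Collect_conj closed_upper_tri closed_Collect_eq closed_Collect_le continuous_intros)
  have HK: "H \<subseteq> K"
  proof (rule closed_subgroup_eqI[OF H sub cl], rule subsetI)
    fix X assume "X \<in> lie_alg H"
    then obtain A B where AB: "A \<in> ker_alpha_minus_beta" "B \<in> u" "X = A + B"
      unfolding lie by (auto elim: set_plus_elim)
    obtain a where A: "A = ut a 0 0 0 0 (- a)" using ker_alpha_minus_beta_eq[OF AB(1)] by blast
    obtain s where B: "B = ut 0 (s * x) 0 0 (s * y) 0" using xy(3)[OF AB(2)] by blast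
    have X: "X = ut a (s * x) 0 0 (s * y) (- a)" by (simp add: AB(3) A B ut_add)
    define g where "g t = ut (exp (a * t)) (exp (a * t) * (t * s) * x) (exp (a * t) * (t * s)\<^sup>2 * x * y / 2) 1
        ((t * s) * y) (exp (- a * t))" for t
    show "X \<in> lie_alg K"
    proof (rule lie_alg_curve[OF sub cl, of g])
      show "((\<lambda>t. g t $ i $ j) has_real_derivative X $ i $ j) (at 0)" for i j
        unfolding X g_def by (intro has_real_derivative_ut; auto intro!: derivative_eq_intros)
      show "g t \<in> K" for t
        unfolding K g_def by (intro exI[of _ "exp (a * t)"] exI[of _ "t * s"]) (simp add: exp_minus inverse_eq_divide)
    qed (simp add: mat_1_ut g_def)
  qed
  define M where "M = max 1 (max ((x / y)\<^sup>2) ((y / x)\<^sup>2))"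
  have scale: "p\<^sup>2 \<le> M * q\<^sup>2" if "p\<^sup>2 = (x / y)\<^sup>2 * q\<^sup>2 \<or> p\<^sup>2 = (y / x)\<^sup>2 * q\<^sup>2 \<or> p\<^sup>2 = q\<^sup>2" for p q
  proof -
    have "(x / y)\<^sup>2 * q\<^sup>2 \<le> M * q\<^sup>2" "(y / x)\<^sup>2 * q\<^sup>2 \<le> M * q\<^sup>2" "1 * q\<^sup>2 \<le> M * q\<^sup>2"
      by (intro mult_right_mono; simp add: M_def)+
    then show ?thesis using that by auto
  qed
  show ?thesis
  proof (rule rho_comparableI[OF \<nu>])
    show "M \<ge> 1" by (simp add: M_def)
    fix h assume "h \<in> H"
    then have "h \<in> K" using HK by blast
    then obtain E s where E: "E > 0" and h: "h = ut E (E * s * x) (E * s\<^sup>2 * x * y / 2) 1 (s * y) (1 / E)"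
      by (auto simp: K)
    have n: "(norm h)\<^sup>2 = E\<^sup>2 + (E * s * x)\<^sup>2 + (E * s\<^sup>2 * x * y / 2)\<^sup>2 + 1\<^sup>2 + (s * y)\<^sup>2 + (1 / E)\<^sup>2"
      unfolding h norm_sq_ut ..
    have "E * s * x * (s * y) - E * s\<^sup>2 * x * y / 2 * 1 = E * s\<^sup>2 * x * y / 2"
      by (simp add: power2_eq_square)
    moreover have "E * s * x * (1 / E) = s * x" "E * (1 / E) = 1" "E * (s * y) = E * s * y" using E by auto
    ultimately have m: "(norm (rho h))\<^sup>2 = E\<^sup>2 + (E * s * y)\<^sup>2 + 1\<^sup>2 + (E * s\<^sup>2 * x * y / 2)\<^sup>2 + (s * x)\<^sup>2 + (1 / E)\<^sup>2"
      unfolding h norm_sq_rho_ut by (simp only: mult_1_left mult_1_right)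
    have ex: "(E * s * x)\<^sup>2 = (x / y)\<^sup>2 * (E * s * y)\<^sup>2" "(s * y)\<^sup>2 = (y / x)\<^sup>2 * (s * x)\<^sup>2"
      "(E * s * y)\<^sup>2 = (y / x)\<^sup>2 * (E * s * x)\<^sup>2" "(s * x)\<^sup>2 = (x / y)\<^sup>2 * (s * y)\<^sup>2"
      using xy by (auto simp: power2_eq_square)
    have s1: "q\<^sup>2 \<le> M * q\<^sup>2" for q by (rule scale) simp
    note s2 = scale[of "E * s * x" "E * s * y"] scale[of "s * y" "s * x"]
      scale[of "E * s * y" "E * s * x"] scale[of "s * x" "s * y"]
    show "(norm h)\<^sup>2 \<le> M * (norm (rho h))\<^sup>2 \<and> (norm (rho h))\<^sup>2 \<le> M * (norm h)\<^sup>2"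
      unfolding n m distrib_left
      using s1[of E] s1[of "E * s\<^sup>2 * x * y / 2"] s1[of 1] s1[of "1 / E"] s2 ex
      by (intro conjI) linarith+
  qed
qed

section \<open>The subgroups of part (3)\<close>

text \<open>The exponential of \<open>b\<close> times the nilpotent matrix with entries
  \<open>x\<close>, \<open>y\<close>, \<open>z\<close> at (1,2), (2,3), (1,3); the quadratic term is
  half of its square. In \<open>ut\<close> the (1,3) entry precedes the (2,3) entry.\<close>

definition unip :: "real \<Rightarrow> real \<Rightarrow> real \<Rightarrow> real \<Rightarrow> mat3" where
  "unip x y z b = ut 1 (b * x) (b * z + b\<^sup>2 * (x * y) / 2) 1 (b * y) 1"

lemma unip_add: "unip x y z (b + b') = unip x y z b ** unip x y z b'"
  by (simp add: unip_def power2_eq_square field_simps)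

lemma unip_0: "unip x y z 0 = mat 1"
  by (simp add: unip_def mat_1_ut)

lemma unip_derivative: "((\<lambda>b. unip x y z b $ i $ j) has_real_derivative ut 0 x z 0 y 0 $ i $ j) (at 0)"
  unfolding unip_def by (intro has_real_derivative_ut; auto intro!: derivative_eq_intros)

lemma mat_exp_unip: "mat_exp (b *\<^sub>R ut 0 x z 0 y 0) = unip x y z b"
  by (rule mat_exp_one_parameter[OF unip_add unip_0 unip_derivative])

text \<open>The logarithm of an element of N has entries \<open>g$1$2\<close>, \<open>g$2$3\<close>
  and \<open>g$1$3 - g$1$2 * g$2$3 / 2\<close>. The equations say that it is parallel to
  \<open>(x, y, z)\<close>, and they make the range visibly closed.\<close>

lemma range_unip:
  assumes "(x, y, z) \<noteq> (0, 0, 0)"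
  shows "range (unip x y z) = {g \<in> N_grp. g$1$2 * y = g$2$3 * x \<and>
    g$1$2 * z = (g$1$3 - g$1$2 * g$2$3 / 2) * x \<and> g$2$3 * z = (g$1$3 - g$1$2 * g$2$3 / 2) * y}"
proof (intro equalityI subsetI)
  fix g assume g: "g \<in> {g \<in> N_grp. g$1$2 * y = g$2$3 * x \<and>
    g$1$2 * z = (g$1$3 - g$1$2 * g$2$3 / 2) * x \<and> g$2$3 * z = (g$1$3 - g$1$2 * g$2$3 / 2) * y}"
  define w where "w = g$1$3 - g$1$2 * g$2$3 / 2"
  have eq: "g$1$2 * y = g$2$3 * x" "g$1$2 * z = w * x" "g$2$3 * z = w * y" using g by (auto simp: w_def)
  have "\<exists>b. g$1$2 = b * x \<and> g$2$3 = b * y \<and> w = b * z"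
  proof -
    consider "x \<noteq> 0" | "y \<noteq> 0" | "z \<noteq> 0" using assms by auto
    then show ?thesis
    proof cases
      case 1 then show ?thesis using eq by (intro exI[of _ "g$1$2 / x"]) (simp add: field_simps)
    next
      case 2 then show ?thesis using eq by (intro exI[of _ "g$2$3 / y"]) (simp add: field_simps)
    next
      case 3 then show ?thesis using eq by (intro exI[of _ "w / z"]) (simp add: field_simps)
    qed
  qed
  then obtain b where b: "g$1$2 = b * x" "g$2$3 = b * y" "w = b * z" by blast
  have 13: "g$1$3 = b * z + b\<^sup>2 * (x * y) / 2"
  proof -
    have "g$1$3 - (b * x) * (b * y) / 2 = b * z" using b(3) unfolding w_def b(1,2) .
    then show ?thesis by (simp add: power2_eq_square field_simps)
  qed
  have "g \<in> N_grp" using g by simp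
  then have "g = ut 1 (g$1$2) (g$1$3) 1 (g$2$3) 1" by (simp only: N_grp_iff)
  then have "g = unip x y z b" unfolding unip_def b(1,2) 13 .
  then show "g \<in> range (unip x y z)" by blast
qed (auto simp: unip_def power2_eq_square)

lemma closed_range_unip:
  assumes "(x, y, z) \<noteq> (0, 0, 0)"
  shows "closed (range (unip x y z))"
  unfolding range_unip[OF assms] Collect_conj_eq Collect_mem_eq
  by (intro closed_Int closed_N_grp closed_Collect_eq continuous_intros) auto

lemma subgroup_range_unip: "subgroup (range (unip x y z)) SL3"
proof (rule subgroup_SL3I)
  fix g assume "g \<in> range (unip x y z)"
  then obtain b where g: "g = unip x y z b" by blast
  then show "det g = 1" by (simp add: unip_def)
  have "g ** unip x y z (- b) = mat 1"
    using unip_add[of x y z b "- b"] by (simp add: g unip_0)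
  then show "\<exists>g'\<in>range (unip x y z). g ** g' = mat 1" by blast
  fix g' assume "g' \<in> range (unip x y z)"
  then obtain b' where "g' = unip x y z b'" by blast
  then show "g ** g' \<in> range (unip x y z)" by (simp add: g flip: unip_add)
qed (auto simp: image_iff intro: exI[of _ 0] unip_0[symmetric])

lemma upper_tri_mult_diag:
  "upper_tri a \<Longrightarrow> upper_tri b \<Longrightarrow> (a ** b)$i$i = a$i$i * b$i$i"
  using exhaust_3[of i] by (auto simp: upper_tri_def matrix_matrix_mult_def sum_3)

text \<open>
  The weights \<open>d\<close> say that the diagonals of the elements of \<open>H\<close> lie on the line
  \<open>t \<mapsto> diag (exp (d 1 * t), exp (d 2 * t), exp (d 3 * t))\<close>.
\<close>
locale two_dim_subgroup =
  fixes H :: "mat3 set" and i :: 3 and d :: "3 \<Rightarrow> real"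
  assumes sub: "subgroup H SL3" and cl: "closed H" and conn: "connected H"
    and upper: "\<And>h. h \<in> H \<Longrightarrow> upper_tri h"
    and dim_lie: "dim (lie_alg H) = 2"
    and pos: "\<And>h l. h \<in> H \<Longrightarrow> h$l$l > 0"
    and weights: "\<And>h l. h \<in> H \<Longrightarrow> ln (h$l$l) = d l * ln (h$i$i)"
    and not_unipotent: "\<not> H \<subseteq> N_grp"
    and not_split: "H \<noteq> (H \<inter> A_grp) <#>\<^bsub>SL3\<^esub> (H \<inter> N_grp)"
begin

lemma lie_upper: "X \<in> lie_alg H \<Longrightarrow> upper_tri X"
  using lie_alg_upper_tri upper by blast

lemma lie_diag:
  assumes X: "X \<in> lie_alg H" shows "X$l$l = d l * X$i$i"
proof -
  have "mat_exp X \<in> H" using lie_alg_mat_exp[OF X, of 1] by simp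
  from weights[OF this, of l] show ?thesis
    by (simp add: mat_exp_upper_tri_diag[OF lie_upper[OF X]])
qed

lemma in_N_grp:
  assumes h: "h \<in> H" "h$i$i = 1" shows "h \<in> N_grp"
proof -
  have "h$l$l = 1" for l using weights[OF h(1), of l] pos[OF h(1), of l] h(2) by simp
  then show ?thesis using upper[OF h(1)] by (simp add: N_grp_def upper_tri_def)
qed

lemma lie_nilpotent_eq:
  assumes X: "X \<in> lie_alg H" "X$i$i = 0" shows "X = ut 0 (X$1$2) (X$1$3) 0 (X$2$3) 0"
proof -
  have "X$l$l = 0" for l using lie_diag[OF X(1), of l] X(2) by simp
  then show ?thesis by (subst upper_tri_eq_ut[OF lie_upper[OF X(1)]]) (simp only:)
qed

text \<open>If every tangent vector had zero diagonal, H would lie in N. So some \<open>X\<close>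
  can be normalized to \<open>X$i$i = 1\<close>, and a second basis vector becomes nilpotent after
  subtracting a multiple of \<open>X\<close>.\<close>

lemma lie_basis:
  obtains X x y z where "X \<in> lie_alg H" "X$i$i = 1" "ut 0 x z 0 y 0 \<in> lie_alg H" "(x, y, z) \<noteq> (0, 0, 0)"
    "\<And>Y. Y \<in> lie_alg H \<Longrightarrow> \<exists>a b. Y = a *\<^sub>R X + b *\<^sub>R ut 0 x z 0 y 0"
proof -
  have S: "subspace (lie_alg H)" by (rule lie_alg_subspace[OF sub cl])
  have "\<exists>X\<in>lie_alg H. X$i$i \<noteq> 0"
  proof (rule ccontr)
    assume neg: "\<not> ?thesis"
    have "H \<subseteq> N_grp"
    proof (rule closed_subgroup_eqI[OF sub cl conn N_grp_subgroup closed_N_grp], rule subsetI)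
      fix X assume X: "X \<in> lie_alg H"
      then have "X = ut 0 (X$1$2) (X$1$3) 0 (X$2$3) 0" using neg lie_nilpotent_eq by blast
      then have "mat_exp (t *\<^sub>R X) = unip (X$1$2) (X$2$3) (X$1$3) t" for t using mat_exp_unip by metis
      then show "X \<in> lie_alg N_grp" by (simp add: lie_alg_def unip_def)
    qed
    then show False using not_unipotent by blast
  qed
  then obtain X0 where X0: "X0 \<in> lie_alg H" "X0$i$i \<noteq> 0" by blast
  define X where "X = (1 / X0$i$i) *\<^sub>R X0"
  have X: "X \<in> lie_alg H" "X$i$i = 1" using X0 by (auto simp: X_def subspace_mul[OF S])
  have X_nz: "X \<noteq> 0" using X(2) by auto
  have "dim (span {X}) = 1" using X_nz by (simp add: dim_eq_card_independent)
  then have "\<not> lie_alg H \<subseteq> span {X}" using dim_lie dim_subset[of "lie_alg H" "span {X}"] by auto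
  then obtain Y where Y: "Y \<in> lie_alg H" "Y \<notin> span {X}" by blast
  define V where "V = Y - (Y$i$i) *\<^sub>R X"
  have V: "V \<in> lie_alg H" unfolding V_def by (intro subspace_diff[OF S] subspace_mul[OF S] Y X)
  have Vi: "V$i$i = 0" by (simp add: V_def X)
  have V_span: "V \<notin> span {X}"
  proof
    assume "V \<in> span {X}"
    then have "V + (Y$i$i) *\<^sub>R X \<in> span {X}" by (intro span_add span_mul[OF span_base]) auto
    then show False using Y(2) by (simp add: V_def)
  qed
  have ind: "independent {V, X}"
    using V_span X_nz by (simp add: independent_insert)
  have "lie_alg H = span {V, X}"
  proof (rule sym, rule subspace_dim_equal)
    show "span {V, X} \<subseteq> lie_alg H" using V X(1) S by (intro span_minimal) auto
    have "V \<noteq> X" using V_span span_base[of X "{X}"] by auto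
    then show "dim (lie_alg H) \<le> dim (span {V, X})"
      using dim_eq_card_independent[OF ind] by (simp add: dim_lie)
  qed (use S in auto)
  then have span: "\<exists>a b. Y = a *\<^sub>R X + b *\<^sub>R V" if "Y \<in> lie_alg H" for Y
    using that by (auto simp: span_insert span_singleton) (metis diff_add_cancel)
  have V_nz: "V \<noteq> 0" using V_span span_zero by metis
  note Vut = lie_nilpotent_eq[OF V Vi]
  show ?thesis
  proof (rule that[of X "V$1$2" "V$1$3" "V$2$3"])
    show "(V $ 1 $ 2, V $ 2 $ 3, V $ 1 $ 3) \<noteq> (0, 0, 0)"
    proof
      assume "(V $ 1 $ 2, V $ 2 $ 3, V $ 1 $ 3) = (0, 0, 0)"
      then have "V = ut 0 0 0 0 0 0" using Vut by simp
      then show False using V_nz by (simp add: vec_eq_iff forall_3)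
    qed
    show "ut 0 (V$1$2) (V$1$3) 0 (V$2$3) 0 \<in> lie_alg H" using V Vut by simp
    show "\<exists>a b. Y = a *\<^sub>R X + b *\<^sub>R ut 0 (V$1$2) (V$1$3) 0 (V$2$3) 0" if "Y \<in> lie_alg H" for Y
      using span[OF that] unfolding Vut[symmetric] .
  qed (use X in auto)
qed

text \<open>
  \<open>h \<mapsto> exp(-t X) h\<close> with \<open>t = ln h$i$i\<close> retracts \<open>H\<close> onto \<open>H \<inter> N\<close>, which is therefore connected.
\<close>
lemma unipotent_part:
  assumes X: "X \<in> lie_alg H" "X$i$i = 1" and V: "ut 0 x z 0 y 0 \<in> lie_alg H" "(x, y, z) \<noteq> (0, 0, 0)"
    and span: "\<And>Y. Y \<in> lie_alg H \<Longrightarrow> \<exists>a b. Y = a *\<^sub>R X + b *\<^sub>R ut 0 x z 0 y 0"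
  shows "H \<inter> N_grp = range (unip x y z)"
proof
  let ?U = "H \<inter> N_grp"
  define \<phi> where "\<phi> h = mat_exp (- ln (h$i$i) *\<^sub>R X) ** h" for h
  have subU: "subgroup ?U SL3"
  proof (rule subgroup_SL3I)
    fix u assume u: "u \<in> ?U"
    show "det u = 1" using u subgroup_SL3D(1)[OF sub] by blast
    then obtain u' where u': "u ** u' = mat 1" by (rule SL3_inverse)
    then have "u' \<in> ?U" using u subgroup_SL3D(4)[OF sub] subgroup_SL3D(4)[OF N_grp_subgroup] by blast
    then show "\<exists>u'\<in>?U. u ** u' = mat 1" using u' by blast
    show "u ** v \<in> ?U" if "v \<in> ?U" for v
      using u that subgroup_SL3D(3)[OF sub] subgroup_SL3D(3)[OF N_grp_subgroup] by blast
  qed (use subgroup_SL3D(2)[OF sub] subgroup_SL3D(2)[OF N_grp_subgroup] in blast)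
  have "continuous_on H \<phi>"
    unfolding \<phi>_def
  proof (intro continuous_on_matrix_mult continuous_on_id)
    have "continuous_on H (\<lambda>h. - ln (h$i$i))"
      by (intro continuous_intros) (use pos in \<open>auto simp: less_imp_neq[symmetric]\<close>)
    from continuous_on_compose2[OF continuous_on_mat_exp_scaleR this]
    show "continuous_on H (\<lambda>h. mat_exp (- ln (h$i$i) *\<^sub>R X))" by auto
  qed
  then have conn': "connected (\<phi> ` H)" by (rule connected_continuous_image[OF _ conn])
  have "\<phi> ` H = ?U"
  proof (intro equalityI subsetI)
    fix g assume "g \<in> \<phi> ` H"
    then obtain h where h: "h \<in> H" "g = \<phi> h" by blast
    let ?E = "mat_exp (- ln (h$i$i) *\<^sub>R X)"
    have E: "?E \<in> H" by (rule lie_alg_mat_exp[OF X(1)])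
    have g: "g \<in> H" unfolding h(2) \<phi>_def by (rule subgroup_SL3D(3)[OF sub E h(1)])
    have "upper_tri (- ln (h$i$i) *\<^sub>R X)" using lie_upper[OF X(1)] by (simp add: upper_tri_def)
    then have "?E$i$i = 1 / h$i$i"
      using pos[OF h(1), of i] by (simp add: mat_exp_upper_tri_diag X(2) exp_minus inverse_eq_divide)
    moreover have "g$i$i = ?E$i$i * h$i$i"
      unfolding h(2) \<phi>_def
      by (rule upper_tri_mult_diag[OF upper[OF E] upper[OF h(1)]])
    ultimately have "g$i$i = 1" using pos[OF h(1), of i] by simp
    then show "g \<in> ?U" using g in_N_grp by blast
  next
    fix u assume u: "u \<in> ?U"
    then have "\<phi> u = u" by (simp add: \<phi>_def N_grp_def)
    then show "u \<in> \<phi> ` H" using u by force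
  qed
  then have connU: "connected ?U" using conn' by simp
  show "?U \<subseteq> range (unip x y z)"
  proof (rule closed_subgroup_eqI[OF subU _ connU subgroup_range_unip closed_range_unip[OF V(2)]])
    show "closed ?U" using cl closed_N_grp by blast
    show "lie_alg ?U \<subseteq> lie_alg (range (unip x y z))"
    proof
      fix Y assume Y: "Y \<in> lie_alg ?U"
      then have YH: "Y \<in> lie_alg H" by (simp add: lie_alg_def)
      have "mat_exp Y \<in> N_grp" using lie_alg_mat_exp[OF Y, of 1] by simp
      then have "Y$i$i = 0"
        using mat_exp_upper_tri_diag[OF lie_upper[OF YH], of i] by (simp add: N_grp_def)
      moreover obtain a b where ab: "Y = a *\<^sub>R X + b *\<^sub>R ut 0 x z 0 y 0" using span[OF YH] by blast
      moreover have "ut 0 x z 0 y 0 $ i $ i = 0" using exhaust_3[of i] by auto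
      ultimately have "Y = b *\<^sub>R ut 0 x z 0 y 0" using X(2) by simp
      then have "mat_exp (t *\<^sub>R Y) = unip x y z (t * b)" for t
        using mat_exp_unip[of "t * b"] by simp
      then show "Y \<in> lie_alg (range (unip x y z))" by (simp add: lie_alg_def)
    qed
  qed
  show "range (unip x y z) \<subseteq> ?U"
  proof
    fix g assume "g \<in> range (unip x y z)"
    then obtain b where g: "g = unip x y z b" by blast
    have "g \<in> H" using lie_alg_mat_exp[OF V(1), of b] by (simp add: g mat_exp_unip)
    then show "g \<in> ?U" by (simp add: g unip_def)
  qed
qed

text \<open>Choosing \<open>t\<close> to cancel the diagonal entry \<open>h$i$i\<close> leaves a
  unipotent element of H.\<close>

lemma product_form:
  assumes g: "\<And>t. g t \<in> H" "\<And>t. g t $ i $ i = exp t" and U: "H \<inter> N_grp = range (unip x y z)" and h: "h \<in> H"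
  obtains t b where "h = g t ** unip x y z b"
proof -
  define t where "t = ln (h$i$i)"
  obtain g' where g': "g t ** g' = mat 1" "g' ** g t = mat 1"
    using SL3_inverse[of "g t"] subgroup_SL3D(1)[OF sub g(1)] by metis
  have g'H: "g' \<in> H" by (rule subgroup_SL3D(4)[OF sub g(1) g'(1)])
  have prod: "(a ** b)$i$i = a$i$i * b$i$i" if "a \<in> H" "b \<in> H" for a b
    by (rule upper_tri_mult_diag[OF upper[OF that(1)] upper[OF that(2)]])
  have "g t $ i $ i * g' $ i $ i = 1" using prod[OF g(1) g'H, of t] g' by (simp add: mat_def)
  moreover have "g t $ i $ i = h$i$i" using g(2) pos[OF h, of i] by (simp add: t_def)
  ultimately have "(g' ** h)$i$i = 1" using prod[OF g'H h] by (simp add: mult.commute)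
  moreover have g'h: "g' ** h \<in> H" by (rule subgroup_SL3D(3)[OF sub g'H h])
  ultimately have "g' ** h \<in> range (unip x y z)" using in_N_grp U by blast
  then obtain b where "g' ** h = unip x y z b" by blast
  then have "g t ** unip x y z b = h" using g' by (metis matrix_mul_assoc matrix_mul_lid)
  then show ?thesis using that by metis
qed

text \<open>A diagonal complement of \<open>H \<inter> N_grp\<close> would split H. This is what
  excludes \<open>c = 0\<close> in each family.\<close>

lemma no_diagonal_one_parameter:
  assumes g: "\<And>t. g t \<in> H" "\<And>t. g t $ i $ i = exp t" and U: "H \<inter> N_grp = range (unip x y z)"
    and A: "\<And>t. g t \<in> A_grp"
  shows False
proof -
  have "H = (H \<inter> A_grp) <#>\<^bsub>SL3\<^esub> (H \<inter> N_grp)"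
  proof (intro equalityI subsetI)
    fix h assume "h \<in> H"
    then obtain t b where "h = g t ** unip x y z b" using product_form[OF g U] by metis
    then show "h \<in> (H \<inter> A_grp) <#>\<^bsub>SL3\<^esub> (H \<inter> N_grp)"
      using g(1) A U unfolding set_mult_SL3 by blast
  qed (auto simp: set_mult_SL3 intro: subgroup_SL3D(3)[OF sub])
  then show False using not_split by simp
qed

text \<open>Applied to a conjugate of the nilpotent basis vector, this makes that vector an
  eigenvector of the conjugation.\<close>

lemma lie_nilpotent_multiple:
  assumes X: "X$i$i = 1" and span: "\<And>Y. Y \<in> lie_alg H \<Longrightarrow> \<exists>a b. Y = a *\<^sub>R X + b *\<^sub>R ut 0 x z 0 y 0"
    and Y: "ut 0 p r 0 q 0 \<in> lie_alg H"
  obtains b where "p = b * x" "q = b * y" "r = b * z"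
proof -
  obtain a b where ab: "ut 0 p r 0 q 0 = a *\<^sub>R X + b *\<^sub>R ut 0 x z 0 y 0" using span[OF Y] by blast
  have "ut 0 p r 0 q 0 $ i $ i = 0" "ut 0 x z 0 y 0 $ i $ i = 0" using exhaust_3[of i] by auto
  then have "a = 0" using arg_cong[OF ab, of "\<lambda>M. M $ i $ i"] X by simp
  with ab show ?thesis using that[of b] by (simp add: ut_scaleR)
qed

text \<open>Dividing a row by its diagonal entry yields the unipotent factor of \<open>h n\<close>.
  The diagonal tends to 1, so the rescaled entries have the limit of those of \<open>h n\<close>
  itself.\<close>

lemma unipotent_factor_limit:
  assumes X: "X \<in> lie_alg H" and pq: "p \<noteq> q"
  defines "h \<equiv> \<lambda>n. mat_exp ((1 / real (Suc n)) *\<^sub>R X)"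
  shows "(\<lambda>n. real (Suc n) * (h n $ p $ q / h n $ p $ p)) \<longlonglongrightarrow> X $ p $ q"
proof -
  have "(\<lambda>n. ((h n - mat 1) /\<^sub>R (1 / real (Suc n))) $ p $ q) \<longlonglongrightarrow> X $ p $ q"
    unfolding h_def by (intro tendsto_vec_nth mat_exp_tangent)
  moreover have "((h n - mat 1) /\<^sub>R (1 / real (Suc n))) $ p $ q = real (Suc n) * h n $ p $ q" for n
    using pq by (simp add: mat_def)
  ultimately have 1: "(\<lambda>n. real (Suc n) * h n $ p $ q) \<longlonglongrightarrow> X $ p $ q" by simp
  have "h \<longlonglongrightarrow> mat 1" unfolding h_def by (rule tangent_imp_tendsto_1[OF recip_Suc mat_exp_tangent])
  then have "(\<lambda>n. h n $ p $ p) \<longlonglongrightarrow> mat 1 $ p $ p" by (intro tendsto_vec_nth)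
  then have "(\<lambda>n. h n $ p $ p) \<longlonglongrightarrow> 1" by (simp add: mat_def)
  from tendsto_divide[OF 1 this] show ?thesis by simp
qed

end

section \<open>The families of nonsplit two-dimensional subgroups\<close>

definition band_family :: "mat3 set \<Rightarrow> bool" where
  "band_family H \<longleftrightarrow> (\<exists>c. c \<noteq> 0 \<and>
     (\<forall>h\<in>H. \<exists>t s. (norm h)\<^sup>2 = sq_norm c t s \<and> (norm (rho h))\<^sup>2 = sq_norm_rho c t s) \<and>
     (\<forall>t s. \<exists>h\<in>H. (norm h)\<^sup>2 = sq_norm c t s \<and> (norm (rho h))\<^sup>2 = sq_norm_rho c t s))"

text \<open>\<open>b * m t\<close> is the entry that the unipotent factor contributes to the
  product. As \<open>m t\<close> is nonzero, it takes every real value \<open>s\<close>, so both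
  directions hold with the same \<open>c\<close>.\<close>

lemma (in two_dim_subgroup) band_familyI:
  assumes c: "c \<noteq> 0" and g: "\<And>t. g t \<in> H" "\<And>t. g t $ i $ i = exp t" and U: "H \<inter> N_grp = range (unip x y z)"
    and norms: "\<And>t b. (norm (g t ** unip x y z b))\<^sup>2 = sq_norm c t (b * m t)"
      "\<And>t b. (norm (rho (g t ** unip x y z b)))\<^sup>2 = sq_norm_rho c t (b * m t)"
    and m: "\<And>t. m t \<noteq> 0"
  shows "band_family H"
  unfolding band_family_def
proof (rule exI[of _ c], intro conjI ballI allI c)
  fix h assume "h \<in> H"
  then obtain t b where "h = g t ** unip x y z b" using product_form[OF g U] by metis
  then show "\<exists>t s. (norm h)\<^sup>2 = sq_norm c t s \<and> (norm (rho h))\<^sup>2 = sq_norm_rho c t s"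
    using norms by blast
next
  fix t s
  have "g t ** unip x y z (s / m t) \<in> H"
    using U by (intro subgroup_SL3D(3)[OF sub g(1)]) blast
  then show "\<exists>h\<in>H. (norm h)\<^sup>2 = sq_norm c t s \<and> (norm (rho h))\<^sup>2 = sq_norm_rho c t s"
    using norms[of t "s / m t"] m by (intro bexI[of _ "g t ** unip x y z (s / m t)"]) simp_all
qed

lemma exp_products: "exp t * exp t = exp (2 * t)" "exp t * exp (- 2 * t) = exp (- t)"
  "exp (- 2 * t) * exp t = exp (- t)" for t :: real
  by (simp_all flip: exp_add)

lemma exp_ln_2:
  "exp (ln 2 :: real) = 2" "exp (- ln 2 :: real) = 1 / 2" "exp (2 * ln 2 :: real) = 4" "exp (- 2 * ln 2 :: real) = 1 / 4" "exp (- (2 * ln 2) :: real) = 1 / 4"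
proof -
  show 1: "exp (ln 2 :: real) = 2" "exp (- ln 2 :: real) = 1 / 2" by (simp_all add: exp_minus)
  show 2: "exp (2 * ln 2 :: real) = 4" unfolding exp_double 1 by simp
  have "exp (- 2 * ln 2 :: real) = inverse (exp (2 * ln 2))" by (simp flip: exp_minus)
  then show "exp (- 2 * ln 2 :: real) = 1 / 4" "exp (- (2 * ln 2) :: real) = 1 / 4" by (simp_all add: 2)
qed

text \<open>
  Compatibility writes the unipotent factor of \<open>exp (t X)\<close> as an element of \<open>U C\<^sub>N(T)\<close>; its derivative at \<open>0\<close> shows that \<open>X\<close>
  minus its diagonal lies in the span of \<open>V\<close> and the root vector centralized by \<open>T\<close>. The line spanned by
  \<open>V\<close> is invariant under conjugation by \<open>H\<close>, which leaves only one root space for it (two in the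
  case of \<open>\<alpha> + \<beta>\<close>).
\<close>
lemma band_family_alpha:
  assumes "two_dim_subgroup H 1 (\<lambda>l. if l = 3 then -2 else 1)"
    and compat: "\<And>h. h \<in> H \<Longrightarrow> \<exists>u\<in>H \<inter> N_grp. \<exists>w. h = ut (h$1$1) 0 0 (h$2$2) 0 (h$3$3) ** u ** ut 1 w 0 1 0 1"
  shows "band_family H"
proof -
  interpret two_dim_subgroup H 1 "\<lambda>l. if l = 3 then -2 else 1" by fact
  obtain X x y z where X: "X \<in> lie_alg H" "X$1$1 = 1" and V: "ut 0 x z 0 y 0 \<in> lie_alg H" "(x, y, z) \<noteq> (0, 0, 0)"
    and span: "\<And>Y. Y \<in> lie_alg H \<Longrightarrow> \<exists>a b. Y = a *\<^sub>R X + b *\<^sub>R ut 0 x z 0 y 0"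
    using lie_basis by metis
  note U = unipotent_part[OF X V span]
  have S: "subspace (lie_alg H)" by (rule lie_alg_subspace[OF sub cl])
  \<comment> \<open>The centralizing factor, with its unknown \<open>w\<close>, changes only the
    (1,2) entry; the other two are those of an element of \<open>H \<inter> N_grp\<close>.\<close>
  have entries: "\<exists>b. h$1$3 / h$1$1 = b * z + b\<^sup>2 * (x * y) / 2 \<and> h$2$3 / h$2$2 = b * y" if h: "h \<in> H" for h
  proof -
    obtain u w where u: "u \<in> H \<inter> N_grp" "h = ut (h$1$1) 0 0 (h$2$2) 0 (h$3$3) ** u ** ut 1 w 0 1 0 1"
      using compat[OF h] by blast
    then obtain b where b: "u = unip x y z b" using U by blast
    have eq: "h = ut (h$1$1) (h$1$1 * (w + b * x)) (h$1$1 * (b * z + b\<^sup>2 * (x * y) / 2)) (h$2$2) (h$2$2 * (b * y)) (h$3$3)"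
      by (subst u(2)) (simp add: b unip_def algebra_simps)
    have "h$1$3 = h$1$1 * (b * z + b\<^sup>2 * (x * y) / 2)" "h$2$3 = h$2$2 * (b * y)"
      by (subst eq; simp)+
    then show ?thesis using pos[OF h, of 1] pos[OF h, of 2] by (intro exI[of _ b]) simp
  qed
  define h where "h n = mat_exp ((1 / real (Suc n)) *\<^sub>R X)" for n
  define p where "p n = h n $ 1 $ 3 / h n $ 1 $ 1" for n
  define q where "q n = h n $ 2 $ 3 / h n $ 2 $ 2" for n
  have pl: "(\<lambda>n. real (Suc n) * p n) \<longlonglongrightarrow> X$1$3" and ql: "(\<lambda>n. real (Suc n) * q n) \<longlonglongrightarrow> X$2$3"
    unfolding p_def q_def h_def by (intro unipotent_factor_limit[OF X(1)]; simp)+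
  have rel: "\<exists>b. p n = b * z + b\<^sup>2 * (x * y) / 2 \<and> q n = b * y" for n
    unfolding p_def q_def h_def by (rule entries[OF lie_alg_mat_exp[OF X(1)]])
  have q0: "q \<longlonglongrightarrow> 0"
    using tendsto_mult[OF recip_Suc(2) ql] by simp
  \<comment> \<open>Eliminating \<open>b\<close> gives \<open>y p = z q + (x / 2) q\<^sup>2\<close>;
    after rescaling by \<open>n\<close> the quadratic term disappears, because \<open>q\<close>
    tends to 0.\<close>
  have "y * X$1$3 = z * X$2$3"
  proof (rule LIMSEQ_unique)
    show "(\<lambda>n. y * (real (Suc n) * p n)) \<longlonglongrightarrow> y * X$1$3" by (intro tendsto_mult_left pl)
    have "(\<lambda>n. z * (real (Suc n) * q n) + x / 2 * ((real (Suc n) * q n) * q n)) \<longlonglongrightarrow> z * X$2$3 + x / 2 * (X$2$3 * 0)"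
      by (intro tendsto_add tendsto_mult_left tendsto_mult ql q0)
    moreover have "z * (real (Suc n) * q n) + x / 2 * ((real (Suc n) * q n) * q n) = y * (real (Suc n) * p n)" for n
      using rel[of n] by (auto simp: power2_eq_square algebra_simps)
    ultimately show "(\<lambda>n. y * (real (Suc n) * p n)) \<longlonglongrightarrow> z * X$2$3" by simp
  qed
  moreover have "X$2$3 = 0" if "y = 0"
  proof -
    have "q n = 0" for n using rel[of n] that by auto
    then show ?thesis using ql by (simp add: LIMSEQ_const_iff)
  qed
  moreover have "X$1$3 = 0" if "y = 0" "z = 0"
  proof -
    have "p n = 0" for n using rel[of n] that by auto
    then show ?thesis using pl by (simp add: LIMSEQ_const_iff)
  qed
  ultimately obtain v where v: "X$1$3 = v * z" "X$2$3 = v * y"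
    using that[of "X$2$3 / y"] that[of "X$1$3 / z"] by (cases "y = 0"; cases "z = 0") (auto simp: field_simps)
  have Xd: "X$2$2 = 1" "X$3$3 = -2" using lie_diag[OF X(1), of 2] lie_diag[OF X(1), of 3] X(2) by auto
  define g where "g c t = ut (exp t) (c * t * exp t) 0 (exp t) 0 (exp (- 2 * t))" for c t
  have gexp: "mat_exp (t *\<^sub>R ut 1 c 0 1 0 (-2)) = g c t" for c t
  proof (rule mat_exp_one_parameter)
    show "g c (s + t) = g c s ** g c t" for s t
      by (simp add: g_def exp_add exp_diff exp_minus field_simps)
    show "((\<lambda>t. g c t $ i $ j) has_real_derivative ut 1 c 0 1 0 (- 2) $ i $ j) (at 0)" for i j
      unfolding g_def by (intro has_real_derivative_ut; auto intro!: derivative_eq_intros)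
  qed (simp add: g_def mat_1_ut)
  have gH: "g c t \<in> H" if "ut 1 c 0 1 0 (-2) \<in> lie_alg H" for c t
    using lie_alg_mat_exp[OF that, of t] by (simp add: gexp)
  have g11: "g c t $ 1 $ 1 = exp t" for c t by (simp add: g_def)
  have nz: "c \<noteq> 0" if "ut 1 c 0 1 0 (-2) \<in> lie_alg H" for c
  proof
    assume "c = 0"
    then have "g c t \<in> A_grp" for t
      by (auto simp: g_def A_grp_def carrier_SL3 forall_3 simp flip: exp_add)
    then show False using no_diagonal_one_parameter[OF gH[OF that] g11 U] by blast
  qed
  define c where "c = X$1$2 - v * x"
  have X': "ut 1 c 0 1 0 (-2) \<in> lie_alg H"
  proof -
    have Xeq: "X = ut 1 (X$1$2) (v * z) 1 (v * y) (-2)"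
      by (subst upper_tri_eq_ut[OF lie_upper[OF X(1)]]) (simp only: X(2) Xd v)
    have "X - v *\<^sub>R ut 0 x z 0 y 0 = ut 1 c 0 1 0 (-2)" by (subst Xeq) (simp add: ut_scaleR ut_diff c_def)
    then show ?thesis using subspace_diff[OF S X(1) subspace_mul[OF S V(1), of v]] by simp
  qed
  note c = nz[OF X']
  \<comment> \<open>Otherwise a multiple of the nilpotent vector would cancel \<open>c\<close> and
    leave a diagonal vector in the Lie algebra.\<close>
  have yz: "y \<noteq> 0 \<or> z \<noteq> 0"
  proof (rule ccontr)
    assume "\<not> ?thesis"
    then have "y = 0" "z = 0" "x \<noteq> 0" using V(2) by auto
    then have "ut 1 c 0 1 0 (-2) - (c / x) *\<^sub>R ut 0 x z 0 y 0 = ut 1 0 0 1 0 (-2)"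
      by (simp add: ut_scaleR ut_diff)
    then show False using nz[of 0] subspace_diff[OF S X' subspace_mul[OF S V(1), of "c / x"]] by simp
  qed
  \<comment> \<open>Conjugation at time \<open>ln 2\<close> multiplies the (1,3) and (2,3) entries
    by 8, fixes the (1,2) entry, and adds the shear \<open>8 * c * L * y\<close>. If
    \<open>y\<close> were nonzero, the eigenvalue would be 8 and the shear would have to
    vanish.\<close>
  define L where "L = ln (2 :: real)"
  have L: "L \<noteq> 0" by (simp add: L_def)
  note eL = exp_ln_2[folded L_def]
  have "g c L ** ut 0 x z 0 y 0 ** g c (- L) \<in> lie_alg H"
    by (rule lie_alg_conj[OF sub cl gH[OF X'] _ V(1)]) (simp add: g_def mat_1_ut eL)
  then have "ut 0 x (8 * z + 8 * c * L * y) 0 (8 * y) 0 \<in> lie_alg H"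
    by (simp add: g_def eL) (simp add: algebra_simps)?
  then obtain b where b: "x = b * x" "8 * y = b * y" "8 * z + 8 * c * L * y = b * z"
    by (rule lie_nilpotent_multiple[OF X(2), rotated]) (use span in blast)+
  have y0: "y = 0" using b c L by (cases "y = 0") auto
  then have z0: "z \<noteq> 0" using yz by simp
  then have "b = 8" using b y0 by simp
  then have x0: "x = 0" using b by simp
  show ?thesis
  proof (rule band_familyI[OF c gH[OF X'] g11 U])
    have eq: "g c t ** unip x y z b = ut (exp t) (c * t * exp t) (b * (z * exp t)) (exp t) 0 (exp (- 2 * t))" for t b
      by (simp add: g_def unip_def x0 y0)
    show "(norm (g c t ** unip x y z b))\<^sup>2 = sq_norm c t (b * (z * exp t))" for t b
      unfolding eq norm_sq_ut sq_norm_def by simp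
    show "(norm (rho (g c t ** unip x y z b)))\<^sup>2 = sq_norm_rho c t (b * (z * exp t))" for t b
      unfolding eq norm_sq_rho_ut sq_norm_rho_def mult.assoc exp_products by (simp add: power2_eq_square)
    show "z * exp t \<noteq> 0" for t using z0 by simp
  qed
qed

text \<open>The counterpart for a torus centralizing the (2,3) root vector. The nilpotent vector is
  again in the (1,3) root space, but now the unknown \<open>w\<close> also enters the (1,3) entry,
  through the product \<open>b * x * w\<close>.\<close>

lemma band_family_beta:
  assumes "two_dim_subgroup H 2 (\<lambda>l. if l = 1 then -2 else 1)"
    and compat: "\<And>h. h \<in> H \<Longrightarrow> \<exists>u\<in>H \<inter> N_grp. \<exists>w. h = ut (h$1$1) 0 0 (h$2$2) 0 (h$3$3) ** u ** ut 1 0 0 1 w 1"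
  shows "band_family H"
proof -
  interpret two_dim_subgroup H 2 "\<lambda>l. if l = 1 then -2 else 1" by fact
  obtain X x y z where X: "X \<in> lie_alg H" "X$2$2 = 1" and V: "ut 0 x z 0 y 0 \<in> lie_alg H" "(x, y, z) \<noteq> (0, 0, 0)"
    and span: "\<And>Y. Y \<in> lie_alg H \<Longrightarrow> \<exists>a b. Y = a *\<^sub>R X + b *\<^sub>R ut 0 x z 0 y 0"
    using lie_basis by metis
  note U = unipotent_part[OF X V span]
  have S: "subspace (lie_alg H)" by (rule lie_alg_subspace[OF sub cl])
  have entries: "\<exists>b w. h$1$2 / h$1$1 = b * x \<and> h$1$3 / h$1$1 = b * z + b\<^sup>2 * (x * y) / 2 + b * x * w \<and> h$2$3 / h$2$2 = b * y + w" if h: "h \<in> H" for h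
  proof -
    obtain u w where u: "u \<in> H \<inter> N_grp" "h = ut (h$1$1) 0 0 (h$2$2) 0 (h$3$3) ** u ** ut 1 0 0 1 w 1"
      using compat[OF h] by blast
    then obtain b where b: "u = unip x y z b" using U by blast
    have eq: "h = ut (h$1$1) (h$1$1 * (b * x)) (h$1$1 * (b * z + b\<^sup>2 * (x * y) / 2 + b * x * w)) (h$2$2) (h$2$2 * (b * y + w)) (h$3$3)"
      by (subst u(2)) (simp add: b unip_def algebra_simps)
    have "h$1$2 = h$1$1 * (b * x)" "h$1$3 = h$1$1 * (b * z + b\<^sup>2 * (x * y) / 2 + b * x * w)" "h$2$3 = h$2$2 * (b * y + w)"
      by (subst eq; simp)+
    then show ?thesis using pos[OF h, of 1] pos[OF h, of 2] by (intro exI[of _ b] exI[of _ w]) simp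
  qed
  define h where "h n = mat_exp ((1 / real (Suc n)) *\<^sub>R X)" for n
  define o' where "o' n = h n $ 1 $ 2 / h n $ 1 $ 1" for n
  define p where "p n = h n $ 1 $ 3 / h n $ 1 $ 1" for n
  define q where "q n = h n $ 2 $ 3 / h n $ 2 $ 2" for n
  have ol: "(\<lambda>n. real (Suc n) * o' n) \<longlonglongrightarrow> X$1$2" and pl: "(\<lambda>n. real (Suc n) * p n) \<longlonglongrightarrow> X$1$3"
    and ql: "(\<lambda>n. real (Suc n) * q n) \<longlonglongrightarrow> X$2$3"
    unfolding o'_def p_def q_def h_def by (intro unipotent_factor_limit[OF X(1)]; simp)+
  have rel: "\<exists>b w. o' n = b * x \<and> p n = b * z + b\<^sup>2 * (x * y) / 2 + b * x * w \<and> q n = b * y + w" for n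
    unfolding o'_def p_def q_def h_def by (rule entries[OF lie_alg_mat_exp[OF X(1)]])
  have o0: "o' \<longlonglongrightarrow> 0"
    using tendsto_mult[OF recip_Suc(2) ol] by simp
  have q0: "q \<longlonglongrightarrow> 0"
    using tendsto_mult[OF recip_Suc(2) ql] by simp
  \<comment> \<open>Eliminating both \<open>b\<close> and \<open>w\<close> gives
    \<open>x p = z o' + x o' q - (y / 2) o'\<^sup>2\<close>; the products vanish in the rescaled
    limit.\<close>
  have "x * X$1$3 = z * X$1$2"
  proof (rule LIMSEQ_unique)
    show "(\<lambda>n. x * (real (Suc n) * p n)) \<longlonglongrightarrow> x * X$1$3" by (intro tendsto_mult_left pl)
    have "(\<lambda>n. z * (real (Suc n) * o' n) + x * ((real (Suc n) * o' n) * q n) - y / 2 * ((real (Suc n) * o' n) * o' n))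
        \<longlonglongrightarrow> z * X$1$2 + x * (X$1$2 * 0) - y / 2 * (X$1$2 * 0)"
      by (intro tendsto_add tendsto_diff tendsto_mult_left tendsto_mult ol q0 o0)
    moreover have "z * (real (Suc n) * o' n) + x * ((real (Suc n) * o' n) * q n) - y / 2 * ((real (Suc n) * o' n) * o' n)
        = x * (real (Suc n) * p n)" for n
    proof -
      obtain b w where "o' n = b * x" "p n = b * z + b\<^sup>2 * (x * y) / 2 + b * x * w" "q n = b * y + w"
        using rel[of n] by blast
      then have "x * p n = z * o' n + x * (o' n * q n) - y / 2 * (o' n * o' n)"
        by (simp add: power2_eq_square algebra_simps)
      then have "real (Suc n) * (x * p n) = real (Suc n) * (z * o' n + x * (o' n * q n) - y / 2 * (o' n * o' n))"
        by (simp only:)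
      then show ?thesis by (simp only: distrib_left right_diff_distrib mult_ac)
    qed
    ultimately show "(\<lambda>n. x * (real (Suc n) * p n)) \<longlonglongrightarrow> z * X$1$2" by simp
  qed
  moreover have "X$1$2 = 0" if "x = 0"
  proof -
    have "o' n = 0" for n using rel[of n] that by auto
    then show ?thesis using ol by (simp add: LIMSEQ_const_iff)
  qed
  moreover have "X$1$3 = 0" if "x = 0" "z = 0"
  proof -
    have "p n = 0" for n using rel[of n] that by auto
    then show ?thesis using pl by (simp add: LIMSEQ_const_iff)
  qed
  ultimately obtain v where v: "X$1$3 = v * z" "X$1$2 = v * x"
    using that[of "X$1$2 / x"] that[of "X$1$3 / z"] by (cases "x = 0"; cases "z = 0") (auto simp: field_simps)
  have Xd: "X$1$1 = -2" "X$3$3 = 1" using lie_diag[OF X(1), of 1] lie_diag[OF X(1), of 3] X(2) by auto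
  define g where "g c t = ut (exp (- 2 * t)) 0 0 (exp t) (c * t * exp t) (exp t)" for c t
  have gexp: "mat_exp (t *\<^sub>R ut (-2) 0 0 1 c 1) = g c t" for c t
  proof (rule mat_exp_one_parameter)
    show "g c (s + t) = g c s ** g c t" for s t
      by (simp add: g_def exp_add exp_diff exp_minus field_simps)
    show "((\<lambda>t. g c t $ i $ j) has_real_derivative ut (- 2) 0 0 1 c 1 $ i $ j) (at 0)" for i j
      unfolding g_def by (intro has_real_derivative_ut; auto intro!: derivative_eq_intros)
  qed (simp add: g_def mat_1_ut)
  have gH: "g c t \<in> H" if "ut (-2) 0 0 1 c 1 \<in> lie_alg H" for c t
    using lie_alg_mat_exp[OF that, of t] by (simp add: gexp)
  have g11: "g c t $ 2 $ 2 = exp t" for c t by (simp add: g_def)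
  have nz: "c \<noteq> 0" if "ut (-2) 0 0 1 c 1 \<in> lie_alg H" for c
  proof
    assume "c = 0"
    then have "g c t \<in> A_grp" for t
      by (auto simp: g_def A_grp_def carrier_SL3 forall_3 simp flip: exp_add)
    then show False using no_diagonal_one_parameter[OF gH[OF that] g11 U] by blast
  qed
  define c where "c = X$2$3 - v * y"
  have X': "ut (-2) 0 0 1 c 1 \<in> lie_alg H"
  proof -
    have Xeq: "X = ut (-2) (v * x) (v * z) 1 (X$2$3) 1"
      by (subst upper_tri_eq_ut[OF lie_upper[OF X(1)]]) (simp only: X(2) Xd v)
    have "X - v *\<^sub>R ut 0 x z 0 y 0 = ut (-2) 0 0 1 c 1" by (subst Xeq) (simp add: ut_scaleR ut_diff c_def)
    then show ?thesis using subspace_diff[OF S X(1) subspace_mul[OF S V(1), of v]] by simp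
  qed
  note c = nz[OF X']
  have xz: "x \<noteq> 0 \<or> z \<noteq> 0"
  proof (rule ccontr)
    assume "\<not> ?thesis"
    then have "x = 0" "z = 0" "y \<noteq> 0" using V(2) by auto
    then have "ut (-2) 0 0 1 c 1 - (c / y) *\<^sub>R ut 0 x z 0 y 0 = ut (-2) 0 0 1 0 1"
      by (simp add: ut_scaleR ut_diff)
    then show False using nz[of 0] subspace_diff[OF S X' subspace_mul[OF S V(1), of "c / y"]] by simp
  qed
  define L where "L = ln (2 :: real)"
  have L: "L \<noteq> 0" by (simp add: L_def)
  note eL = exp_ln_2[folded L_def]
  have "g c L ** ut 0 x z 0 y 0 ** g c (- L) \<in> lie_alg H"
    by (rule lie_alg_conj[OF sub cl gH[OF X'] _ V(1)]) (simp add: g_def mat_1_ut eL)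
  then have "ut 0 (x / 8) (z / 8 - c * L * x / 8) 0 y 0 \<in> lie_alg H"
    by (simp add: g_def eL) (simp add: algebra_simps)?
  then obtain b where b: "x / 8 = b * x" "y = b * y" "z / 8 - c * L * x / 8 = b * z"
    by (rule lie_nilpotent_multiple[OF X(2), rotated]) (use span in blast)+
  have x0: "x = 0"
  proof (rule ccontr)
    assume "x \<noteq> 0"
    then have "b = 1 / 8" using b(1) by simp
    have "c * L * x = 0" using b(3) unfolding \<open>b = 1 / 8\<close> by linarith
    then show False using c L \<open>x \<noteq> 0\<close> by simp
  qed
  then have z0: "z \<noteq> 0" using xz by simp
  then have "b = 1 / 8" using b x0 by simp
  then have y0: "y = 0" using b by simp
  show ?thesis
  proof (rule band_familyI[OF c gH[OF X'] g11 U])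
    have eq: "g c t ** unip x y z b = ut (exp (- 2 * t)) 0 (b * (z * exp (- 2 * t))) (exp t) (c * t * exp t) (exp t)" for t b
      by (simp add: g_def unip_def x0 y0)
    show "(norm (g c t ** unip x y z b))\<^sup>2 = sq_norm c t (b * (z * exp (- 2 * t)))" for t b
      unfolding eq norm_sq_ut sq_norm_def by simp
    show "(norm (rho (g c t ** unip x y z b)))\<^sup>2 = sq_norm_rho c t (b * (z * exp (- 2 * t)))" for t b
      unfolding eq norm_sq_rho_ut sq_norm_rho_def mult.assoc exp_products
      by (simp add: power2_eq_square exp_products(3)[of t, simplified] mult.left_commute[of "exp (- (2 * t))"])
    show "z * exp (- 2 * t) \<noteq> 0" for t using z0 by simp
  qed
qed

text \<open>The (1,3) root vector is central in N, so the unknown \<open>w\<close> affects only that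
  entry and the remaining relations are linear in \<open>b\<close>. Here the nilpotent vector may be
  the (1,2) or the (2,3) root vector.\<close>

lemma band_family_alpha_beta:
  assumes "two_dim_subgroup H 1 (\<lambda>l. if l = 2 then -2 else 1)"
    and compat: "\<And>h. h \<in> H \<Longrightarrow> \<exists>u\<in>H \<inter> N_grp. \<exists>w. h = ut (h$1$1) 0 0 (h$2$2) 0 (h$3$3) ** u ** ut 1 0 w 1 0 1"
  shows "band_family H"
proof -
  interpret two_dim_subgroup H 1 "\<lambda>l. if l = 2 then -2 else 1" by fact
  obtain X x y z where X: "X \<in> lie_alg H" "X$1$1 = 1" and V: "ut 0 x z 0 y 0 \<in> lie_alg H" "(x, y, z) \<noteq> (0, 0, 0)"
    and span: "\<And>Y. Y \<in> lie_alg H \<Longrightarrow> \<exists>a b. Y = a *\<^sub>R X + b *\<^sub>R ut 0 x z 0 y 0"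
    using lie_basis by metis
  note U = unipotent_part[OF X V span]
  have S: "subspace (lie_alg H)" by (rule lie_alg_subspace[OF sub cl])
  have entries: "\<exists>b. h$1$2 / h$1$1 = b * x \<and> h$2$3 / h$2$2 = b * y" if h: "h \<in> H" for h
  proof -
    obtain u w where u: "u \<in> H \<inter> N_grp" "h = ut (h$1$1) 0 0 (h$2$2) 0 (h$3$3) ** u ** ut 1 0 w 1 0 1"
      using compat[OF h] by blast
    then obtain b where b: "u = unip x y z b" using U by blast
    have eq: "h = ut (h$1$1) (h$1$1 * (b * x)) (h$1$1 * (w + (b * z + b\<^sup>2 * (x * y) / 2))) (h$2$2) (h$2$2 * (b * y)) (h$3$3)"
      by (subst u(2)) (simp add: b unip_def algebra_simps)
    have "h$1$2 = h$1$1 * (b * x)" "h$2$3 = h$2$2 * (b * y)"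
      by (subst eq; simp)+
    then show ?thesis using pos[OF h, of 1] pos[OF h, of 2] by (intro exI[of _ b]) simp
  qed
  define h where "h n = mat_exp ((1 / real (Suc n)) *\<^sub>R X)" for n
  define p where "p n = h n $ 1 $ 2 / h n $ 1 $ 1" for n
  define q where "q n = h n $ 2 $ 3 / h n $ 2 $ 2" for n
  have pl: "(\<lambda>n. real (Suc n) * p n) \<longlonglongrightarrow> X$1$2" and ql: "(\<lambda>n. real (Suc n) * q n) \<longlonglongrightarrow> X$2$3"
    unfolding p_def q_def h_def by (intro unipotent_factor_limit[OF X(1)]; simp)+
  have rel: "\<exists>b. p n = b * x \<and> q n = b * y" for n
    unfolding p_def q_def h_def by (rule entries[OF lie_alg_mat_exp[OF X(1)]])
  have "y * X$1$2 = x * X$2$3"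
  proof (rule LIMSEQ_unique)
    show "(\<lambda>n. y * (real (Suc n) * p n)) \<longlonglongrightarrow> y * X$1$2" by (intro tendsto_mult_left pl)
    have "(\<lambda>n. x * (real (Suc n) * q n)) \<longlonglongrightarrow> x * X$2$3" by (intro tendsto_mult_left ql)
    moreover have "x * (real (Suc n) * q n) = y * (real (Suc n) * p n)" for n
      using rel[of n] by auto
    ultimately show "(\<lambda>n. y * (real (Suc n) * p n)) \<longlonglongrightarrow> x * X$2$3" by (simp only:)
  qed
  moreover have "X$1$2 = 0" if "x = 0"
  proof -
    have "p n = 0" for n using rel[of n] that by auto
    then show ?thesis using pl by (simp add: LIMSEQ_const_iff)
  qed
  moreover have "X$2$3 = 0" if "y = 0"
  proof -
    have "q n = 0" for n using rel[of n] that by auto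
    then show ?thesis using ql by (simp add: LIMSEQ_const_iff)
  qed
  ultimately obtain v where v: "X$1$2 = v * x" "X$2$3 = v * y"
    using that[of "X$1$2 / x"] that[of "X$2$3 / y"] by (cases "x = 0"; cases "y = 0") (auto simp: field_simps)
  have Xd: "X$2$2 = -2" "X$3$3 = 1" using lie_diag[OF X(1), of 2] lie_diag[OF X(1), of 3] X(2) by auto
  define g where "g c t = ut (exp t) 0 (c * t * exp t) (exp (- 2 * t)) 0 (exp t)" for c t
  have gexp: "mat_exp (t *\<^sub>R ut 1 0 c (-2) 0 1) = g c t" for c t
  proof (rule mat_exp_one_parameter)
    show "g c (s + t) = g c s ** g c t" for s t
      by (simp add: g_def exp_add exp_diff exp_minus field_simps)
    show "((\<lambda>t. g c t $ i $ j) has_real_derivative ut 1 0 c (- 2) 0 1 $ i $ j) (at 0)" for i j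
      unfolding g_def by (intro has_real_derivative_ut; auto intro!: derivative_eq_intros)
  qed (simp add: g_def mat_1_ut)
  have gH: "g c t \<in> H" if "ut 1 0 c (-2) 0 1 \<in> lie_alg H" for c t
    using lie_alg_mat_exp[OF that, of t] by (simp add: gexp)
  have g11: "g c t $ 1 $ 1 = exp t" for c t by (simp add: g_def)
  have nz: "c \<noteq> 0" if "ut 1 0 c (-2) 0 1 \<in> lie_alg H" for c
  proof
    assume "c = 0"
    then have "g c t \<in> A_grp" for t
      by (auto simp: g_def A_grp_def carrier_SL3 forall_3 simp flip: exp_add)
    then show False using no_diagonal_one_parameter[OF gH[OF that] g11 U] by blast
  qed
  define c where "c = X$1$3 - v * z"
  have X': "ut 1 0 c (-2) 0 1 \<in> lie_alg H"
  proof -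
    have Xeq: "X = ut 1 (v * x) (X$1$3) (-2) (v * y) 1"
      by (subst upper_tri_eq_ut[OF lie_upper[OF X(1)]]) (simp only: X(2) Xd v)
    have "X - v *\<^sub>R ut 0 x z 0 y 0 = ut 1 0 c (-2) 0 1" by (subst Xeq) (simp add: ut_scaleR ut_diff c_def)
    then show ?thesis using subspace_diff[OF S X(1) subspace_mul[OF S V(1), of v]] by simp
  qed
  note c = nz[OF X']
  have xy: "x \<noteq> 0 \<or> y \<noteq> 0"
  proof (rule ccontr)
    assume "\<not> ?thesis"
    then have "x = 0" "y = 0" "z \<noteq> 0" using V(2) by auto
    then have "ut 1 0 c (-2) 0 1 - (c / z) *\<^sub>R ut 0 x z 0 y 0 = ut 1 0 0 (-2) 0 1"
      by (simp add: ut_scaleR ut_diff)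
    then show False using nz[of 0] subspace_diff[OF S X' subspace_mul[OF S V(1), of "c / z"]] by simp
  qed
  define L where "L = ln (2 :: real)"
  have L: "L \<noteq> 0" by (simp add: L_def)
  note eL = exp_ln_2[folded L_def]
  \<comment> \<open>The factors 8, 1 and 1/8 on the three root spaces are distinct, so the
    eigenvector lies in one of them; (1,3) is excluded by \<open>xy\<close>.\<close>
  have "g c L ** ut 0 x z 0 y 0 ** g c (- L) \<in> lie_alg H"
    by (rule lie_alg_conj[OF sub cl gH[OF X'] _ V(1)]) (simp add: g_def mat_1_ut eL)
  then have "ut 0 (8 * x) z 0 (y / 8) 0 \<in> lie_alg H"
    by (simp add: g_def eL) (simp add: algebra_simps)?
  then obtain b where b: "8 * x = b * x" "y / 8 = b * y" "z = b * z"
    by (rule lie_nilpotent_multiple[OF X(2), rotated]) (use span in blast)+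
  have z0: "z = 0"
  proof (rule ccontr)
    assume "z \<noteq> 0"
    then have "b = 1" using b by simp
    then show False using b xy by simp
  qed
  show ?thesis
  proof (cases "x = 0")
    case False
    then have "b = 8" using b by simp
    then have y0: "y = 0" using b by simp
    show ?thesis
    proof (rule band_familyI[OF c gH[OF X'] g11 U])
      have eq: "g c t ** unip x y z b = ut (exp t) (b * (x * exp t)) (c * t * exp t) (exp (- 2 * t)) 0 (exp t)" for t b
        by (simp add: g_def unip_def y0 z0)
      show "(norm (g c t ** unip x y z b))\<^sup>2 = sq_norm c t (b * (x * exp t))" for t b
        unfolding eq norm_sq_ut sq_norm_def by simp
      show "(norm (rho (g c t ** unip x y z b)))\<^sup>2 = sq_norm_rho c t (b * (x * exp t))" for t b
        unfolding eq norm_sq_rho_ut sq_norm_rho_def mult.assoc exp_products by (simp add: power2_eq_square)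
      show "x * exp t \<noteq> 0" for t using False by simp
    qed
  next
    case True
    then have y0: "y \<noteq> 0" using xy by simp
    show ?thesis
    proof (rule band_familyI[OF c gH[OF X'] g11 U])
      have eq: "g c t ** unip x y z b = ut (exp t) 0 (c * t * exp t) (exp (- 2 * t)) (b * (y * exp (- 2 * t))) (exp t)" for t b
        by (simp add: g_def unip_def True z0)
      show "(norm (g c t ** unip x y z b))\<^sup>2 = sq_norm c t (b * (y * exp (- 2 * t)))" for t b
        unfolding eq norm_sq_ut sq_norm_def by simp
      show "(norm (rho (g c t ** unip x y z b)))\<^sup>2 = sq_norm_rho c t (b * (y * exp (- 2 * t)))" for t b
        unfolding eq norm_sq_rho_ut sq_norm_rho_def mult.assoc exp_products
        by (simp add: power2_eq_square exp_products(2)[of t, simplified] mult.left_commute[of "exp t"])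
      show "y * exp (- 2 * t) \<noteq> 0" for t using y0 by simp
    qed
  qed
qed

section \<open>Compatibility and reduction to the families\<close>

lemma AN_form:
  assumes "h \<in> A_grp <#>\<^bsub>SL3\<^esub> N_grp"
  shows "upper_tri h" "h$l$l > 0"
proof -
  obtain a n where an: "a \<in> A_grp" "n \<in> N_grp" "h = a ** n" using assms by (auto simp: set_mult_SL3)
  have u: "upper_tri a" "upper_tri n" using an by (auto simp: A_grp_def N_grp_def upper_tri_def)
  then show "upper_tri h"
    unfolding an(3) by (auto simp: upper_tri_def matrix_matrix_mult_def sum_3)
  show "h$l$l > 0"
    unfolding an(3) upper_tri_mult_diag[OF u] using an by (simp add: A_grp_def N_grp_def)
qed

text \<open>The other two factors are unipotent, so the factor in T is the diagonal of
  \<open>h\<close>. The diagonal part of every element of H belongs to T; commuting with it is the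
  entrywise relation in the last conclusion.\<close>

lemma compatible_decomposition:
  assumes sub: "subgroup H SL3" and AN: "H \<subseteq> A_grp <#>\<^bsub>SL3\<^esub> N_grp" and comp: "compatible_with_A H"
    and h: "h \<in> H"
  obtains u e where "u \<in> H \<inter> N_grp" "e \<in> N_grp" "h = ut (h$1$1) 0 0 (h$2$2) 0 (h$3$3) ** u ** e"
    "\<And>h' i j. h' \<in> H \<Longrightarrow> h'$i$i * e$i$j = h'$j$j * e$i$j"
proof -
  define T where "T = A_grp \<inter> (H <#>\<^bsub>SL3\<^esub> N_grp)"
  have T_form: "\<tau> = ut (\<tau>$1$1) 0 0 (\<tau>$2$2) 0 (\<tau>$3$3)" if "\<tau> \<in> A_grp" for \<tau>
    using that by (simp add: vec_eq_iff forall_3 A_grp_def)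
  have "h \<in> (T <#>\<^bsub>SL3\<^esub> (H \<inter> N_grp)) <#>\<^bsub>SL3\<^esub> centralizer_in_N T"
    using comp h unfolding compatible_with_A_def Let_def T_def by blast
  then obtain \<tau> u e where d: "\<tau> \<in> T" "u \<in> H \<inter> N_grp" "e \<in> centralizer_in_N T" "h = \<tau> ** u ** e"
    unfolding set_mult_SL3 by blast
  have e: "e \<in> N_grp" "\<And>t. t \<in> T \<Longrightarrow> e ** t = t ** e" using d(3) by (auto simp: centralizer_in_N_def)
  have \<tau>A: "\<tau> \<in> A_grp" using d(1) by (simp add: T_def)
  have up: "upper_tri \<tau>" "upper_tri u" "upper_tri e" "upper_tri (\<tau> ** u)"
    using \<tau>A d(2) e(1) by (auto simp: A_grp_def N_grp_def upper_tri_def matrix_matrix_mult_def sum_3)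
  have "h$l$l = \<tau>$l$l" for l
    unfolding d(4) using upper_tri_mult_diag[OF up(4,3)] upper_tri_mult_diag[OF up(1,2)] d(2) e(1)
    by (simp add: N_grp_def)
  then have \<tau>: "\<tau> = ut (h$1$1) 0 0 (h$2$2) 0 (h$3$3)" using T_form[OF \<tau>A] by simp
  have "h'$i$i * e$i$j = h'$j$j * e$i$j" if h': "h' \<in> H" for h' i j
  proof -
    obtain a n where an: "a \<in> A_grp" "n \<in> N_grp" "h' = a ** n" using AN h' by (auto simp: set_mult_SL3)
    obtain n' where n': "n ** n' = mat 1" using SL3_inverse subgroup_SL3D(1)[OF N_grp_subgroup an(2)] by metis
    then have "n' \<in> N_grp" by (rule subgroup_SL3D(4)[OF N_grp_subgroup an(2)])
    moreover have "h' ** n' = a" unfolding an(3) by (simp add: n' flip: matrix_mul_assoc)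
    ultimately have "a \<in> T" using an(1) h' unfolding T_def set_mult_SL3 by blast
    then have comm: "e ** a = a ** e" by (rule e(2))
    have ua: "upper_tri a" "upper_tri n" using an by (auto simp: A_grp_def N_grp_def upper_tri_def)
    have "h'$l$l = a$l$l" for l
      unfolding an(3) using upper_tri_mult_diag[OF ua] an(2) by (simp add: N_grp_def)
    moreover have "(e ** a)$i$j = e$i$j * a$j$j" "(a ** e)$i$j = a$i$i * e$i$j"
      using an(1) exhaust_3[of i] exhaust_3[of j] by (auto simp: matrix_matrix_mult_def sum_3 A_grp_def)
    ultimately show ?thesis using comm by (simp add: mult.commute)
  qed
  moreover have "h = ut (h$1$1) 0 0 (h$2$2) 0 (h$3$3) ** u ** e"
    unfolding \<tau>[symmetric] by (rule d(4))
  ultimately show ?thesis using that[OF d(2) e(1)] by blast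
qed

text \<open>A nontrivial centralizing factor can occur only where a root is trivial on the diagonals
  of H. If there were none, each diagonal would lie in H and H would split. As H is not in N,
  exactly one root is trivial, and each choice leads to one family lemma.\<close>

lemma band_family_nonsplit:
  assumes sub: "subgroup H SL3" and AN: "H \<subseteq> A_grp <#>\<^bsub>SL3\<^esub> N_grp"
    and cl: "closed H" and conn: "connected H" and comp: "compatible_with_A H"
    and dim: "dim (lie_alg H) = 2" and nonsplit: "H \<noteq> (H \<inter> A_grp) <#>\<^bsub>SL3\<^esub> (H \<inter> N_grp)"
  shows "band_family H"
proof -
  have upper: "upper_tri h" and pos: "h$l$l > 0" if "h \<in> H" for h l
    using AN_form[of h] AN that by auto
  have det: "h$1$1 * h$2$2 * h$3$3 = 1" if "h \<in> H" for h
    using subgroup_SL3D(1)[OF sub that] upper_tri_eq_ut[OF upper[OF that]] det_ut by metis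
  have split_sub: "(H \<inter> A_grp) <#>\<^bsub>SL3\<^esub> (H \<inter> N_grp) \<subseteq> H"
    using subgroup_SL3D(3)[OF sub] by (auto simp: set_mult_SL3)
  have notN: "\<not> H \<subseteq> N_grp"
  proof
    assume HN: "H \<subseteq> N_grp"
    have "mat 1 \<in> H \<inter> A_grp"
      using subgroup_SL3D(2)[OF sub] by (simp add: A_grp_def carrier_SL3 mat_def) (simp add: mat_1_ut flip: mat_def)
    then have "H \<subseteq> (H \<inter> A_grp) <#>\<^bsub>SL3\<^esub> (H \<inter> N_grp)"
      using HN unfolding set_mult_SL3 by (blast intro: matrix_mul_lid[symmetric])
    then show False using split_sub nonsplit by blast
  qed
  have "\<exists>i j e. (i, j) \<in> {(1, 2), (2, 3), (1, 3 :: 3)} \<and> e \<in> N_grp \<and> e$i$j \<noteq> 0 \<and>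
    (\<forall>h'\<in>H. h'$i$i * e$i$j = h'$j$j * e$i$j)"
  proof (rule ccontr)
    assume neg: "\<not> ?thesis"
    have "H \<subseteq> (H \<inter> A_grp) <#>\<^bsub>SL3\<^esub> (H \<inter> N_grp)"
    proof
      fix h assume h: "h \<in> H"
      let ?D = "ut (h$1$1) 0 0 (h$2$2) 0 (h$3$3)"
      obtain u e where u: "u \<in> H \<inter> N_grp" "e \<in> N_grp" "h = ?D ** u ** e"
        and comm: "\<And>h' i j. h' \<in> H \<Longrightarrow> h'$i$i * e$i$j = h'$j$j * e$i$j"
        using compatible_decomposition[OF sub AN comp h] by metis
      have "e$1$2 = 0" "e$2$3 = 0" "e$1$3 = 0" using neg u(2) comm by blast+
      then have "e = mat 1" using u(2) by (simp add: N_grp_def vec_eq_iff forall_3 mat_def)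
      then have hD: "h = ?D ** u" using u(3) by simp
      obtain u' where u': "u ** u' = mat 1" using SL3_inverse subgroup_SL3D(1)[OF sub] u(1) by (metis IntD1)
      then have "u' \<in> H" using subgroup_SL3D(4)[OF sub] u(1) by blast
      moreover have "?D = h ** u'" by (subst hD) (simp add: u' flip: matrix_mul_assoc)
      ultimately have "?D \<in> H" using subgroup_SL3D(3)[OF sub h] by simp
      moreover have "?D \<in> A_grp" using pos[OF h] det[OF h] by (simp add: A_grp_def carrier_SL3 forall_3)
      ultimately show "h \<in> (H \<inter> A_grp) <#>\<^bsub>SL3\<^esub> (H \<inter> N_grp)"
        using hD u(1) unfolding set_mult_SL3 by blast
    qed
    then show False using split_sub nonsplit by blast
  qed
  then obtain i j where ij: "(i, j) \<in> {(1, 2), (2, 3), (1, 3 :: 3)}" "\<And>h. h \<in> H \<Longrightarrow> h$i$i = h$j$j" by force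
  obtain h0 where h0: "h0 \<in> H" "h0 \<notin> N_grp" using notN by blast
  \<comment> \<open>A positive scalar diagonal of determinant 1 is the identity. Hence
    \<open>h0\<close> witnesses that the other two roots are nontrivial, which kills all but one
    entry of every centralizing factor.\<close>
  have h0_distinct: "\<not> (h0$1$1 = h0$2$2 \<and> h0$2$2 = h0$3$3)"
  proof
    assume eq: "h0$1$1 = h0$2$2 \<and> h0$2$2 = h0$3$3"
    then have "h0$1$1 ^ 3 = 1" using det[OF h0(1)] by (simp add: power3_eq_cube)
    then have "h0$1$1 = 1" using pos[OF h0(1), of 1] by (metis less_eq_real_def power_one power_eq_iff_eq_base zero_less_one zero_less_numeral)
    then have "h0 \<in> N_grp" using eq upper[OF h0(1)] by (simp add: N_grp_def upper_tri_def forall_3)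
    then show False using h0(2) by simp
  qed
  have lndet: "ln (h$1$1) + ln (h$2$2) + ln (h$3$3) = 0" if "h \<in> H" for h
  proof -
    have "ln (h$1$1 * h$2$2 * h$3$3) = 0" using det[OF that] by simp
    then show ?thesis using pos[OF that, of 1] pos[OF that, of 2] pos[OF that, of 3] by (simp add: ln_mult)
  qed
  have decomp: "\<exists>u\<in>H \<inter> N_grp. \<exists>e\<in>N_grp. h = ut (h$1$1) 0 0 (h$2$2) 0 (h$3$3) ** u ** e \<and>
    (\<forall>i j. h0$i$i \<noteq> h0$j$j \<longrightarrow> e$i$j = 0)" if h: "h \<in> H" for h
  proof -
    obtain u e where "u \<in> H \<inter> N_grp" "e \<in> N_grp" "h = ut (h$1$1) 0 0 (h$2$2) 0 (h$3$3) ** u ** e"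
      and comm: "\<And>h' i j. h' \<in> H \<Longrightarrow> h'$i$i * e$i$j = h'$j$j * e$i$j"
      using compatible_decomposition[OF sub AN comp h] by metis
    moreover have "e$i$j = 0" if "h0$i$i \<noteq> h0$j$j" for i j
      using comm[OF h0(1), of i j] that by simp
    ultimately show ?thesis by blast
  qed
  consider "i = 1" "j = 2" | "i = 2" "j = 3" | "i = 1" "j = 3" using ij(1) by auto
  then show ?thesis
  proof cases
    case 1
    have eq: "h$1$1 = h$2$2" if "h \<in> H" for h using ij(2)[OF that] 1 by simp
    show ?thesis
    proof (rule band_family_alpha)
      show "two_dim_subgroup H 1 (\<lambda>l. if l = 3 then - 2 else 1)"
      proof (rule two_dim_subgroup.intro)
        fix h and l :: 3 assume h: "h \<in> H"
        show "ln (h$l$l) = (if l = 3 then - 2 else 1) * ln (h$1$1)"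
          using lndet[OF h] eq[OF h] exhaust_3[of l] by auto
      qed (use sub cl conn upper pos dim notN nonsplit in auto)
      show "\<exists>u\<in>H \<inter> N_grp. \<exists>w. h = ut (h$1$1) 0 0 (h$2$2) 0 (h$3$3) ** u ** ut 1 w 0 1 0 1" if h: "h \<in> H" for h
      proof -
        obtain u e where u: "u \<in> H \<inter> N_grp" "e \<in> N_grp" "h = ut (h$1$1) 0 0 (h$2$2) 0 (h$3$3) ** u ** e"
          "\<forall>i j. h0$i$i \<noteq> h0$j$j \<longrightarrow> e$i$j = 0" using decomp[OF h] by blast
        have "e$1$3 = 0" "e$2$3 = 0" using u(4) eq[OF h0(1)] h0_distinct by auto
        then have "e = ut 1 (e$1$2) 0 1 0 1" using u(2) by (metis N_grp_iff)
        then show ?thesis using u(1,3) by metis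
      qed
    qed
  next
    case 2
    have eq: "h$2$2 = h$3$3" if "h \<in> H" for h using ij(2)[OF that] 2 by simp
    show ?thesis
    proof (rule band_family_beta)
      show "two_dim_subgroup H 2 (\<lambda>l. if l = 1 then - 2 else 1)"
      proof (rule two_dim_subgroup.intro)
        fix h and l :: 3 assume h: "h \<in> H"
        show "ln (h$l$l) = (if l = 1 then - 2 else 1) * ln (h$2$2)"
          using lndet[OF h] eq[OF h] exhaust_3[of l] by auto
      qed (use sub cl conn upper pos dim notN nonsplit in auto)
      show "\<exists>u\<in>H \<inter> N_grp. \<exists>w. h = ut (h$1$1) 0 0 (h$2$2) 0 (h$3$3) ** u ** ut 1 0 0 1 w 1" if h: "h \<in> H" for h
      proof -
        obtain u e where u: "u \<in> H \<inter> N_grp" "e \<in> N_grp" "h = ut (h$1$1) 0 0 (h$2$2) 0 (h$3$3) ** u ** e"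
          "\<forall>i j. h0$i$i \<noteq> h0$j$j \<longrightarrow> e$i$j = 0" using decomp[OF h] by blast
        have "e$1$2 = 0" "e$1$3 = 0" using u(4) eq[OF h0(1)] h0_distinct by auto
        then have "e = ut 1 0 0 1 (e$2$3) 1" using u(2) by (metis N_grp_iff)
        then show ?thesis using u(1,3) by metis
      qed
    qed
  next
    case 3
    have eq: "h$1$1 = h$3$3" if "h \<in> H" for h using ij(2)[OF that] 3 by simp
    show ?thesis
    proof (rule band_family_alpha_beta)
      show "two_dim_subgroup H 1 (\<lambda>l. if l = 2 then - 2 else 1)"
      proof (rule two_dim_subgroup.intro)
        fix h and l :: 3 assume h: "h \<in> H"
        show "ln (h$l$l) = (if l = 2 then - 2 else 1) * ln (h$1$1)"
          using lndet[OF h] eq[OF h] exhaust_3[of l] by auto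
      qed (use sub cl conn upper pos dim notN nonsplit in auto)
      show "\<exists>u\<in>H \<inter> N_grp. \<exists>w. h = ut (h$1$1) 0 0 (h$2$2) 0 (h$3$3) ** u ** ut 1 0 w 1 0 1" if h: "h \<in> H" for h
      proof -
        obtain u e where u: "u \<in> H \<inter> N_grp" "e \<in> N_grp" "h = ut (h$1$1) 0 0 (h$2$2) 0 (h$3$3) ** u ** e"
          "\<forall>i j. h0$i$i \<noteq> h0$j$j \<longrightarrow> e$i$j = 0" using decomp[OF h] by blast
        have "e$1$2 = 0" "e$2$3 = 0" using u(4) eq[OF h0(1)] h0_distinct by auto
        then have "e = ut 1 0 (e$1$3) 1 0 1" using u(2) by (metis N_grp_iff)
        then show ?thesis using u(1,3) by metis
      qed
    qed
  qed
qed

theorem proposition4p12: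
  fixes H :: "(real^3^3) set" and \<nu> \<nu>' :: "real^3^3 \<Rightarrow> real"
  assumes "is_norm \<nu>" and "is_norm \<nu>'"
    and "subgroup H SL3" and "H \<subseteq> A_grp <#>\<^bsub>SL3\<^esub> N_grp"
    and "closed H" and "connected H"
    and "compatible_with_A H"
  shows "(lie_alg H = u_alpha + u_alpha_beta \<or> lie_alg H = u_beta + u_alpha_beta
            \<longrightarrow> rho_comparable \<nu> \<nu>' H)
       \<and> (\<forall>u. subspace u \<and> dim u = 1 \<and> u \<subseteq> u_alpha + u_beta \<and> u \<notin> {u_alpha, u_beta} \<and>
              lie_alg H = ker_alpha_minus_beta + u
            \<longrightarrow> rho_comparable \<nu> \<nu>' H)
       \<and> (dim (lie_alg H) = 2 \<and> H \<noteq> (H \<inter> A_grp) <#>\<^bsub>SL3\<^esub> (H \<inter> N_grp)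
            \<longrightarrow> cartan_proj_band \<nu> \<nu>' H (\<lambda>r. (r * ln r) powr (1/2)) (\<lambda>r. r^2 / ln r))"
proof (intro conjI impI allI)
  assume "lie_alg H = u_alpha + u_alpha_beta \<or> lie_alg H = u_beta + u_alpha_beta"
  then show "rho_comparable \<nu> \<nu>' H"
    by (rule rho_comparable_abelian_unipotent[OF assms(1,2,3,5,6)])
next
  fix u assume u: "subspace u \<and> dim u = 1 \<and> u \<subseteq> u_alpha + u_beta \<and> u \<notin> {u_alpha, u_beta} \<and>
    lie_alg H = ker_alpha_minus_beta + u"
  show "rho_comparable \<nu> \<nu>' H"
    by (rule rho_comparable_ker_alpha_minus_beta[OF assms(1,2,3,5,6), of u]) (use u in auto)
next
  assume H: "dim (lie_alg H) = 2 \<and> H \<noteq> (H \<inter> A_grp) <#>\<^bsub>SL3\<^esub> (H \<inter> N_grp)"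
  then have "band_family H" by (intro band_family_nonsplit assms(3-7)) auto
  then obtain c where c: "c \<noteq> 0"
    "\<And>h. h \<in> H \<Longrightarrow> \<exists>t s. (norm h)\<^sup>2 = sq_norm c t s \<and> (norm (rho h))\<^sup>2 = sq_norm_rho c t s"
    "\<And>t s. \<exists>h\<in>H. (norm h)\<^sup>2 = sq_norm c t s \<and> (norm (rho h))\<^sup>2 = sq_norm_rho c t s"
    unfolding band_family_def by blast
  show "cartan_proj_band \<nu> \<nu>' H (\<lambda>r. (r * ln r) powr (1/2)) (\<lambda>r. r^2 / ln r)"
    using subgroup_SL3D(1)[OF assms(3)] c(2,3)
    by (rule cartan_proj_band_criterion[OF assms(1,2) c(1)])
qed

end
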